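(* Let $K$ be a compact set in $\mathbb{C}^k$. Then $$\widehat K_\Gamma=\Big(\bigcup_T\operatorname{supp}(T)\Big)\cup K,$$ where the union is taken over all positive $\Gamma$-directed currents $T$ of bidimension $(1,1)$ on $\mathbb{C}^k$, with compact support, such that $i\partial\overline\partial T\le 0$ in $\mathbb{C}^k\setminus K$.
   Context: For every $z\in\mathbb{C}^k$, $\Gamma_z$ is a closed cone of $(1,0)$-vectors at $z$ containing non-zero vectors, and $\Gamma:=\bigcup_{z}\Gamma_z$ is closed (in the $(1,0)$-tangent bundle). Define $$\mathcal P_\Gamma:=\{u\in\mathcal C^2(\mathbb{C}^k):\ \langle i\partial\overline\partial u(z), i\xi_z\wedge\bar\xi_z\rangle\ge 0\ \text{for every } z \text{ and every } \xi_z\in\Gamma_z\}.$$ A positive current $T$ of bidimension $(1,1)$ is $\Gamma$-directed if $T\wedge i\partial\overline\partial u\ge0$ for every $u\in\mathcal P_\Gamma$. The hull of a compact $K$ is $$\widehat K_\Gamma:=\{z\in\mathbb{C}^k:\ u(z)\le\sup_K u\ \text{for every } u\in\mathcal P_\Gamma\}.$$ *)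

theory Defs
  imports "HOL-Analysis.Analysis"
begin

section \<open>Smooth functions on the whole space\<close>

primrec Ck :: "nat \<Rightarrow> ('a::real_normed_vector \<Rightarrow> 'b::real_normed_vector) \<Rightarrow> bool" where
  "Ck 0 f \<longleftrightarrow> continuous_on UNIV f"
| "Ck (Suc n) f \<longleftrightarrow>
     (\<forall>x. f differentiable (at x)) \<and> (\<forall>v. Ck n (\<lambda>x. frechet_derivative f (at x) v))"

definition supp :: "('a::topological_space \<Rightarrow> 'b::zero) \<Rightarrow> 'a set" where
  "supp f = closure {x. f x \<noteq> 0}"

definition test_fun :: "('a::real_normed_vector \<Rightarrow> 'b::real_normed_vector) \<Rightarrow> bool" where
  "test_fun f \<longleftrightarrow> (\<forall>n. Ck n f) \<and> compact (supp f)"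

primrec iter_deriv ::
    "'a list \<Rightarrow> ('a::real_normed_vector \<Rightarrow> 'b::real_normed_vector) \<Rightarrow> 'a \<Rightarrow> 'b" where
  "iter_deriv [] f = f"
| "iter_deriv (v # vs) f = iter_deriv vs (\<lambda>x. frechet_derivative f (at x) v)"


section \<open>Forms of bidegree (1,1)\<close>

text \<open>The matrix-valued map \<open>\<phi>\<close> stands for the (1,1)-form
  \<open>i \<Sum>\<^sub>j\<^sub>l \<phi>(z)\<^sub>j\<^sub>l dz\<^sub>j \<and> d(cnj z\<^sub>l)\<close>.\<close>

type_synonym 'n form11 = "complex^'n \<Rightarrow> complex^'n^'n"

definition d_z :: "'n \<Rightarrow> (complex^'n::finite \<Rightarrow> complex) \<Rightarrow> complex^'n \<Rightarrow> complex" where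
  "d_z j f z = (frechet_derivative f (at z) (axis j 1)
                - \<i> * frechet_derivative f (at z) (axis j \<i>)) / 2"

definition d_zbar :: "'n \<Rightarrow> (complex^'n::finite \<Rightarrow> complex) \<Rightarrow> complex^'n \<Rightarrow> complex" where
  "d_zbar j f z = (frechet_derivative f (at z) (axis j 1)
                   + \<i> * frechet_derivative f (at z) (axis j \<i>)) / 2"

text \<open>The coefficient matrix of the form \<open>i\<partial>\<partial>\<close>-bar \<open>u\<close>.\<close>

definition ddbar :: "(complex^'n::finite \<Rightarrow> real) \<Rightarrow> 'n form11" where
  "ddbar u z = (\<chi> j l. d_z j (d_zbar l (\<lambda>w. complex_of_real (u w))) z)"

text \<open>The pairing of a (1,1)-covector \<open>M\<close> with \<open>i\<xi> \<and> cnj \<xi>\<close>, normalised so that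
  \<open>i dz\<^sub>j \<and> d(cnj z\<^sub>j)\<close> gives \<open>\<bar>\<xi>\<^sub>j\<bar>\<^sup>2\<close>.\<close>

definition pair11 :: "complex^'n^'n \<Rightarrow> complex^'n::finite \<Rightarrow> complex" where
  "pair11 M \<xi> = (\<Sum>j\<in>UNIV. \<Sum>l\<in>UNIV. M $ j $ l * \<xi> $ j * cnj (\<xi> $ l))"

definition positive_form :: "'n::finite form11 \<Rightarrow> bool" where
  "positive_form \<phi> \<longleftrightarrow> (\<forall>z \<xi>. pair11 (\<phi> z) \<xi> \<in> \<real>\<^sub>\<ge>\<^sub>0)"


section \<open>Currents of bidimension (1,1)\<close>

text \<open>A current is a functional on test forms; its values on other arguments are irrelevant.
  Continuity is stated along sequences, which for linear functionals on the space of test forms is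
  the same as continuity for the usual inductive limit topology.\<close>

type_synonym 'n current11 = "'n form11 \<Rightarrow> complex"

definition current11 :: "'n::finite current11 \<Rightarrow> bool" where
  "current11 T \<longleftrightarrow>
     (\<forall>\<phi> \<psi>. test_fun \<phi> \<longrightarrow> test_fun \<psi> \<longrightarrow> T (\<lambda>z. \<phi> z + \<psi> z) = T \<phi> + T \<psi>) \<and>
     (\<forall>c \<phi>. test_fun \<phi> \<longrightarrow> T (\<lambda>z. \<chi> j l. c * \<phi> z $ j $ l) = c * T \<phi>) \<and>
     (\<forall>\<phi> C. compact C \<longrightarrow> (\<forall>n. test_fun (\<phi> n) \<and> supp (\<phi> n) \<subseteq> C) \<longrightarrow>
        (\<forall>vs. uniform_limit UNIV (\<lambda>n. iter_deriv vs (\<phi> n)) (\<lambda>_. 0) sequentially) \<longrightarrow>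
        (\<lambda>n. T (\<phi> n)) \<longlonglongrightarrow> 0)"

definition positive_current :: "'n::finite current11 \<Rightarrow> bool" where
  "positive_current T \<longleftrightarrow>
     current11 T \<and> (\<forall>\<phi>. test_fun \<phi> \<longrightarrow> positive_form \<phi> \<longrightarrow> T \<phi> \<in> \<real>\<^sub>\<ge>\<^sub>0)"

definition current_supp :: "'n::finite current11 \<Rightarrow> (complex^'n) set" where
  "current_supp T =
     - \<Union>{U. open U \<and> (\<forall>\<phi>. test_fun \<phi> \<longrightarrow> supp \<phi> \<subseteq> U \<longrightarrow> T \<phi> = 0)}"

text \<open>A positive current has order zero, so it extends uniquely to continuous forms \<open>\<psi>\<close> with
  compact support: the value is the common limit of \<open>T \<phi>\<^sub>n\<close> over all sequences of test
  forms \<open>\<phi>\<^sub>n\<close> supported in a fixed compact set and tending uniformly to \<open>\<psi>\<close>. Such sequences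
  exist by regularisation. For currents that are not of order zero the value is unspecified.\<close>

definition current_ext :: "'n::finite current11 \<Rightarrow> 'n current11" where
  "current_ext T \<psi> = (THE c. \<forall>\<phi> C. compact C \<longrightarrow> (\<forall>n. test_fun (\<phi> n) \<and> supp (\<phi> n) \<subseteq> C) \<longrightarrow>
      uniform_limit UNIV \<phi> \<psi> sequentially \<longrightarrow> (\<lambda>n. T (\<phi> n)) \<longlonglongrightarrow> c)"

text \<open>The distribution \<open>T \<and> i\<partial>\<partial>\<close>-bar \<open>u\<close>, for \<open>u\<close> of class \<open>C\<^sup>2\<close> and \<open>T\<close> of order zero,
  evaluated at the test function \<open>h\<close>.\<close>

definition wedge_ddbar ::
    "'n::finite current11 \<Rightarrow> (complex^'n \<Rightarrow> real) \<Rightarrow> (complex^'n \<Rightarrow> real) \<Rightarrow> complex" where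
  "wedge_ddbar T u h = current_ext T (\<lambda>z. h z *\<^sub>R ddbar u z)"

text \<open>The distribution \<open>i\<partial>\<partial>\<close>-bar \<open>T\<close>.\<close>

definition ddbar_current :: "'n::finite current11 \<Rightarrow> (complex^'n \<Rightarrow> real) \<Rightarrow> complex" where
  "ddbar_current T h = T (ddbar h)"

definition nonneg_distribution_on ::
    "(complex^'n::finite) set \<Rightarrow> ((complex^'n \<Rightarrow> real) \<Rightarrow> complex) \<Rightarrow> bool" where
  "nonneg_distribution_on U D \<longleftrightarrow>
     (\<forall>h. test_fun h \<longrightarrow> supp h \<subseteq> U \<longrightarrow> (\<forall>z. h z \<ge> 0) \<longrightarrow> D h \<in> \<real>\<^sub>\<ge>\<^sub>0)"


section \<open>\<open>\<Gamma>\<close>-directed currents and hulls\<close>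

definition psh_dir :: "(complex^'n::finite \<Rightarrow> (complex^'n) set) \<Rightarrow> (complex^'n \<Rightarrow> real) set" where
  "psh_dir \<Gamma> = {u. Ck 2 u \<and> (\<forall>z. \<forall>\<xi>\<in>\<Gamma> z. pair11 (ddbar u z) \<xi> \<in> \<real>\<^sub>\<ge>\<^sub>0)}"

definition directed_current :: "(complex^'n::finite \<Rightarrow> (complex^'n) set) \<Rightarrow> 'n current11 \<Rightarrow> bool" where
  "directed_current \<Gamma> T \<longleftrightarrow>
     positive_current T \<and> (\<forall>u\<in>psh_dir \<Gamma>. nonneg_distribution_on UNIV (wedge_ddbar T u))"

text \<open>The supremum is taken in \<open>ereal\<close>, so that it is \<open>-\<infinity>\<close> when \<open>K\<close> is empty.\<close>

definition hull_dir ::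
    "(complex^'n::finite \<Rightarrow> (complex^'n) set) \<Rightarrow> (complex^'n) set \<Rightarrow> (complex^'n) set" where
  "hull_dir \<Gamma> K = {z. \<forall>u\<in>psh_dir \<Gamma>. ereal (u z) \<le> (SUP w\<in>K. ereal (u w))}"

end

theory Submission
  imports Defs
begin

text \<open>Let \<open>z\<^sub>0\<close> lie in the hull but not in \<open>K\<close>. For a (1,1)-form \<open>\<phi>\<close> let \<open>p \<phi>\<close> be the infimum of
  \<open>max u - u z\<^sub>0\<close>, the maximum taken over \<open>K\<close>, over all test functions \<open>u\<close> whose Levi form
  dominates \<open>\<phi>\<close> on \<open>\<Gamma>\<close> over a large ball. Adding to \<open>u\<close> a large multiple of a convex function of
  \<open>\<bar>z\<bar>\<^sup>2\<close> that vanishes on \<open>K\<close> and at \<open>z\<^sub>0\<close> turns local into global positivity along \<open>\<Gamma>\<close>, so the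
  definition of the hull makes \<open>p\<close> a finite sublinear functional. A linear functional below \<open>p\<close> is
  a \<open>\<Gamma>\<close>-directed current \<open>T\<close>; testing it on \<open>i\<partial>\<partial>\<close>-bar \<open>u\<close> for \<open>u \<ge> 0\<close> supported off \<open>K\<close> gives at most
  \<open>- u z\<^sub>0\<close>, which is the required sign and also puts \<open>z\<^sub>0\<close> into the support.

  Conversely let \<open>u z\<^sub>0 > c > u\<close> on \<open>K\<close> with \<open>z\<^sub>0\<close> in the support of \<open>T\<close>. The function
  \<open>v = (u + \<epsilon>\<bar>z\<bar>\<^sup>2 - c)\<^sub>+\<^sup>3\<close> vanishes near \<open>K\<close>, so \<open>T \<and> i\<partial>\<partial>\<close>-bar \<open>v\<close> is a positive measure of
  nonpositive mass, hence zero. Near \<open>z\<^sub>0\<close> the Levi form of \<open>v\<close> is strictly positive along \<open>\<Gamma>\<close>, so a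
  small multiple of \<open>\<bar>z\<bar>\<^sup>2\<close>, cut off near \<open>z\<^sub>0\<close>, can be subtracted; thus the trace measure of \<open>T\<close>
  vanishes near \<open>z\<^sub>0\<close>, a contradiction.\<close>

section \<open>Calculus of finitely differentiable functions\<close>

text \<open>Two regularities have to be reconciled: functions in \<open>psh_dir \<Gamma>\<close> are
  only C^2, while currents and the sign condition on \<open>ddbar_current\<close> see smooth forms
  only. The bridge is that a positive current is dominated by its trace measure, so it extends to
  continuous forms, and that mollification commutes with \<open>ddbar\<close>. In the first half the
  functional is built on all bounded continuous forms instead of test forms. A cut-off multiple of
  the squared norm dominates any given form on the ball, so \<open>p\<close> is at most a constant
  times the sup norm; the resulting current has order zero from the start and its extension is plain
  evaluation. The competitors \<open>u\<close> have compact support, hence bounded Levi forms, and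
  one multiple of the convex function absorbs them on the whole exterior of the ball. In the second
  half the mass of \<open>T\<close> wedged with the Levi form of \<open>v\<close> is read off from a
  cutoff \<open>h\<close> equal to 1 near the support of \<open>T\<close>. The product
  \<open>h v\<close> is an admissible function for the sign condition, up to mollification, because
  \<open>v\<close> vanishes near \<open>K\<close>.\<close>

lemma Ck_SucI:
  assumes "\<And>x. (f has_derivative D x) (at x)" "\<And>v. Ck n (\<lambda>x. D x v)"
  shows "Ck (Suc n) f"
proof -
  have "frechet_derivative f (at x) = D x" for x
    using frechet_derivative_at[OF assms(1)[of x]] by simp
  then show ?thesis
    using assms by (auto simp: differentiable_def)
qed

lemma Ck_has_derivative:
  assumes "Ck (Suc n) f"
  shows "(f has_derivative frechet_derivative f (at x)) (at x)"
  using assms frechet_derivative_works by auto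

lemma Ck_Suc_frechet_derivative: "Ck (Suc n) f \<Longrightarrow> Ck n (\<lambda>x. frechet_derivative f (at x) v)"
  by simp

lemma Ck_SucD: "Ck (Suc n) f \<Longrightarrow> Ck n f"
proof (induction n arbitrary: f)
  case 0
  then show ?case
    by (simp add: continuous_at_imp_continuous_on differentiable_imp_continuous_within)
next
  case (Suc n)
  then show ?case by (metis Ck.simps(2))
qed

lemma Ck_mono: "Ck n f \<Longrightarrow> m \<le> n \<Longrightarrow> Ck m f"
  by (induction n) (auto simp del: Ck.simps dest: Ck_SucD simp: le_Suc_eq)

lemma Ck_imp_continuous_on: "Ck n f \<Longrightarrow> continuous_on A f"
  using Ck_mono[of n f 0] continuous_on_subset by auto

lemma Ck_const [simp]: "Ck n (\<lambda>x. c)"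
  by (induction n arbitrary: c) auto

lemma Ck_linear_compose:
  assumes "bounded_linear g" "Ck n f"
  shows "Ck n (\<lambda>x. g (f x))"
  using assms(2)
proof (induction n arbitrary: f)
  case 0
  then show ?case by (simp add: bounded_linear.continuous_on[OF assms(1)])
next
  case (Suc n)
  show ?case
    by (rule Ck_SucI[OF bounded_linear.has_derivative[OF assms(1) Ck_has_derivative[OF Suc.prems]]])
      (rule Suc.IH, rule Ck_Suc_frechet_derivative[OF Suc.prems])
qed

lemma Ck_add:
  assumes "Ck n f" "Ck n g"
  shows "Ck n (\<lambda>x. f x + g x)"
  using assms
proof (induction n arbitrary: f g)
  case 0
  then show ?case by (auto intro: continuous_intros)
next
  case (Suc n)
  show ?case
    by (rule Ck_SucI[OF has_derivative_add[OF Ck_has_derivative[OF Suc.prems(1)]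
        Ck_has_derivative[OF Suc.prems(2)]]])
      (rule Suc.IH; rule Ck_Suc_frechet_derivative, fact Suc.prems)
qed

lemma Ck_minus: "Ck n f \<Longrightarrow> Ck n (\<lambda>x. - f x)"
  by (rule Ck_linear_compose[OF bounded_linear_minus[OF bounded_linear_ident]])

lemma Ck_diff: "Ck n f \<Longrightarrow> Ck n g \<Longrightarrow> Ck n (\<lambda>x. f x - g x)"
  using Ck_add[of n f "\<lambda>x. - g x"] Ck_minus by auto

lemma Ck_sum: "(\<And>i. i \<in> I \<Longrightarrow> Ck n (f i)) \<Longrightarrow> Ck n (\<lambda>x. \<Sum>i\<in>I. f i x)"
  by (induction I rule: infinite_finite_induct) (auto intro!: Ck_add)

lemma Ck_bilinear:
  assumes "bounded_bilinear P" "Ck n f" "Ck n g"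
  shows "Ck n (\<lambda>x. P (f x) (g x))"
  using assms(2,3)
proof (induction n arbitrary: f g)
  case 0
  then show ?case by (simp add: bounded_bilinear.continuous_on[OF assms(1)])
next
  case (Suc n)
  show ?case
    by (rule Ck_SucI[OF bounded_bilinear.FDERIV[OF assms(1) Ck_has_derivative[OF Suc.prems(1)]
        Ck_has_derivative[OF Suc.prems(2)]]])
      (rule Ck_add; rule Suc.IH;
        (rule Ck_SucD, fact Suc.prems | rule Ck_Suc_frechet_derivative, fact Suc.prems))
qed

lemmas Ck_scaleR = Ck_bilinear[OF bounded_bilinear_scaleR]
lemmas Ck_mult = Ck_bilinear[OF bounded_bilinear_mult]

lemma Ck_bounded_linear: "bounded_linear L \<Longrightarrow> Ck n L"
proof (cases n)
  case (Suc m)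
  assume "bounded_linear L"
  then show ?thesis
    unfolding Suc by (intro Ck_SucI) (auto intro: bounded_linear_imp_has_derivative)
qed (auto intro: linear_continuous_on)

lemma Ck_ident: "Ck n (\<lambda>x. x)"
  by (rule Ck_bounded_linear[OF bounded_linear_ident])

lemma has_derivative_compose_real:
  fixes g :: "real \<Rightarrow> 'b::real_normed_vector" and f :: "'a::real_normed_vector \<Rightarrow> real"
  assumes "(f has_derivative D) (at x)" "g differentiable (at (f x))"
  shows "((\<lambda>x. g (f x)) has_derivative (\<lambda>v. D v *\<^sub>R frechet_derivative g (at (f x)) 1)) (at x)"
proof -
  have *: "(g has_derivative frechet_derivative g (at (f x))) (at (f x))"
    using assms(2) frechet_derivative_works by blast
  have "frechet_derivative g (at (f x)) t = t *\<^sub>R frechet_derivative g (at (f x)) 1" for t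
    using linear_scale[OF has_derivative_linear[OF *], of t 1] by simp
  then have "frechet_derivative g (at (f x)) \<circ> D =
      (\<lambda>v. D v *\<^sub>R frechet_derivative g (at (f x)) 1)"
    unfolding fun_eq_iff o_apply by blast
  with diff_chain_at[OF assms(1) *] show ?thesis
    by (simp only: o_def)
qed

text \<open>The induction generalises \<open>g\<close> alone: by the chain rule the derivative is a
  derivative of \<open>f\<close> times a derivative of \<open>g\<close> evaluated at the same
  \<open>f\<close>.\<close>

lemma Ck_compose_real:
  fixes g :: "real \<Rightarrow> 'b::real_normed_vector" and f :: "'a::real_normed_vector \<Rightarrow> real"
  assumes "Ck n g" "Ck n f"
  shows "Ck n (\<lambda>x. g (f x))"
  using assms
proof (induction n arbitrary: g)
  case 0
  then show ?case
    by (auto intro: continuous_on_compose2)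
next
  case (Suc n)
  have "((\<lambda>x. g (f x)) has_derivative
      (\<lambda>v. frechet_derivative f (at x) v *\<^sub>R frechet_derivative g (at (f x)) 1)) (at x)" for x
    by (rule has_derivative_compose_real[OF Ck_has_derivative[OF Suc.prems(2)]])
      (use Suc.prems in auto)
  then show ?case
  proof (rule Ck_SucI)
    show "Ck n (\<lambda>x. frechet_derivative f (at x) v *\<^sub>R frechet_derivative g (at (f x)) 1)" for v
      by (rule Ck_scaleR[OF Ck_Suc_frechet_derivative[OF Suc.prems(2)]
          Suc.IH[OF Ck_Suc_frechet_derivative[OF Suc.prems(1)] Ck_SucD[OF Suc.prems(2)]]])
  qed
qed

lemma Ck_inner_self: "Ck n (\<lambda>x::'a::real_inner. x \<bullet> x)"
  by (rule Ck_bilinear[OF bounded_bilinear_inner Ck_ident Ck_ident])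

subsection \<open>A flat function\<close>

text \<open>The parameter \<open>n\<close> makes the family closed under differentiation: the
  derivative of a member is a combination of two others, so one induction shows all of them
  smooth.\<close>

definition flat :: "nat \<Rightarrow> real \<Rightarrow> real" where
  "flat n t = (if t > 0 then exp (- inverse t) / t ^ n else 0)"

text \<open>One term of the exponential series suffices:
  \<open>x ^ Suc n / fact (Suc n) \<le> exp x\<close> at \<open>x = inverse t\<close>.\<close>

lemma flat_bound:
  fixes t :: real
  assumes "t > 0"
  shows "exp (- inverse t) / t ^ n \<le> fact (Suc n) * t"
proof -
  let ?x = "inverse t"
  have sm: "(\<lambda>k. ?x ^ k / fact k) sums exp ?x"
    using exp_converges[of ?x] by (simp only: real_scaleR_def divide_inverse_commute)
  have "?x ^ Suc n / fact (Suc n) \<le> exp ?x"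
    using sum_le_suminf[OF sums_summable[OF sm], of "{Suc n}"] assms sums_unique[OF sm]
    by (simp del: power_Suc fact_Suc)
  then have "?x ^ Suc n \<le> exp ?x * fact (Suc n)"
    by (subst (asm) pos_divide_le_eq) auto
  then have "?x ^ Suc n * exp (- ?x) * t \<le> exp ?x * fact (Suc n) * exp (- ?x) * t"
    using assms by (intro mult_right_mono) auto
  then show ?thesis
    using assms by (simp add: exp_minus field_simps del: fact_Suc)
qed

lemma flat_has_derivative:
  "(flat n has_real_derivative flat (n + 2) t - n * flat (Suc n) t) (at t)"
proof -
  consider "t > 0" | "t < 0" | "t = 0" by linarith
  then show ?thesis
  proof cases
    case 1
    have "((\<lambda>t. exp (- inverse t) / t ^ n) has_real_derivative
        flat (n + 2) t - n * flat (Suc n) t) (at t)"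
      using 1 by (auto intro!: derivative_eq_intros simp: flat_def field_simps power2_eq_square)
        (cases n; simp add: field_simps)
    then show ?thesis
      by (rule has_field_derivative_transform_within_open[of _ _ _ "{0<..}"])
        (use 1 in \<open>auto simp: flat_def\<close>)
  next
    case 2
    have "((\<lambda>t. 0) has_real_derivative flat (n + 2) t - n * flat (Suc n) t) (at t)"
      using 2 by (auto simp: flat_def)
    then show ?thesis
      by (rule has_field_derivative_transform_within_open[of _ _ _ "{..<0}"])
        (use 2 in \<open>auto simp: flat_def\<close>)
  next
    case 3
    \<comment> \<open>For positive \<open>h\<close> the difference quotient is
      \<open>flat (Suc n) h\<close>, so the bound is used with \<open>Suc n\<close> and produces the
      larger factorial.\<close>
    have "norm (flat n h / h) \<le> fact (Suc (Suc n)) * \<bar>h\<bar>" for h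
    proof (cases "h > 0")
      case True
      then show ?thesis
        using flat_bound[of h "Suc n"] by (simp add: flat_def field_simps del: fact_Suc)
    qed (auto simp: flat_def mult_nonneg_nonpos simp del: fact_Suc)
    moreover have "((\<lambda>h. fact (Suc (Suc n)) * \<bar>h\<bar>) \<longlongrightarrow> (0::real)) (at 0)"
      by (auto intro!: tendsto_eq_intros)
    ultimately have "((\<lambda>h. flat n h / h) \<longlongrightarrow> 0) (at 0)"
      by (intro Lim_null_comparison[of "\<lambda>h. flat n h / h"]) auto
    then show ?thesis
      using 3 by (simp add: DERIV_def flat_def)
  qed
qed

lemma Ck_flat: "Ck m (flat n)"
proof (induction m arbitrary: n)
  case 0
  show ?case
    using DERIV_isCont[OF flat_has_derivative] by (auto intro!: continuous_at_imp_continuous_on)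
next
  case (Suc m)
  show ?case
    by (rule Ck_SucI[OF flat_has_derivative[unfolded has_field_derivative_def]])
      (intro Ck_mult Ck_diff Ck_const Suc.IH)
qed

lemma flat_nonneg: "0 \<le> flat n t"
  by (simp add: flat_def)

section \<open>Mollification\<close>

text \<open>Stated for a bilinear \<open>P\<close> so that it serves twice: with
  \<open>scaleR\<close> the derivative falls on the mollified function, with the flipped product it
  falls on the kernel. The other factor \<open>w\<close> is merely continuous.\<close>

lemma has_derivative_integral_bilinear:
  fixes g :: "'a::euclidean_space \<Rightarrow> 'c::real_normed_vector"
    and w :: "'a \<Rightarrow> 'd::real_normed_vector"
    and P :: "'d \<Rightarrow> 'c \<Rightarrow> 'b::banach"
  assumes P: "bounded_bilinear P" and g: "Ck 1 g" and w: "continuous_on UNIV w"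
  shows "((\<lambda>x. integral (cbox a b) (\<lambda>y. P (w y) (g (x - y)))) has_derivative
    (\<lambda>v. integral (cbox a b) (\<lambda>y. P (w y) (frechet_derivative g (at (x - y)) v)))) (at x)"
proof -
  let ?D = "\<lambda>x y. Blinfun (\<lambda>v. P (w y) (frechet_derivative g (at (x - y)) v))"
  have der: "((\<lambda>x. P (w y) (g (x - y))) has_derivative
      (\<lambda>v. P (w y) (frechet_derivative g (at (x - y)) v))) (at x)" for x y
  proof (rule bounded_linear.has_derivative[OF bounded_bilinear.bounded_linear_right[OF P]])
    have "((\<lambda>x. x - y) has_derivative (\<lambda>v. v)) (at x)"
      by (auto intro!: derivative_eq_intros)
    then show "((\<lambda>x. g (x - y)) has_derivative frechet_derivative g (at (x - y))) (at x)"
      using diff_chain_at[of "\<lambda>x. x - y" "\<lambda>v. v" x g] Ck_has_derivative[of 0 g] g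
      by (simp add: o_def One_nat_def[symmetric] del: One_nat_def)
  qed
  have D: "blinfun_apply (?D x y) = (\<lambda>v. P (w y) (frechet_derivative g (at (x - y)) v))" for x y
    by (rule bounded_linear_Blinfun_apply[OF has_derivative_bounded_linear[OF der]])
  \<comment> \<open>\<open>Ck 1\<close> gives continuity of the derivative only in each fixed
    direction; in finite dimension this yields continuity in operator norm, as differentiation under
    the integral demands.\<close>
  have contD: "continuous_on (UNIV \<times> cbox a b) (\<lambda>(x, y). ?D x y)"
  proof (rule continuous_on_blinfun_componentwise)
    fix i :: 'a
    have *: "continuous_on UNIV (\<lambda>x. frechet_derivative g (at x) i)"
      using g by simp
    have "continuous_on (UNIV \<times> cbox a b)
        (\<lambda>p. P (w (snd p)) (frechet_derivative g (at (fst p - snd p)) i))"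
      by (intro bounded_bilinear.continuous_on[OF P] continuous_on_compose2[OF w]
          continuous_on_compose2[OF *] continuous_intros) auto
    then show "continuous_on (UNIV \<times> cbox a b) (\<lambda>p. blinfun_apply (case p of (x, y) \<Rightarrow> ?D x y) i)"
      by (simp add: case_prod_beta D)
  qed
  have cont: "continuous_on (cbox a b) (\<lambda>y. P (w y) (g (x - y)))" for x
    by (intro bounded_bilinear.continuous_on[OF P] continuous_on_subset[OF w]
        continuous_on_compose2[OF Ck_imp_continuous_on[OF g, of UNIV]] continuous_intros) auto
  have contDx: "continuous_on (cbox a b) (?D x)"
    using continuous_on_compose2[OF contD, of "cbox a b" "\<lambda>y. (x, y)"]
    by (simp add: continuous_on_Pair image_subset_iff)
  have "((\<lambda>x. integral (cbox a b) (\<lambda>y. P (w y) (g (x - y)))) has_derivative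
      integral (cbox a b) (?D x)) (at x within UNIV)"
    by (rule leibniz_rule[OF _ integrable_continuous[OF cont] contD])
      (use der in \<open>auto simp: D\<close>)
  moreover have "blinfun_apply (integral (cbox a b) (?D x)) =
      (\<lambda>v. integral (cbox a b) (\<lambda>y. P (w y) (frechet_derivative g (at (x - y)) v)))"
    by (subst blinfun_apply_integral[OF integrable_continuous[OF contDx], abs_def])
      (simp add: D fun_eq_iff)
  ultimately show ?thesis by simp
qed

definition mollify :: "('a::euclidean_space \<Rightarrow> real) \<Rightarrow> ('a \<Rightarrow> 'b::banach) \<Rightarrow> 'a \<Rightarrow> 'b" where
  "mollify \<rho> f x = integral UNIV (\<lambda>y. \<rho> y *\<^sub>R f (x - y))"

lemma integral_UNIV_cbox:
  fixes g :: "'a::euclidean_space \<Rightarrow> 'b::banach"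
  assumes "\<And>y. y \<notin> cbox a b \<Longrightarrow> g y = 0"
  shows "integral UNIV g = integral (cbox a b) g"
proof -
  have "integral UNIV g = integral UNIV (\<lambda>x. if x \<in> cbox a b then g x else 0)"
    by (rule arg_cong[where f = "integral UNIV"]) (use assms in auto)
  also have "\<dots> = integral (cbox a b) g"
    by (rule integral_restrict_UNIV)
  finally show ?thesis .
qed

text \<open>This substitution makes convolution commutative, which is how a derivative gets onto the
  kernel.\<close>

lemma integral_UNIV_reflect:
  fixes g :: "'a::euclidean_space \<Rightarrow> 'b::banach"
  assumes "continuous_on UNIV g" and zero: "\<And>y. y \<notin> cbox a b \<Longrightarrow> g y = 0"
  shows "integral UNIV (\<lambda>y. g (x - y)) = integral UNIV g"
proof -
  have "(g has_integral integral (cbox a b) g) (cbox a b)"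
    by (intro integrable_integral integrable_continuous continuous_on_subset[OF assms(1)] subset_UNIV)
  from has_integral_affinity[OF this, of "-1" x]
  have "((\<lambda>y. g (x - y)) has_integral integral (cbox a b) g)
      ((\<lambda>y. (1 / - 1) *\<^sub>R y + - ((1 / - 1) *\<^sub>R x)) ` cbox a b)"
    by (simp add: algebra_simps)
  then have "((\<lambda>y. g (x - y)) has_integral integral (cbox a b) g) UNIV"
  proof (rule has_integral_on_superset)
    fix y
    assume *: "y \<notin> (\<lambda>y. (1 / - 1) *\<^sub>R y + - ((1 / - 1) *\<^sub>R x)) ` cbox a b"
    have "y = (1 / - 1) *\<^sub>R (x - y) + - ((1 / - 1) *\<^sub>R x)" by simp
    with * have "x - y \<notin> cbox a b" by blast
    then show "g (x - y) = 0" by (rule zero)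
  qed auto
  then show ?thesis
    using integral_UNIV_cbox[of a b g] zero by (simp add: integral_unique)
qed

lemma compact_supp_cbox:
  fixes f :: "'a::euclidean_space \<Rightarrow> 'b::real_normed_vector"
  assumes "compact (supp f)"
  obtains a b where "\<And>y. y \<notin> cbox a b \<Longrightarrow> f y = 0"
proof -
  obtain a where "supp f \<subseteq> cbox (-a) a"
    using bounded_subset_cbox_symmetric[OF compact_imp_bounded[OF assms]] .
  then have "y \<notin> cbox (-a) a \<Longrightarrow> f y = 0" for y
    using closure_subset[of "{x. f x \<noteq> 0}"] by (auto simp: supp_def)
  then show ?thesis by (rule that)
qed

lemma mollify_integral:
  assumes "\<And>y. y \<notin> cbox a b \<Longrightarrow> \<rho> y = 0"
  shows "mollify \<rho> f x = integral (cbox a b) (\<lambda>y. \<rho> y *\<^sub>R f (x - y))"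
  unfolding mollify_def by (rule integral_UNIV_cbox) (simp add: assms)

lemma mollify_integral':
  assumes "\<And>y. y \<notin> cbox a b \<Longrightarrow> \<rho> y = 0" "\<And>y. y \<notin> cbox c d \<Longrightarrow> f y = 0"
    and "continuous_on UNIV \<rho>" "continuous_on UNIV f"
  shows "mollify \<rho> f x = integral (cbox c d) (\<lambda>y. \<rho> (x - y) *\<^sub>R f y)"
proof -
  have "continuous_on UNIV (\<lambda>y. \<rho> y *\<^sub>R f (x - y))"
    by (intro continuous_intros assms(3) continuous_on_compose2[OF assms(4)]) auto
  from integral_UNIV_reflect[OF this, of a b x]
  have "mollify \<rho> f x = integral UNIV (\<lambda>y. \<rho> (x - y) *\<^sub>R f y)"
    by (simp add: mollify_def assms(1))
  also have "\<dots> = integral (cbox c d) (\<lambda>y. \<rho> (x - y) *\<^sub>R f y)"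
    by (rule integral_UNIV_cbox) (simp add: assms(2))
  finally show ?thesis .
qed

section \<open>Derivatives of mollifications\<close>

lemma mollify_has_derivative_right:
  fixes f :: "'a::euclidean_space \<Rightarrow> 'b::banach"
  assumes "continuous_on UNIV \<rho>" "compact (supp \<rho>)" "Ck 1 f"
  shows "(mollify \<rho> f has_derivative (\<lambda>v. mollify \<rho> (\<lambda>x. frechet_derivative f (at x) v) x)) (at x)"
proof -
  obtain a b where ab: "\<And>y. y \<notin> cbox a b \<Longrightarrow> \<rho> y = 0"
    using compact_supp_cbox[OF assms(2)] by blast
  have mollify_integral_cbox:
      "mollify \<rho> g = (\<lambda>x. integral (cbox a b) (\<lambda>y. \<rho> y *\<^sub>R g (x - y)))" for g :: "'a \<Rightarrow> 'b"
    by (rule ext) (rule mollify_integral[OF ab])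
  show ?thesis
    unfolding mollify_integral_cbox
    by (rule has_derivative_integral_bilinear[OF bounded_bilinear_scaleR assms(3,1)])
qed

lemma supp_frechet_derivative: "supp (\<lambda>x. frechet_derivative f (at x) v) \<subseteq> supp f"
proof -
  have "frechet_derivative f (at x) v = 0" if "x \<notin> supp f" for x
  proof -
    have "((\<lambda>_. 0) has_derivative (\<lambda>_. 0)) (at x)" by simp
    then have "(f has_derivative (\<lambda>_. 0)) (at x)"
      by (rule has_derivative_transform_within_open[of _ _ _ _ "- supp f"])
        (use that closure_subset[of "{x. f x \<noteq> 0}"] in \<open>auto simp: supp_def\<close>)
    then show ?thesis
      using frechet_derivative_at by metis
  qed
  then have "{x. frechet_derivative f (at x) v \<noteq> 0} \<subseteq> supp f" by blast
  then show ?thesis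
    unfolding supp_def by (intro closure_minimal) auto
qed

lemma compact_supp_subset: "supp f \<subseteq> C \<Longrightarrow> compact C \<Longrightarrow> compact (supp f)"
  unfolding supp_def by (metis compact_Int_closed closed_closure inf.absorb_iff2)

lemma mollify_Ck_right:
  fixes f :: "'a::euclidean_space \<Rightarrow> 'b::banach"
  assumes "continuous_on UNIV \<rho>" "compact (supp \<rho>)" "Ck n f"
  shows "Ck n (mollify \<rho> f)"
  using assms(3)
proof (induction n arbitrary: f)
  case 0
  obtain a b where ab: "\<And>y. y \<notin> cbox a b \<Longrightarrow> \<rho> y = 0"
    using compact_supp_cbox[OF assms(2)] by blast
  have mollify_integral_cbox:
      "mollify \<rho> g = (\<lambda>x. integral (cbox a b) (\<lambda>y. \<rho> y *\<^sub>R g (x - y)))" for g :: "'a \<Rightarrow> 'b"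
    by (rule ext) (rule mollify_integral[OF ab])
  have "continuous_on (UNIV \<times> cbox a b) (\<lambda>(x, y). \<rho> y *\<^sub>R f (x - y))"
    unfolding case_prod_beta
    by (rule continuous_on_scaleR[OF continuous_on_compose2[OF assms(1) continuous_on_snd]
          continuous_on_compose2[OF Ck_imp_continuous_on[OF 0, of UNIV]]])
      (auto intro!: continuous_intros)
  from integral_continuous_on_param[OF this] show ?case
    by (simp add: mollify_integral_cbox)
next
  case (Suc n)
  have "Ck 1 f" by (rule Ck_mono[OF Suc.prems]) simp
  then show ?case
    by (rule Ck_SucI[OF mollify_has_derivative_right[OF assms(1,2)]])
      (rule Suc.IH[OF Ck_Suc_frechet_derivative[OF Suc.prems]])
qed

text \<open>This is the smoothing effect: \<open>f\<close> is only continuous. Its compact support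
  puts the reflected integral on a box independent of \<open>x\<close>.\<close>

lemma mollify_has_derivative_left:
  assumes "Ck 1 \<rho>" "compact (supp \<rho>)" "continuous_on UNIV f" "compact (supp f)"
  shows "(mollify \<rho> f has_derivative (\<lambda>v. mollify (\<lambda>x. frechet_derivative \<rho> (at x) v) f x)) (at x)"
proof -
  obtain a b where ab: "\<And>y. y \<notin> cbox a b \<Longrightarrow> \<rho> y = 0"
    using compact_supp_cbox[OF assms(2)] by blast
  obtain c d where cd: "\<And>y. y \<notin> cbox c d \<Longrightarrow> f y = 0"
    using compact_supp_cbox[OF assms(4)] by blast
  have 1: "mollify \<rho> f = (\<lambda>x. integral (cbox c d) (\<lambda>y. \<rho> (x - y) *\<^sub>R f y))"
    using mollify_integral'[OF ab cd Ck_imp_continuous_on[OF assms(1)] assms(3)] by auto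
  have 2: "mollify (\<lambda>x. frechet_derivative \<rho> (at x) v) f x =
      integral (cbox c d) (\<lambda>y. frechet_derivative \<rho> (at (x - y)) v *\<^sub>R f y)" for v
  proof -
    have "compact (supp (\<lambda>x. frechet_derivative \<rho> (at x) v))"
      using compact_supp_subset[OF supp_frechet_derivative assms(2)] .
    then obtain a' b' where "\<And>y. y \<notin> cbox a' b' \<Longrightarrow> frechet_derivative \<rho> (at y) v = 0"
      using compact_supp_cbox by blast
    from mollify_integral'[OF this cd _ assms(3)] show ?thesis
      using assms(1) by simp
  qed
  show ?thesis
    unfolding 1 2
    by (rule has_derivative_integral_bilinear[OF bounded_bilinear.flip[OF bounded_bilinear_scaleR]
          assms(1,3)])
qed

lemma mollify_Ck_left:
  assumes "Ck n \<rho>" "compact (supp \<rho>)" "continuous_on UNIV f" "compact (supp f)"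
  shows "Ck n (mollify \<rho> f)"
  using assms(1,2)
proof (induction n arbitrary: \<rho>)
  case 0
  then show ?case
    using mollify_Ck_right[of \<rho> 0 f] assms(3) by simp
next
  case (Suc n)
  have "Ck 1 \<rho>" by (rule Ck_mono[OF Suc.prems(1)]) simp
  then show ?case
    by (rule Ck_SucI[OF mollify_has_derivative_left[OF _ Suc.prems(2) assms(3,4)]])
      (rule Suc.IH[OF Ck_Suc_frechet_derivative[OF Suc.prems(1)]
          compact_supp_subset[OF supp_frechet_derivative Suc.prems(2)]])
qed

section \<open>Supports, the bump kernel, and averaging over small balls\<close>

lemma supp_subsetI: "closed C \<Longrightarrow> (\<And>x. x \<notin> C \<Longrightarrow> f x = 0) \<Longrightarrow> supp f \<subseteq> C"
  unfolding supp_def by (rule closure_minimal) auto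

lemma not_in_supp: "x \<notin> supp f \<Longrightarrow> f x = 0"
  using closure_subset[of "{x. f x \<noteq> 0}"] by (auto simp: supp_def)

lemma closed_supp: "closed (supp f)"
  by (simp add: supp_def)

lemma compact_supp_cball:
  fixes f :: "'a::euclidean_space \<Rightarrow> 'b::real_normed_vector"
  assumes "compact (supp f)"
  obtains R where "supp f \<subseteq> cball 0 R"
proof -
  obtain R where "\<forall>x\<in>supp f. norm x \<le> R"
    using compact_imp_bounded[OF assms] by (auto simp: bounded_iff)
  then have "supp f \<subseteq> cball 0 R" by auto
  then show ?thesis by (rule that)
qed

text \<open>The standard mollifier of radius \<open>\<delta>\<close>. The squared norm, rather than
  the norm, keeps the argument of \<open>flat\<close> smooth at the origin.\<close>

definition bump_kernel :: "real \<Rightarrow> 'a::euclidean_space \<Rightarrow> real" where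
  "bump_kernel \<delta> y = flat 0 (\<delta>\<^sup>2 - y \<bullet> y) / integral UNIV (\<lambda>y::'a. flat 0 (\<delta>\<^sup>2 - y \<bullet> y))"

context
  fixes \<delta> :: real
  assumes \<delta>: "\<delta> > 0"
begin

lemma flat_outside: "\<delta> < norm y \<Longrightarrow> flat 0 (\<delta>\<^sup>2 - y \<bullet> y) = 0"
  using power_strict_mono[of \<delta> "norm y" 2] \<delta> by (simp add: flat_def dot_square_norm)

lemma Ck_bump: "Ck n (\<lambda>y. flat 0 (\<delta>\<^sup>2 - y \<bullet> y))"
  by (intro Ck_compose_real[OF Ck_flat] Ck_diff Ck_const Ck_inner_self)

lemma cball_subset_cube: "cball 0 \<delta> \<subseteq> cbox (- \<delta> *\<^sub>R One) (\<delta> *\<^sub>R One :: 'a::euclidean_space)"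
proof
  fix y :: 'a assume "y \<in> cball 0 \<delta>"
  then have "\<bar>y \<bullet> i\<bar> \<le> \<delta>" if "i \<in> Basis" for i
    using Basis_le_norm[OF that, of y] by simp
  then show "y \<in> cbox (- \<delta> *\<^sub>R One) (\<delta> *\<^sub>R One)"
    by (auto simp: mem_box abs_le_iff minus_le_iff)
qed

text \<open>A nonnegative continuous function with zero integral over a box vanishes on it, but the
  bump is positive at the origin.\<close>

lemma integral_bump_pos: "integral UNIV (\<lambda>y::'a::euclidean_space. flat 0 (\<delta>\<^sup>2 - y \<bullet> y)) > 0"
proof -
  let ?b = "\<lambda>y::'a. flat 0 (\<delta>\<^sup>2 - y \<bullet> y)" and ?Q = "cbox (- \<delta> *\<^sub>R One) (\<delta> *\<^sub>R One :: 'a)"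
  have Q: "integral UNIV ?b = integral ?Q ?b"
  proof (rule integral_UNIV_cbox)
    fix y :: 'a assume "y \<notin> ?Q"
    then show "?b y = 0"
      using cball_subset_cube flat_outside[of y] by (metis in_mono mem_cball_0 not_less)
  qed
  have cont: "continuous_on ?Q ?b"
    by (rule Ck_imp_continuous_on[OF Ck_bump[of 0]])
  moreover have 0: "0 \<in> box (- \<delta> *\<^sub>R One) (\<delta> *\<^sub>R One :: 'a)"
    using \<delta> by (auto simp: mem_box)
  ultimately have "integral ?Q ?b = 0 \<longleftrightarrow> (\<forall>x\<in>?Q. ?b x = 0)"
    by (intro integral_cbox_eq_0_iff) (auto simp: flat_nonneg)
  moreover have "?b 0 \<noteq> 0" "0 \<in> ?Q"
    using \<delta> 0 box_subset_cbox by (auto simp: flat_def)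
  ultimately have "integral ?Q ?b \<noteq> 0"
    by blast
  moreover have "integral ?Q ?b \<ge> 0"
    by (rule integral_nonneg[OF integrable_continuous[OF cont]]) (rule flat_nonneg)
  ultimately show ?thesis
    using Q by linarith
qed

lemma Ck_bump_kernel: "Ck n (bump_kernel \<delta>)"
  unfolding bump_kernel_def[abs_def] divide_inverse by (intro Ck_mult Ck_bump Ck_const)

lemma bump_kernel_nonneg: "bump_kernel \<delta> (y::'a::euclidean_space) \<ge> 0"
  using integral_bump_pos[where 'a='a] by (simp add: bump_kernel_def flat_nonneg)

lemma bump_kernel_outside: "\<delta> < norm y \<Longrightarrow> bump_kernel \<delta> y = 0"
  by (simp add: bump_kernel_def flat_outside)

lemma supp_bump_kernel: "supp (bump_kernel \<delta> :: 'a::euclidean_space \<Rightarrow> real) \<subseteq> cball 0 \<delta>"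
  by (rule supp_subsetI) (auto simp: bump_kernel_outside)

lemma compact_supp_bump_kernel: "compact (supp (bump_kernel \<delta> :: 'a::euclidean_space \<Rightarrow> real))"
  by (rule compact_supp_subset[OF supp_bump_kernel compact_cball])

lemma bump_kernel_has_integral: "(bump_kernel \<delta> has_integral 1) (UNIV :: 'a::euclidean_space set)"
proof -
  let ?b = "\<lambda>y::'a. flat 0 (\<delta>\<^sup>2 - y \<bullet> y)"
  \<comment> \<open>A non-integrable function has integral 0 by convention, so positivity of the
    integral already gives integrability.\<close>
  have "?b integrable_on UNIV"
    using integral_bump_pos[where 'a='a] not_integrable_integral by fastforce
  from has_integral_divide[OF integrable_integral[OF this], of "integral UNIV ?b"]
  show ?thesis
    using integral_bump_pos[where 'a='a] by (simp add: bump_kernel_def[abs_def])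
qed

lemma mollify_integrable:
  fixes f :: "'a::euclidean_space \<Rightarrow> 'b::banach"
  assumes "continuous_on UNIV f"
  shows "(\<lambda>y. bump_kernel \<delta> y *\<^sub>R f (x - y)) integrable_on UNIV"
proof -
  obtain a b where ab: "\<And>y::'a. y \<notin> cbox a b \<Longrightarrow> bump_kernel \<delta> y = 0"
    using compact_supp_cbox[OF compact_supp_bump_kernel] by blast
  have "continuous_on (cbox a b) (\<lambda>y. bump_kernel \<delta> y *\<^sub>R f (x - y))"
    by (rule continuous_on_scaleR[OF Ck_imp_continuous_on[OF Ck_bump_kernel]
          continuous_on_compose2[OF assms]]) (auto intro!: continuous_intros)
  from integrable_continuous[OF this]
  show ?thesis
    by (rule integrable_on_superset) (auto simp: ab)
qed

text \<open>A mollification is an average over the \<open>\<delta>\<close>-ball, so it inherits any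
  bound valid there. Taking \<open>c = f x\<close> gives uniform convergence; taking
  \<open>e = 0\<close> gives exact values where \<open>f\<close> is locally constant.\<close>

lemma mollify_near:
  fixes f :: "'a::euclidean_space \<Rightarrow> 'b::banach"
  assumes f: "continuous_on UNIV f" and e: "\<And>y. dist x y \<le> \<delta> \<Longrightarrow> norm (f y - c) \<le> e"
  shows "norm (mollify (bump_kernel \<delta>) f x - c) \<le> e"
proof -
  let ?k = "bump_kernel \<delta> :: 'a \<Rightarrow> real"
  have 1: "((\<lambda>y. ?k y *\<^sub>R c) has_integral 1 *\<^sub>R c) UNIV"
    by (rule has_integral_scaleR_left[OF bump_kernel_has_integral])
  have 2: "((\<lambda>y. ?k y *\<^sub>R f (x - y)) has_integral mollify ?k f x) UNIV"
    unfolding mollify_def by (rule integrable_integral[OF mollify_integrable[OF f]])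
  have 3: "((\<lambda>y. ?k y * e) has_integral 1 * e) UNIV"
    by (rule has_integral_mult_left[OF bump_kernel_has_integral])
  have "norm (integral UNIV (\<lambda>y. ?k y *\<^sub>R f (x - y) - ?k y *\<^sub>R c)) \<le> integral UNIV (\<lambda>y. ?k y * e)"
  proof (rule integral_norm_bound_integral)
    fix y :: 'a
    show "norm (?k y *\<^sub>R f (x - y) - ?k y *\<^sub>R c) \<le> ?k y * e"
    proof (cases "norm y \<le> \<delta>")
      case True
      then have "norm (f (x - y) - c) \<le> e"
        by (intro e) (simp add: dist_norm)
      then show ?thesis
        using bump_kernel_nonneg[of y]
        by (simp add: scaleR_diff_right[symmetric] mult_left_mono del: scaleR_diff_right)
    qed (simp add: bump_kernel_outside)
  qed (use has_integral_diff[OF 2 1] 3 in auto)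
  then show ?thesis
    by (simp only: integral_unique[OF has_integral_diff[OF 2 1]] integral_unique[OF 3]) simp
qed

lemma mollify_nonzeroD:
  fixes f :: "'a::euclidean_space \<Rightarrow> 'b::banach"
  assumes "mollify (bump_kernel \<delta>) f x \<noteq> 0"
  shows "\<exists>y. dist x y \<le> \<delta> \<and> f y \<noteq> 0"
proof (rule ccontr)
  assume *: "\<not> ?thesis"
  have "bump_kernel \<delta> y *\<^sub>R f (x - y) = 0" for y
  proof (cases "norm y \<le> \<delta>")
    case True
    then have "dist x (x - y) \<le> \<delta>" by (simp add: dist_norm)
    with * show ?thesis by auto
  qed (simp add: bump_kernel_outside)
  with assms show False by (simp add: mollify_def)
qed

lemma mollify_mono:
  fixes f g :: "'a::euclidean_space \<Rightarrow> real"
  assumes "continuous_on UNIV f" "continuous_on UNIV g" "\<And>y. f y \<le> g y"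
  shows "mollify (bump_kernel \<delta>) f x \<le> mollify (bump_kernel \<delta>) g x"
  unfolding mollify_def
  by (rule integral_le[OF mollify_integrable[OF assms(1)] mollify_integrable[OF assms(2)]])
    (simp add: mult_left_mono bump_kernel_nonneg assms(3))

lemma mollify_const: "mollify (bump_kernel \<delta>) (\<lambda>_. c) x = c"
  using mollify_near[of "\<lambda>_. c" x c 0] by simp

lemma supp_mollify_cball:
  fixes f :: "'a::euclidean_space \<Rightarrow> 'b::banach"
  assumes "supp f \<subseteq> cball a R"
  shows "supp (mollify (bump_kernel \<delta>) f) \<subseteq> cball a (R + \<delta>)"
proof (rule supp_subsetI)
  fix x assume x: "x \<notin> cball a (R + \<delta>)"
  show "mollify (bump_kernel \<delta>) f x = 0"
  proof (rule ccontr)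
    assume "mollify (bump_kernel \<delta>) f x \<noteq> 0"
    then obtain y where "dist x y \<le> \<delta>" "y \<in> supp f"
      using mollify_nonzeroD not_in_supp by blast
    with assms x dist_triangle[of a x y] show False
      by (auto simp: dist_commute)
  qed
qed simp

lemma test_fun_mollify:
  fixes f :: "'a::euclidean_space \<Rightarrow> 'b::banach"
  assumes "continuous_on UNIV f" "compact (supp f)"
  shows "test_fun (mollify (bump_kernel \<delta>) f)"
proof -
  obtain R where "supp f \<subseteq> cball 0 R"
    using compact_supp_cball[OF assms(2)] .
  then show ?thesis
    unfolding test_fun_def
    using mollify_Ck_left[OF Ck_bump_kernel compact_supp_bump_kernel assms]
      compact_supp_subset[OF supp_mollify_cball compact_cball] by blast
qed

end

section \<open>Uniform approximation and cutoff functions\<close>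

lemma uniformly_continuous_compact_supp:
  fixes f :: "'a::euclidean_space \<Rightarrow> 'b::real_normed_vector"
  assumes "continuous_on UNIV f" "compact (supp f)" "e > 0"
  obtains d where "d > 0" "\<And>x y. dist x y < d \<Longrightarrow> dist (f x) (f y) < e"
proof -
  obtain R where R: "supp f \<subseteq> cball 0 R"
    using compact_supp_cball[OF assms(2)] .
  have "uniformly_continuous_on (cball 0 (R + 1)) f"
    by (rule compact_uniformly_continuous[OF continuous_on_subset[OF assms(1)] compact_cball]) simp
  then obtain d where d: "d > 0"
    "\<And>x y :: 'a. x \<in> cball 0 (R + 1) \<Longrightarrow> y \<in> cball 0 (R + 1) \<Longrightarrow> dist x y < d \<Longrightarrow> dist (f x) (f y) < e"
    unfolding uniformly_continuous_on_def using assms(3) by metis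
  have out: "f x = 0" if "R < norm x" for x
    using R that by (intro not_in_supp) auto
  \<comment> \<open>Points closer than 1 either both lie in the ball of radius \<open>R + 1\<close>,
    where uniform continuity holds, or both outside the ball of radius \<open>R\<close>, where
    \<open>f\<close> vanishes.\<close>
  show ?thesis
  proof (rule that[of "min d 1"])
    fix x y :: 'a assume xy: "dist x y < min d 1"
    then have "\<bar>norm x - norm y\<bar> < 1"
      using norm_triangle_ineq3[of x y] by (simp add: dist_norm)
    then consider "norm x \<le> R + 1 \<and> norm y \<le> R + 1" | "R < norm x \<and> R < norm y"
      by linarith
    then show "dist (f x) (f y) < e"
      using d(2)[of x y] xy assms(3) by cases (auto simp: out)
  qed (use d in auto)
qed

lemma uniform_limit_mollify:
  fixes f :: "'a::euclidean_space \<Rightarrow> 'b::banach"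
  assumes "continuous_on UNIV f" "compact (supp f)"
  shows "uniform_limit UNIV (\<lambda>n. mollify (bump_kernel (inverse (real (Suc n)))) f) f sequentially"
  unfolding uniform_limit_iff
proof (intro allI impI)
  fix e :: real assume "e > 0"
  then obtain d where d: "d > 0" "\<And>x y. dist x y < d \<Longrightarrow> dist (f x) (f y) < e / 2"
    using uniformly_continuous_compact_supp[OF assms, of "e / 2"] by auto
  have "\<forall>\<^sub>F n in sequentially. inverse (real (Suc n)) < d"
    using order_tendstoD(2)[OF LIMSEQ_inverse_real_of_nat d(1)] .
  then show "\<forall>\<^sub>F n in sequentially. \<forall>x\<in>UNIV. dist (mollify (bump_kernel (inverse (real (Suc n)))) f x) (f x) < e"
  proof eventually_elim
    case (elim n)
    have "norm (mollify (bump_kernel (inverse (real (Suc n)))) f x - f x) \<le> e / 2" for x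
    proof (rule mollify_near[OF _ assms(1)])
      fix y assume "dist x y \<le> inverse (real (Suc n))"
      then have "dist (f x) (f y) < e / 2" using elim by (intro d(2)) linarith
      then show "norm (f y - f x) \<le> e / 2" by (simp add: dist_norm norm_minus_commute)
    qed simp
    then show ?case
      using \<open>e > 0\<close> by (smt (verit) dist_norm field_sum_of_halves)
  qed
qed

lemma cutoff_exists:
  fixes a :: "'a::euclidean_space"
  assumes "r < R"
  obtains \<eta> :: "'a \<Rightarrow> real" where "test_fun \<eta>" "\<And>x. 0 \<le> \<eta> x" "\<And>x. \<eta> x \<le> 1"
    "\<And>x. x \<in> cball a r \<Longrightarrow> \<eta> x = 1" "supp \<eta> \<subseteq> cball a R"
proof -
  \<comment> \<open>A third of the gap: the piecewise linear profile \<open>f\<close> is 1 up to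
    radius \<open>r + \<delta>\<close> and 0 beyond \<open>R - \<delta>\<close>, and averaging over
    radius \<open>\<delta>\<close> uses up the other two thirds.\<close>
  define \<delta> where "\<delta> = (R - r) / 3"
  define f where "f x = max 0 (min 1 ((R - \<delta> - dist a x) / \<delta>))" for x
  have \<delta>: "\<delta> > 0" using assms by (simp add: \<delta>_def)
  have f: "continuous_on UNIV f"
    unfolding f_def by (intro continuous_intros) (use \<delta> in auto)
  have s: "supp f \<subseteq> cball a (R - \<delta>)"
    by (rule supp_subsetI) (use \<delta> in \<open>auto simp: f_def divide_le_0_iff divide_less_0_iff max_def min_def not_le\<close>)
  show ?thesis
  proof (rule that[of "mollify (bump_kernel \<delta>) f"])
    show "test_fun (mollify (bump_kernel \<delta>) f)"
      by (rule test_fun_mollify[OF \<delta> f compact_supp_subset[OF s compact_cball]])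
    show "0 \<le> mollify (bump_kernel \<delta>) f x" for x
      using mollify_mono[OF \<delta> continuous_on_const f, of 0 x] mollify_const[OF \<delta>, of "0::real" x]
      by (simp add: f_def)
    show "mollify (bump_kernel \<delta>) f x \<le> 1" for x
      using mollify_mono[OF \<delta> f continuous_on_const, of 1 x] mollify_const[OF \<delta>, of "1::real" x]
      by (simp add: f_def)
    show "supp (mollify (bump_kernel \<delta>) f) \<subseteq> cball a R"
      using supp_mollify_cball[OF \<delta> s] by simp
    fix x assume x: "x \<in> cball a r"
    have "norm (mollify (bump_kernel \<delta>) f x - 1) \<le> 0"
    proof (rule mollify_near[OF \<delta> f])
      fix y assume "dist x y \<le> \<delta>"
      then have "dist a y \<le> R - 2 * \<delta>"
        using x dist_triangle[of a y x] by (simp add: \<delta>_def field_simps)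
      then have "1 \<le> (R - \<delta> - dist a y) / \<delta>" using \<delta> by (simp add: field_simps)
      then show "norm (f y - 1) \<le> 0" by (simp add: f_def)
    qed
    then show "mollify (bump_kernel \<delta>) f x = 1" by simp
  qed
qed

section \<open>Second derivatives and the Levi form\<close>

lemma DERIV_along_line:
  fixes F :: "'a::real_normed_vector \<Rightarrow> real"
  assumes "Ck 1 F"
  shows "((\<lambda>s. F (p + s *\<^sub>R a)) has_real_derivative frechet_derivative F (at (p + s *\<^sub>R a)) a) (at s)"
proof -
  have *: "(F has_derivative frechet_derivative F (at (p + s *\<^sub>R a))) (at (p + s *\<^sub>R a))"
    by (rule Ck_has_derivative[of 0]) (use assms in simp)
  have "((\<lambda>s. p + s *\<^sub>R a) has_derivative (\<lambda>t. t *\<^sub>R a)) (at s)"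
    by (auto intro!: derivative_eq_intros)
  from diff_chain_at[OF this *]
  have "((\<lambda>s. F (p + s *\<^sub>R a)) has_derivative
      (\<lambda>t. frechet_derivative F (at (p + s *\<^sub>R a)) (t *\<^sub>R a))) (at s)"
    by (simp add: o_def)
  then show ?thesis
    by (simp add: has_field_derivative_def linear_scale[OF has_derivative_linear[OF *]] mult_commute_abs)
qed

definition D2 :: "('a::real_normed_vector \<Rightarrow> real) \<Rightarrow> 'a \<Rightarrow> 'a \<Rightarrow> 'a \<Rightarrow> real" where
  "D2 u z a b = frechet_derivative (\<lambda>x. frechet_derivative u (at x) a) (at z) b"

text \<open>The mean value theorem is applied twice, first along \<open>a\<close> to the difference
  of \<open>f\<close> and its translate by \<open>t *\<^sub>R b\<close>, then along \<open>b\<close>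
  to the derivative in direction \<open>a\<close>. The second difference is symmetric in
  \<open>a\<close> and \<open>b\<close>, which is the point.\<close>

lemma second_difference_eq_D2:
  fixes f :: "'a::real_normed_vector \<Rightarrow> real"
  assumes f: "Ck 2 f" and t: "t > 0"
  shows "\<exists>r s. 0 \<le> r \<and> r \<le> t \<and> 0 \<le> s \<and> s \<le> t \<and>
    f (x + t *\<^sub>R a + t *\<^sub>R b) - f (x + t *\<^sub>R a) - f (x + t *\<^sub>R b) + f x
      = t\<^sup>2 * D2 f (x + r *\<^sub>R a + s *\<^sub>R b) a b"
proof -
  have f1: "Ck 1 f" by (rule Ck_mono[OF f]) simp
  have f2: "Ck 1 (\<lambda>x. frechet_derivative f (at x) a)"
    using f by (simp add: numeral_2_eq_2)
  define g where "g r = f ((x + t *\<^sub>R b) + r *\<^sub>R a) - f (x + r *\<^sub>R a)" for r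
  define g' where "g' r = frechet_derivative f (at ((x + t *\<^sub>R b) + r *\<^sub>R a)) a -
    frechet_derivative f (at (x + r *\<^sub>R a)) a" for r
  have "(g has_real_derivative g' r) (at r)" for r
    unfolding g_def g'_def by (intro DERIV_diff DERIV_along_line[OF f1])
  from MVT2[OF t this] obtain r where r: "0 < r" "r < t" "g t - g 0 = (t - 0) * g' r"
    by blast
  define h where "h s = frechet_derivative f (at (x + r *\<^sub>R a + s *\<^sub>R b)) a" for s
  have "(h has_real_derivative D2 f (x + r *\<^sub>R a + s *\<^sub>R b) a b) (at s)" for s
    unfolding h_def D2_def by (rule DERIV_along_line[OF f2])
  from MVT2[OF t this] obtain s where s: "0 < s" "s < t"
    "h t - h 0 = (t - 0) * D2 f (x + r *\<^sub>R a + s *\<^sub>R b) a b"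
    by blast
  have "g' r = h t - h 0"
    by (simp add: g'_def h_def add.commute add.left_commute)
  then have "g t - g 0 = t\<^sup>2 * D2 f (x + r *\<^sub>R a + s *\<^sub>R b) a b"
    using r s by (simp add: power2_eq_square)
  moreover have "g t - g 0 =
      f (x + t *\<^sub>R a + t *\<^sub>R b) - f (x + t *\<^sub>R a) - f (x + t *\<^sub>R b) + f x"
    by (simp add: g_def add.commute add.left_commute)
  ultimately show ?thesis
    using r s by (intro exI[of _ r] exI[of _ s]) auto
qed

lemma continuous_on_D2: "Ck 2 f \<Longrightarrow> continuous_on UNIV (\<lambda>z. D2 f z a b)"
  by (simp add: D2_def numeral_2_eq_2)

text \<open>Schwarz's theorem. Swapping \<open>a\<close> and \<open>b\<close> leaves the second
  difference unchanged, so the two mixed derivatives agree at points \<open>p n\<close> and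
  \<open>q n\<close> that both tend to \<open>x\<close>; continuity of the second derivatives
  finishes.\<close>

lemma D2_symmetric:
  fixes f :: "'a::real_normed_vector \<Rightarrow> real"
  assumes f: "Ck 2 f"
  shows "D2 f x a b = D2 f x b a"
proof -
  define t where "t n = inverse (real (Suc n))" for n
  have t: "t n > 0" for n by (simp add: t_def)
  have "\<exists>p. \<forall>n. \<exists>r s. 0 \<le> r \<and> r \<le> t n \<and> 0 \<le> s \<and> s \<le> t n \<and> p n = x + r *\<^sub>R a + s *\<^sub>R b \<and>
     f (x + t n *\<^sub>R a + t n *\<^sub>R b) - f (x + t n *\<^sub>R a) - f (x + t n *\<^sub>R b) + f x
      = (t n)\<^sup>2 * D2 f (p n) a b" for a b
  proof (rule choice, rule allI)
    fix n
    show "\<exists>p. \<exists>r s. 0 \<le> r \<and> r \<le> t n \<and> 0 \<le> s \<and> s \<le> t n \<and> p = x + r *\<^sub>R a + s *\<^sub>R b \<and>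
       f (x + t n *\<^sub>R a + t n *\<^sub>R b) - f (x + t n *\<^sub>R a) - f (x + t n *\<^sub>R b) + f x
        = (t n)\<^sup>2 * D2 f p a b"
      using second_difference_eq_D2[OF f t[of n], of x a b] by blast
  qed
  note ex = this
  \<comment> \<open>The remaining conjunct is left as an arbitrary \<open>Q\<close>, so that one
    statement covers both \<open>p\<close> and \<open>q\<close>.\<close>
  have lim: "p \<longlonglongrightarrow> x" if "\<forall>n. \<exists>r s. 0 \<le> r \<and> r \<le> t n \<and> 0 \<le> s \<and> s \<le> t n \<and> p n = x + r *\<^sub>R a + s *\<^sub>R b \<and> Q n"
    for p a b Q
  proof (rule Lim_null[THEN iffD2], rule Lim_null_comparison)
    have "norm (p n - x) \<le> t n * (norm a + norm b)" for n
    proof -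
      obtain r s where rs: "0 \<le> r" "r \<le> t n" "0 \<le> s" "s \<le> t n" "p n = x + r *\<^sub>R a + s *\<^sub>R b"
        using \<open>\<forall>n. _ n\<close> by blast
      have "norm (p n - x) \<le> norm (r *\<^sub>R a) + norm (s *\<^sub>R b)"
        using norm_triangle_ineq[of "r *\<^sub>R a" "s *\<^sub>R b"] rs(5) by (simp add: algebra_simps)
      also have "\<dots> \<le> t n * norm a + t n * norm b"
        using rs by (intro add_mono) (auto intro: mult_right_mono)
      finally show ?thesis by (simp add: algebra_simps)
    qed
    then show "\<forall>\<^sub>F n in sequentially. norm (p n - x) \<le> t n * (norm a + norm b)" by simp
    show "(\<lambda>n. t n * (norm a + norm b)) \<longlonglongrightarrow> 0"
      unfolding t_def by (intro tendsto_mult_left_zero LIMSEQ_inverse_real_of_nat)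
  qed
  obtain p where p: "\<forall>n. \<exists>r s. 0 \<le> r \<and> r \<le> t n \<and> 0 \<le> s \<and> s \<le> t n \<and> p n = x + r *\<^sub>R a + s *\<^sub>R b \<and>
     f (x + t n *\<^sub>R a + t n *\<^sub>R b) - f (x + t n *\<^sub>R a) - f (x + t n *\<^sub>R b) + f x
      = (t n)\<^sup>2 * D2 f (p n) a b"
    using ex by blast
  obtain q where q: "\<forall>n. \<exists>r s. 0 \<le> r \<and> r \<le> t n \<and> 0 \<le> s \<and> s \<le> t n \<and> q n = x + r *\<^sub>R b + s *\<^sub>R a \<and>
     f (x + t n *\<^sub>R b + t n *\<^sub>R a) - f (x + t n *\<^sub>R b) - f (x + t n *\<^sub>R a) + f x
      = (t n)\<^sup>2 * D2 f (q n) b a"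
    using ex by blast
  have "(t n)\<^sup>2 * D2 f (p n) a b = (t n)\<^sup>2 * D2 f (q n) b a" for n
  proof -
    have "(t n)\<^sup>2 * D2 f (p n) a b =
        f (x + t n *\<^sub>R a + t n *\<^sub>R b) - f (x + t n *\<^sub>R a) - f (x + t n *\<^sub>R b) + f x"
      using p by metis
    also have "\<dots> = f (x + t n *\<^sub>R b + t n *\<^sub>R a) - f (x + t n *\<^sub>R b) - f (x + t n *\<^sub>R a) + f x"
      by (simp add: add.assoc add.commute[of "t n *\<^sub>R a"])
    also have "\<dots> = (t n)\<^sup>2 * D2 f (q n) b a"
      using q by metis
    finally show ?thesis .
  qed
  then have eq: "D2 f (p n) a b = D2 f (q n) b a" for n
    by (simp add: less_imp_neq[OF t, symmetric])
  have "(\<lambda>n. D2 f (p n) a b) \<longlonglongrightarrow> D2 f x a b"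
    by (rule continuous_on_tendsto_compose[OF continuous_on_D2[OF f] lim[OF p]]) auto
  moreover have "(\<lambda>n. D2 f (q n) b a) \<longlonglongrightarrow> D2 f x b a"
    by (rule continuous_on_tendsto_compose[OF continuous_on_D2[OF f] lim[OF q]]) auto
  ultimately show ?thesis
    unfolding eq by (rule LIMSEQ_unique)
qed

lemma bilinear_D2:
  assumes f: "Ck 2 f"
  shows "bilinear (D2 f z)"
proof -
  have lin: "linear (\<lambda>b. D2 f z a b)" for a
    unfolding D2_def by (rule linear_frechet_derivative) (use f in \<open>simp add: numeral_2_eq_2\<close>)
  moreover have "(\<lambda>a. D2 f z a b) = (\<lambda>a. D2 f z b a)" for b
    using D2_symmetric[OF f] by blast
  ultimately show ?thesis
    unfolding bilinear_def by simp
qed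

lemma frechet_derivativeI: "(f has_derivative D) (at x) \<Longrightarrow> frechet_derivative f (at x) = D"
  by (rule frechet_derivative_at[symmetric])

lemma D2_eqI:
  assumes "\<And>x. (u has_derivative D x) (at x)" "((\<lambda>x. D x a) has_derivative E) (at z)"
  shows "D2 u z a b = E b"
  unfolding D2_def frechet_derivativeI[OF assms(1)] frechet_derivativeI[OF assms(2)] ..

lemma Ck2_derivs:
  assumes "Ck 2 u"
  shows "(u has_derivative frechet_derivative u (at x)) (at x)"
    "((\<lambda>x. frechet_derivative u (at x) a) has_derivative D2 u x a) (at x)"
proof -
  show "(u has_derivative frechet_derivative u (at x)) (at x)"
    using assms Ck_has_derivative[of 1 u] by (simp add: numeral_2_eq_2)
  show "((\<lambda>x. frechet_derivative u (at x) a) has_derivative D2 u x a) (at x)"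
    using assms Ck_has_derivative[of 0 "\<lambda>x. frechet_derivative u (at x) a" x]
    by (simp add: numeral_2_eq_2 D2_def[abs_def])
qed

lemma D2_add: "Ck 2 u \<Longrightarrow> Ck 2 v \<Longrightarrow> D2 (\<lambda>x. u x + v x) z a b = D2 u z a b + D2 v z a b"
  by (rule D2_eqI[OF has_derivative_add[OF Ck2_derivs(1) Ck2_derivs(1)]
        has_derivative_add[OF Ck2_derivs(2) Ck2_derivs(2)]])

lemma D2_scale: "Ck 2 u \<Longrightarrow> D2 (\<lambda>x. c * u x) z a b = c * D2 u z a b"
  by (rule D2_eqI[OF has_derivative_mult_right[OF Ck2_derivs(1)]
        has_derivative_mult_right[OF Ck2_derivs(2)]])

lemma D2_compose:
  fixes u :: "'a::real_normed_vector \<Rightarrow> real"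
  assumes u: "Ck 2 u" and g: "\<And>t. (g has_real_derivative g' t) (at t)"
    "\<And>t. (g' has_real_derivative g'' t) (at t)"
  shows "D2 (\<lambda>x. g (u x)) z a b = g' (u z) * D2 u z a b +
    g'' (u z) * frechet_derivative u (at z) a * frechet_derivative u (at z) b"
proof (rule D2_eqI[where E = "\<lambda>b. g' (u z) * D2 u z a b +
    g'' (u z) * frechet_derivative u (at z) a * frechet_derivative u (at z) b"])
  note c = diff_chain_at[OF Ck2_derivs(1)[OF u] g(1)[unfolded has_field_derivative_def]]
  note c' = diff_chain_at[OF Ck2_derivs(1)[OF u] g(2)[unfolded has_field_derivative_def]]
  show "((\<lambda>x. g (u x)) has_derivative (\<lambda>v. g' (u x) * frechet_derivative u (at x) v)) (at x)" for x
    using c[of x] by (simp add: o_def)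
  have "((\<lambda>x. g' (u x)) has_derivative (\<lambda>v. g'' (u z) * frechet_derivative u (at z) v)) (at z)"
    using c'[of z] by (simp add: o_def)
  from has_derivative_mult[OF this Ck2_derivs(2)[OF u]]
  show "((\<lambda>x. g' (u x) * frechet_derivative u (at x) a) has_derivative
      (\<lambda>b. g' (u z) * D2 u z a b +
        g'' (u z) * frechet_derivative u (at z) a * frechet_derivative u (at z) b)) (at z)"
    by (rule has_derivative_eq_rhs) (auto simp: algebra_simps)
qed

lemma D2_inner_self: "D2 (\<lambda>z. z \<bullet> z) z a b = 2 * (a \<bullet> b)"
proof (rule D2_eqI)
  show "((\<lambda>z. z \<bullet> z) has_derivative (\<lambda>v. 2 * (v \<bullet> x))) (at x)" for x :: 'a
    by (auto intro!: derivative_eq_intros simp: inner_commute)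
  show "((\<lambda>x. 2 * (a \<bullet> x)) has_derivative (\<lambda>b. 2 * (a \<bullet> b))) (at z)"
    by (auto intro!: derivative_eq_intros)
qed

text \<open>A quarter of the Laplacian at 0 of the restriction of \<open>u\<close> to the complex
  line through \<open>z\<close> in direction \<open>\<xi>\<close>: the Levi form in real terms.
  Being real-valued, it replaces \<open>pair11 (ddbar u z) \<xi>\<close> in the estimates.\<close>

definition levi :: "(complex^'n::finite \<Rightarrow> real) \<Rightarrow> complex^'n \<Rightarrow> complex^'n \<Rightarrow> real" where
  "levi u z \<xi> = (D2 u z \<xi> \<xi> + D2 u z (\<i> *s \<xi>) (\<i> *s \<xi>)) / 4"

lemma ddbar_nth:
  assumes u: "Ck 2 u"
  shows "ddbar u z $ j $ l = Complex
    ((D2 u z (axis l 1) (axis j 1) + D2 u z (axis l \<i>) (axis j \<i>)) / 4)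
    ((D2 u z (axis l \<i>) (axis j 1) - D2 u z (axis l 1) (axis j \<i>)) / 4)"
proof -
  let ?D = "\<lambda>x. frechet_derivative u (at x)"
  have "frechet_derivative (\<lambda>w. complex_of_real (u w)) (at x) = (\<lambda>v. complex_of_real (?D x v))" for x
    by (rule frechet_derivativeI[OF has_derivative_of_real[OF Ck2_derivs(1)[OF u]]])
  then have zb: "d_zbar l (\<lambda>w. complex_of_real (u w)) =
      (\<lambda>x. (complex_of_real (?D x (axis l 1)) + \<i> * complex_of_real (?D x (axis l \<i>))) / 2)"
    by (simp add: d_zbar_def fun_eq_iff)
  have "((\<lambda>x. (complex_of_real (?D x (axis l 1)) + \<i> * complex_of_real (?D x (axis l \<i>))) / 2) has_derivative
      (\<lambda>v. (complex_of_real (D2 u z (axis l 1) v) + \<i> * complex_of_real (D2 u z (axis l \<i>) v)) / 2)) (at z)"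
    by (intro has_derivative_add has_derivative_mult_right has_derivative_of_real
        bounded_linear.has_derivative[OF bounded_linear_divide] Ck2_derivs(2)[OF u])
  note 1 = frechet_derivativeI[OF this]
  show ?thesis
    by (simp add: ddbar_def d_z_def zb 1 complex_eq_iff)
qed

lemma linear_complex_vec_expansion:
  fixes f :: "complex^'n::finite \<Rightarrow> real"
  assumes "linear f"
  shows "f \<xi> = (\<Sum>l\<in>UNIV. Re (\<xi> $ l) * f (axis l 1) + Im (\<xi> $ l) * f (axis l \<i>))"
proof -
  have "\<xi> = (\<Sum>l\<in>UNIV. Re (\<xi> $ l) *\<^sub>R axis l 1 + Im (\<xi> $ l) *\<^sub>R axis l \<i>)"
    by (simp add: vec_eq_iff axis_def sum.distrib if_distrib[of "\<lambda>x. _ *\<^sub>R x"] complex_eq_iff cong: if_cong)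
  then have "f \<xi> = f (\<Sum>l\<in>UNIV. Re (\<xi> $ l) *\<^sub>R axis l 1 + Im (\<xi> $ l) *\<^sub>R axis l \<i>)"
    by simp
  also have "\<dots> = (\<Sum>l\<in>UNIV. Re (\<xi> $ l) * f (axis l 1) + Im (\<xi> $ l) * f (axis l \<i>))"
    by (simp add: linear_sum[OF assms] linear_add[OF assms] linear_scale[OF assms])
  finally show ?thesis .
qed

lemma bilinear_complex_vec_expansion:
  fixes B :: "complex^'n::finite \<Rightarrow> complex^'n \<Rightarrow> real"
  assumes "bilinear B"
  shows "B \<xi> \<eta> = (\<Sum>j\<in>UNIV. \<Sum>l\<in>UNIV.
     Re (\<xi> $ l) * Re (\<eta> $ j) * B (axis l 1) (axis j 1) + Re (\<xi> $ l) * Im (\<eta> $ j) * B (axis l 1) (axis j \<i>) +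
     Im (\<xi> $ l) * Re (\<eta> $ j) * B (axis l \<i>) (axis j 1) + Im (\<xi> $ l) * Im (\<eta> $ j) * B (axis l \<i>) (axis j \<i>))"
proof -
  have 1: "linear (\<lambda>\<xi>. B \<xi> y)" and 2: "linear (B x)" for x y
    using assms by (auto simp: bilinear_def)
  have "B \<xi> \<eta> = (\<Sum>j\<in>UNIV. Re (\<eta> $ j) * B \<xi> (axis j 1) + Im (\<eta> $ j) * B \<xi> (axis j \<i>))"
    by (rule linear_complex_vec_expansion[OF 2])
  also have "\<dots> = (\<Sum>j\<in>UNIV.
      Re (\<eta> $ j) * (\<Sum>l\<in>UNIV. Re (\<xi> $ l) * B (axis l 1) (axis j 1) + Im (\<xi> $ l) * B (axis l \<i>) (axis j 1)) +
      Im (\<eta> $ j) * (\<Sum>l\<in>UNIV. Re (\<xi> $ l) * B (axis l 1) (axis j \<i>) + Im (\<xi> $ l) * B (axis l \<i>) (axis j \<i>)))"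
    by (simp only: linear_complex_vec_expansion[OF 1, of \<xi>])
  also have "\<dots> = (\<Sum>j\<in>UNIV. \<Sum>l\<in>UNIV.
     Re (\<xi> $ l) * Re (\<eta> $ j) * B (axis l 1) (axis j 1) + Re (\<xi> $ l) * Im (\<eta> $ j) * B (axis l 1) (axis j \<i>) +
     Im (\<xi> $ l) * Re (\<eta> $ j) * B (axis l \<i>) (axis j 1) + Im (\<xi> $ l) * Im (\<eta> $ j) * B (axis l \<i>) (axis j \<i>))"
    unfolding sum_distrib_left sum.distrib[symmetric]
    by (intro sum.cong refl) (simp add: algebra_simps)
  finally show ?thesis .
qed

text \<open>The imaginary part vanishes because the second derivative is symmetric.\<close>

lemma pair11_ddbar:
  assumes u: "Ck 2 u"
  shows "pair11 (ddbar u z) \<xi> = complex_of_real (levi u z \<xi>)"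
proof -
  note B = bilinear_complex_vec_expansion[OF bilinear_D2[OF u]]
  have "Re (pair11 (ddbar u z) \<xi>) = levi u z \<xi>"
    unfolding pair11_def levi_def Re_sum ddbar_nth[OF u] B[of z \<xi> \<xi>] B[of z "\<i> *s \<xi>" "\<i> *s \<xi>"]
      sum.distrib[symmetric] sum_divide_distrib
    by (intro sum.cong refl) (simp add: field_simps)
  moreover have "Im (pair11 (ddbar u z) \<xi>) = (D2 u z (\<i> *s \<xi>) \<xi> - D2 u z \<xi> (\<i> *s \<xi>)) / 4"
    unfolding pair11_def Im_sum ddbar_nth[OF u] B[of z \<xi> "\<i> *s \<xi>"] B[of z "\<i> *s \<xi>" \<xi>]
      sum_subtractf[symmetric] sum_divide_distrib
    by (intro sum.cong refl) (simp add: field_simps)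
  ultimately show ?thesis
    using D2_symmetric[OF u, of z \<xi>] by (simp add: complex_eq_iff)
qed

lemma nonneg_Reals_of_real: "complex_of_real x \<in> \<real>\<^sub>\<ge>\<^sub>0 \<longleftrightarrow> 0 \<le> x"
  by (simp add: complex_nonneg_Reals_iff)

lemma psh_dir_iff: "u \<in> psh_dir \<Gamma> \<longleftrightarrow> Ck 2 u \<and> (\<forall>z. \<forall>\<xi>\<in>\<Gamma> z. 0 \<le> levi u z \<xi>)"
  by (auto simp: psh_dir_def pair11_ddbar nonneg_Reals_of_real)

lemma levi_add: "Ck 2 u \<Longrightarrow> Ck 2 v \<Longrightarrow> levi (\<lambda>x. u x + v x) z \<xi> = levi u z \<xi> + levi v z \<xi>"
  by (simp add: levi_def D2_add add_divide_distrib)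

lemma levi_scale: "Ck 2 u \<Longrightarrow> levi (\<lambda>x. c * u x) z \<xi> = c * levi u z \<xi>"
  by (simp add: levi_def D2_scale algebra_simps)

text \<open>The term dropped is \<open>g''\<close> times a sum of squares, of the derivatives of
  \<open>u\<close> along \<open>\<xi>\<close> and along \<open>\<i> *s \<xi>\<close>.\<close>

lemma levi_compose_ge:
  assumes u: "Ck 2 u" and g: "\<And>t. (g has_real_derivative g' t) (at t)"
    "\<And>t. (g' has_real_derivative g'' t) (at t)" and "g'' (u z) \<ge> 0"
  shows "levi (\<lambda>x. g (u x)) z \<xi> \<ge> g' (u z) * levi u z \<xi>"
proof -
  have "levi (\<lambda>x. g (u x)) z \<xi> = g' (u z) * levi u z \<xi> + g'' (u z) *
      ((frechet_derivative u (at z) \<xi>)\<^sup>2 + (frechet_derivative u (at z) (\<i> *s \<xi>))\<^sup>2) / 4"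
    unfolding levi_def D2_compose[OF u g] by (simp add: field_simps power2_eq_square)
  then show ?thesis
    using assms(4) by simp
qed

lemma inner_ii_vec: "(\<i> *s \<xi>) \<bullet> (\<i> *s \<xi>) = \<xi> \<bullet> (\<xi> :: complex^'n::finite)"
  by (simp add: inner_vec_def inner_complex_def add.commute)

lemma levi_inner_self: "levi (\<lambda>z. z \<bullet> z) z \<xi> = \<xi> \<bullet> \<xi>"
  by (simp add: levi_def D2_inner_self inner_ii_vec)

text \<open>Hence \<open>\<eta> z *\<^sub>R mat 1\<close> is, up to normalisation,
  \<open>\<eta>\<close> times the standard Kaehler form, and its value under \<open>T\<close> is the
  integral of \<open>\<eta>\<close> against the trace measure of \<open>T\<close>.\<close>

lemma ddbar_inner_self: "ddbar (\<lambda>z. z \<bullet> z) z = mat 1"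
  by (auto simp: vec_eq_iff ddbar_nth[OF Ck_inner_self] D2_inner_self inner_axis_axis mat_def complex_eq_iff
      inner_complex_def)

lemma norm_pair11_le:
  fixes M :: "complex^'n^'n::finite"
  shows "norm (pair11 M \<xi>) \<le> real CARD('n) ^ 2 * norm M * (\<xi> \<bullet> \<xi>)"
proof -
  have "norm (M $ j $ l * \<xi> $ j * cnj (\<xi> $ l)) \<le> norm M * (\<xi> \<bullet> \<xi>)" for j l
  proof -
    have 1: "norm (M $ j $ l) \<le> norm M"
      using Finite_Cartesian_Product.norm_nth_le[of "M $ j" l] Finite_Cartesian_Product.norm_nth_le[of M j] by linarith
    have "norm (M $ j $ l * \<xi> $ j * cnj (\<xi> $ l)) = norm (M $ j $ l) * (norm (\<xi> $ j) * norm (\<xi> $ l))"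
      by (simp add: norm_mult)
    also have "\<dots> \<le> norm M * (norm \<xi> * norm \<xi>)"
      by (intro mult_mono 1 Finite_Cartesian_Product.norm_nth_le) auto
    finally show ?thesis by (simp add: dot_square_norm power2_eq_square)
  qed
  then have "norm (pair11 M \<xi>) \<le> (\<Sum>j\<in>(UNIV::'n set). \<Sum>l\<in>(UNIV::'n set). norm M * (\<xi> \<bullet> \<xi>))"
    unfolding pair11_def by (intro order.trans[OF norm_sum] sum_mono)
  then show ?thesis by (simp add: power2_eq_square mult.assoc)
qed

lemma pair11_add: "pair11 (M + N) \<xi> = pair11 M \<xi> + pair11 N \<xi>"
  by (simp add: pair11_def algebra_simps sum.distrib)

lemma pair11_scaleR: "pair11 (c *\<^sub>R M) \<xi> = c *\<^sub>R pair11 M \<xi>"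
  by (simp add: pair11_def scaleR_sum_right)

lemma pair11_minus: "pair11 (- M) \<xi> = - pair11 M \<xi>"
  by (simp add: pair11_def sum_negf)

lemma pair11_mat_1: "pair11 (mat 1) \<xi> = complex_of_real (\<xi> \<bullet> \<xi>)"
  by (simp add: ddbar_inner_self[symmetric, of 0] pair11_ddbar[OF Ck_inner_self] levi_inner_self)

section \<open>Regularity, locality and support of the Levi matrix\<close>

lemma bounded_linear_axis: "bounded_linear (axis j :: 'b::euclidean_space \<Rightarrow> 'b^'n::finite)"
  by (rule linear_conv_bounded_linear[THEN iffD1, OF linearI]) (auto simp: vec_eq_iff axis_def)

lemma Ck_vec:
  fixes f :: "'a::real_normed_vector \<Rightarrow> 'b::euclidean_space ^ 'n::finite"
  assumes "\<And>j. Ck n (\<lambda>z. f z $ j)"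
  shows "Ck n f"
proof -
  have "f = (\<lambda>z. \<Sum>j\<in>UNIV. axis j (f z $ j))"
    by (auto simp: vec_eq_iff axis_def fun_eq_iff)
  moreover have "Ck n (\<lambda>z. \<Sum>j\<in>UNIV. axis j (f z $ j))"
    by (intro Ck_sum Ck_linear_compose[OF bounded_linear_axis] assms)
  ultimately show ?thesis by simp
qed

lemma Ck_Complex: "Ck n f \<Longrightarrow> Ck n g \<Longrightarrow> Ck n (\<lambda>z. Complex (f z) (g z))"
  unfolding Complex_eq
  by (intro Ck_add Ck_linear_compose[OF bounded_linear_of_real] Ck_mult Ck_const)

lemma Ck_D2: "Ck (Suc (Suc n)) u \<Longrightarrow> Ck n (\<lambda>z. D2 u z a b)"
  by (simp add: D2_def)

lemma Ck_ddbar: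
  assumes "Ck (Suc (Suc n)) u"
  shows "Ck n (ddbar u)"
proof (intro Ck_vec)
  have u: "Ck 2 u" by (rule Ck_mono[OF assms]) simp
  show "Ck n (\<lambda>z. ddbar u z $ j $ l)" for j l
    unfolding ddbar_nth[OF u] divide_inverse
    by (intro Ck_Complex Ck_add Ck_diff Ck_mult Ck_const Ck_D2 assms)
qed

lemma continuous_on_ddbar: "Ck 2 u \<Longrightarrow> continuous_on A (ddbar u)"
  using Ck_ddbar[of 0 u] by (intro Ck_imp_continuous_on[of 0]) (simp add: numeral_2_eq_2)

lemma D2_cong:
  assumes "Ck 2 u" "open S" "z \<in> S" "\<And>x. x \<in> S \<Longrightarrow> u x = v x"
  shows "D2 u z a b = D2 v z a b"
  unfolding D2_def
proof (rule frechet_derivative_transform_within_open[OF _ assms(2,3), THEN fun_cong])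
  show "(\<lambda>x. frechet_derivative u (at x) a) differentiable at z"
    using Ck2_derivs(2)[OF assms(1)] by (auto simp: differentiable_def)
  show "frechet_derivative u (at x) a = frechet_derivative v (at x) a" if "x \<in> S" for x
    by (rule frechet_derivative_transform_within_open[OF _ assms(2) that assms(4), THEN fun_cong])
      (use Ck2_derivs(1)[OF assms(1)] in \<open>auto simp: differentiable_def\<close>)
qed

lemma ddbar_cong:
  assumes "Ck 2 u" "Ck 2 v" "open S" "z \<in> S" "\<And>x. x \<in> S \<Longrightarrow> u x = v x"
  shows "ddbar u z = ddbar v z"
proof -
  have "D2 u z a b = D2 v z a b" for a b
    by (rule D2_cong[OF assms(1,3,4)]) (rule assms(5))
  then show ?thesis
    unfolding vec_eq_iff ddbar_nth[OF assms(1)] ddbar_nth[OF assms(2)] by simp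
qed

lemma levi_cong:
  assumes "Ck 2 u" "open S" "z \<in> S" "\<And>x. x \<in> S \<Longrightarrow> u x = v x"
  shows "levi u z \<xi> = levi v z \<xi>"
proof -
  have "D2 u z a b = D2 v z a b" for a b
    by (rule D2_cong[OF assms(1,2,3)]) (rule assms(4))
  then show ?thesis by (simp add: levi_def)
qed

lemma ddbar_add: "Ck 2 u \<Longrightarrow> Ck 2 v \<Longrightarrow> ddbar (\<lambda>x. u x + v x) z = ddbar u z + ddbar v z"
  unfolding vec_eq_iff
  by (simp add: ddbar_nth Ck_add D2_add complex_eq_iff add_divide_distrib diff_divide_distrib)

lemma ddbar_scale: "Ck 2 u \<Longrightarrow> ddbar (\<lambda>x. c * u x) z = c *\<^sub>R ddbar u z"
  unfolding vec_eq_iff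
  by (simp add: ddbar_nth Ck_mult D2_scale complex_eq_iff algebra_simps)

lemma ddbar_outside_supp: "Ck 2 u \<Longrightarrow> z \<notin> supp u \<Longrightarrow> ddbar u z = 0"
proof -
  assume u: "Ck 2 u" and z: "z \<notin> supp u"
  have "ddbar u z = ddbar (\<lambda>_. 0) z"
    by (rule ddbar_cong[of _ _ "- supp u"])
      (use u z closed_supp[of u] in \<open>auto simp: not_in_supp\<close>)
  also have "\<dots> = 0"
    using ddbar_scale[of "\<lambda>_. 0" 0 z] by simp
  finally show ?thesis .
qed

lemma supp_ddbar: "Ck 2 u \<Longrightarrow> supp (ddbar u) \<subseteq> supp u"
  by (rule supp_subsetI) (auto simp: closed_supp ddbar_outside_supp)

lemma test_fun_Ck: "test_fun f \<Longrightarrow> Ck n f"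
  by (simp add: test_fun_def)

lemma test_funI: "(\<And>n. Ck n f) \<Longrightarrow> supp f \<subseteq> C \<Longrightarrow> compact C \<Longrightarrow> test_fun f"
  unfolding test_fun_def using compact_supp_subset by blast

lemma compact_supp_test_fun: "test_fun f \<Longrightarrow> compact (supp f)"
  by (simp add: test_fun_def)

lemma test_fun_ddbar: "test_fun u \<Longrightarrow> test_fun (ddbar u)"
  by (rule test_funI[OF Ck_ddbar supp_ddbar compact_supp_test_fun]) (rule test_fun_Ck | assumption)+

lemma continuous_compact_supp_bounded:
  assumes "continuous_on UNIV f" "compact (supp f)"
  obtains M where "M \<ge> 0" "\<And>x. norm (f x) \<le> M"
proof -
  have "bounded (f ` supp f)"
    by (rule compact_imp_bounded[OF compact_continuous_image[OF continuous_on_subset[OF assms(1)] assms(2)]]) simp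
  then obtain M where M: "M > 0" "\<And>x. x \<in> supp f \<Longrightarrow> norm (f x) \<le> M"
    by (auto simp: bounded_pos)
  have "norm (f x) \<le> M" for x
    using M not_in_supp[of x f] by (cases "x \<in> supp f") auto
  with M show ?thesis by (intro that[of M]) auto
qed

text \<open>Compact support makes the bound uniform in \<open>z\<close>, so that a multiple of a
  strictly positive Levi form can absorb that of \<open>u\<close>.\<close>

lemma levi_bounded:
  assumes u: "Ck 2 u" "compact (supp u)"
  obtains M where "M \<ge> 0" "\<And>z \<xi>. \<bar>levi u z \<xi>\<bar> \<le> M * (\<xi> \<bullet> \<xi>)"
proof -
  obtain M where M: "M \<ge> 0" "\<And>z. norm (ddbar u z) \<le> M"
    using continuous_compact_supp_bounded[OF continuous_on_ddbar[OF u(1)] compact_supp_subset[OF supp_ddbar[OF u(1)] u(2)]]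
    by blast
  show ?thesis
  proof (rule that)
    fix z \<xi>
    have "\<bar>levi u z \<xi>\<bar> \<le> real CARD('a) ^ 2 * norm (ddbar u z) * (\<xi> \<bullet> \<xi>)"
      using norm_pair11_le[of "ddbar u z" \<xi>] by (simp add: pair11_ddbar[OF u(1)])
    also have "\<dots> \<le> real CARD('a) ^ 2 * M * (\<xi> \<bullet> \<xi>)"
      by (intro mult_right_mono mult_left_mono M) auto
    finally show "\<bar>levi u z \<xi>\<bar> \<le> real CARD('a) ^ 2 * M * (\<xi> \<bullet> \<xi>)" .
  qed (use M in auto)
qed

section \<open>Positive currents\<close>

lemma supp_add: "supp (\<lambda>z. f z + g z) \<subseteq> supp f \<union> supp (g :: _ \<Rightarrow> 'b::real_normed_vector)"
  by (rule supp_subsetI) (auto simp: closed_supp not_in_supp intro!: closed_Un)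

lemma supp_scaleR: "supp (\<lambda>z. h z *\<^sub>R (f z :: 'b::real_normed_vector)) \<subseteq> supp h"
  by (rule supp_subsetI) (auto simp: closed_supp not_in_supp)

lemma supp_linear: "linear L \<Longrightarrow> supp (\<lambda>z. L (f z)) \<subseteq> supp f"
  by (rule supp_subsetI) (auto simp: closed_supp not_in_supp linear_0)

lemma test_fun_add: "test_fun f \<Longrightarrow> test_fun g \<Longrightarrow> test_fun (\<lambda>z. f z + g z)"
  by (rule test_funI[OF Ck_add supp_add compact_Un]) (auto intro: test_fun_Ck compact_supp_test_fun)

lemma test_fun_scaleR: "test_fun h \<Longrightarrow> (\<And>n. Ck n f) \<Longrightarrow> test_fun (\<lambda>z. h z *\<^sub>R f z)"
  by (rule test_funI[OF Ck_scaleR supp_scaleR]) (auto intro: test_fun_Ck compact_supp_test_fun)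

lemma test_fun_linear: "bounded_linear L \<Longrightarrow> test_fun f \<Longrightarrow> test_fun (\<lambda>z. L (f z))"
  by (rule test_funI[OF Ck_linear_compose supp_linear])
    (auto intro: test_fun_Ck compact_supp_test_fun bounded_linear.linear)

lemma test_fun_uminus: "test_fun f \<Longrightarrow> test_fun (\<lambda>z. - f z)"
  by (rule test_fun_linear[OF bounded_linear_minus[OF bounded_linear_ident]])

lemma test_fun_diff: "test_fun f \<Longrightarrow> test_fun g \<Longrightarrow> test_fun (\<lambda>z. f z - g z)"
  using test_fun_add[OF _ test_fun_uminus, of f g] by simp

lemma pair11_diff: "pair11 (M - N) \<xi> = pair11 M \<xi> - pair11 N \<xi>"
  using pair11_add[of M "- N" \<xi>] by (simp add: pair11_minus)

definition cmul :: "complex \<Rightarrow> complex^'n^'m \<Rightarrow> complex^'n^'m" where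
  "cmul c M = (\<chi> j l. c * M $ j $ l)"

text \<open>The Hermitian adjoint: \<open>M + adjoint_mat M\<close> pairs to twice the real part of
  \<open>pair11 M \<xi>\<close>, which gives access to forms with real pairings.\<close>

definition adjoint_mat :: "complex^'n^'n \<Rightarrow> complex^'n^'n" where
  "adjoint_mat M = (\<chi> j l. cnj (M $ l $ j))"

lemma bounded_linear_cmul: "bounded_linear (cmul c :: complex^'n::finite^'m::finite \<Rightarrow> _)"
  by (rule linear_conv_bounded_linear[THEN iffD1, OF linearI])
    (auto simp: cmul_def vec_eq_iff algebra_simps)

lemma bounded_linear_adjoint_mat: "bounded_linear (adjoint_mat :: complex^'n::finite^'n \<Rightarrow> _)"
  by (rule linear_conv_bounded_linear[THEN iffD1, OF linearI])
    (auto simp: adjoint_mat_def vec_eq_iff)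

lemma pair11_cmul: "pair11 (cmul c M) \<xi> = c * pair11 M \<xi>"
  by (simp add: pair11_def cmul_def sum_distrib_left mult.assoc)

lemma pair11_adjoint_mat: "pair11 (adjoint_mat M) \<xi> = cnj (pair11 M \<xi>)"
  unfolding pair11_def adjoint_mat_def
  by (subst sum.swap) (simp add: algebra_simps)

lemma cmul_of_real: "cmul (complex_of_real c) M = c *\<^sub>R M"
  by (simp add: cmul_def vec_eq_iff complex_eq_iff)

section \<open>Linearity, and vanishing away from the support\<close>

context
  fixes T :: "'n::finite current11"
  assumes T: "current11 T"
begin

lemma current_add: "test_fun \<phi> \<Longrightarrow> test_fun \<psi> \<Longrightarrow> T (\<lambda>z. \<phi> z + \<psi> z) = T \<phi> + T \<psi>"
  using T unfolding current11_def by blast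

lemma current_cmul: "test_fun \<phi> \<Longrightarrow> T (\<lambda>z. cmul c (\<phi> z)) = c * T \<phi>"
  using T unfolding current11_def cmul_def by blast

lemma current_scaleR: "test_fun \<phi> \<Longrightarrow> T (\<lambda>z. c *\<^sub>R \<phi> z) = c *\<^sub>R T \<phi>"
  using current_cmul[of \<phi> "complex_of_real c"] by (simp add: cmul_of_real scaleR_conv_of_real)

lemma current_uminus: "test_fun \<phi> \<Longrightarrow> T (\<lambda>z. - \<phi> z) = - T \<phi>"
  using current_scaleR[of \<phi> "-1"] by simp

lemma current_diff: "test_fun \<phi> \<Longrightarrow> test_fun \<psi> \<Longrightarrow> T (\<lambda>z. \<phi> z - \<psi> z) = T \<phi> - T \<psi>"
  using current_add[OF _ test_fun_uminus, of \<phi> \<psi>] by (simp add: current_uminus)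

lemma current_zero: "T (\<lambda>z. 0) = 0"
  using current_scaleR[of "\<lambda>_. 0" 0] by (simp add: test_fun_def supp_def)

text \<open>\<open>current_supp\<close> is the complement of a union of open sets on each of which
  \<open>T\<close> vanishes; that it vanishes on the union is a partition-of-unity argument. The
  support of \<open>\<phi>\<close> is covered by finitely many balls, which cutoffs remove one at a
  time.\<close>

lemma current_zero_outside_supp:
  assumes "test_fun \<phi>" "supp \<phi> \<inter> current_supp T = {}"
  shows "T \<phi> = 0"
proof -
  \<comment> \<open>The doubled radius leaves room for a cutoff that is 1 on the covering
    ball.\<close>
  define N where "N x r \<longleftrightarrow> r > 0 \<and> (\<forall>\<phi>. test_fun \<phi> \<longrightarrow> supp \<phi> \<subseteq> cball x (2 * r) \<longrightarrow> T \<phi> = 0)" for x r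
  have cover: "\<exists>r. N x r" if "x \<in> supp \<phi>" for x
  proof -
    have "x \<notin> current_supp T" using that assms(2) by blast
    then obtain U where U: "open U" "x \<in> U"
        "\<forall>\<phi>. test_fun \<phi> \<longrightarrow> supp \<phi> \<subseteq> U \<longrightarrow> T \<phi> = 0"
      unfolding current_supp_def by auto
    obtain e where "e > 0" "cball x e \<subseteq> U"
      using U(1,2) open_contains_cball by blast
    then have "N x (e / 2)"
      using U(3) by (auto simp: N_def)
    then show ?thesis ..
  qed
  have *: "T \<psi> = 0" if "finite F" "\<forall>(x, r)\<in>F. N x r" "test_fun \<psi>" "supp \<psi> \<subseteq> (\<Union>(x, r)\<in>F. ball x r)" for F \<psi>
    using that
  proof (induction F arbitrary: \<psi> rule: finite_induct)
    case empty
    then have "\<psi> = (\<lambda>z. 0)" by (auto simp: fun_eq_iff not_in_supp)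
    then show ?case using current_zero by simp
  next
    case (insert p F)
    obtain x r where p: "p = (x, r)" by fastforce
    have N: "N x r" using insert.prems p by auto
    then have "r < 2 * r" by (simp add: N_def)
    from cutoff_exists[OF this, of x] obtain \<eta> :: "complex^'n \<Rightarrow> real"
      where \<eta>: "test_fun \<eta>" "\<And>z. 0 \<le> \<eta> z" "\<And>z. \<eta> z \<le> 1"
        "\<And>z. z \<in> cball x r \<Longrightarrow> \<eta> z = 1" "supp \<eta> \<subseteq> cball x (2 * r)"
      by blast
    have 1: "test_fun (\<lambda>z. \<eta> z *\<^sub>R \<psi> z)"
      by (rule test_fun_scaleR[OF \<eta>(1) test_fun_Ck[OF insert.prems(2)]])
    have "T (\<lambda>z. \<eta> z *\<^sub>R \<psi> z) = 0"
      using N 1 supp_scaleR[of \<eta> \<psi>] \<eta>(5) unfolding N_def by blast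
    moreover have "T (\<lambda>z. \<psi> z - \<eta> z *\<^sub>R \<psi> z) = 0"
    proof (rule insert.IH)
      show "test_fun (\<lambda>z. \<psi> z - \<eta> z *\<^sub>R \<psi> z)"
        by (rule test_fun_diff[OF insert.prems(2) 1])
      \<comment> \<open>Since \<open>\<eta>\<close> is 1 on the ball and the ball is open, even the
        closed support of the remainder avoids it.\<close>
      have "supp (\<lambda>z. \<psi> z - \<eta> z *\<^sub>R \<psi> z) \<subseteq> supp \<psi> - ball x r"
        by (rule supp_subsetI) (auto simp: closed_supp not_in_supp \<eta>(4))
      then show "supp (\<lambda>z. \<psi> z - \<eta> z *\<^sub>R \<psi> z) \<subseteq> (\<Union>(x, r)\<in>F. ball x r)"
        using insert.prems(3) p by auto
    qed (use insert.prems in auto)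
    ultimately show ?case
      using current_diff[OF insert.prems(2) 1] by simp
  qed
  obtain r where r: "\<And>x. x \<in> supp \<phi> \<Longrightarrow> N x (r x)"
    using cover by metis
  obtain C where C: "C \<subseteq> supp \<phi>" "finite C" "supp \<phi> \<subseteq> (\<Union>x\<in>C. ball x (r x))"
  proof (rule compactE_image[OF compact_supp_test_fun[OF assms(1)], of "supp \<phi>" "\<lambda>x. ball x (r x)"])
    show "supp \<phi> \<subseteq> (\<Union>x\<in>supp \<phi>. ball x (r x))"
      using r unfolding N_def by force
  qed auto
  show ?thesis
    by (rule *[of "(\<lambda>x. (x, r x)) ` C"]) (use C r assms(1) in auto)
qed

end

section \<open>Domination by the trace measure, and order zero\<close>

lemma positive_current_imp_current: "positive_current T \<Longrightarrow> current11 T"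
  by (simp add: positive_current_def)

lemma closed_nonneg_Reals: "closed (\<real>\<^sub>\<ge>\<^sub>0 :: complex set)"
proof -
  have eq: "(\<real>\<^sub>\<ge>\<^sub>0 :: complex set) = {z. 0 \<le> Re z} \<inter> {z. Im z = 0}"
    by (auto simp: complex_nonneg_Reals_iff)
  show ?thesis
    unfolding eq by (intro closed_Int closed_Collect_le closed_Collect_eq continuous_intros)
qed

lemma positive_form_trace: "(\<And>z. 0 \<le> \<eta> z) \<Longrightarrow> positive_form (\<lambda>z. \<eta> z *\<^sub>R mat 1)"
  by (auto simp: positive_form_def pair11_scaleR pair11_mat_1 complex_nonneg_Reals_iff)

context
  fixes T :: "'n::finite current11"
  assumes T: "positive_current T"
begin

private lemmas T' = positive_current_imp_current[OF T]

lemma positive_current_nonneg: "test_fun \<phi> \<Longrightarrow> positive_form \<phi> \<Longrightarrow> T \<phi> \<in> \<real>\<^sub>\<ge>\<^sub>0"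
  using T unfolding positive_current_def by blast

text \<open>Adding \<open>\<psi>\<close> to, or subtracting it from, \<open>B\<close> times
  \<open>\<eta>\<close> times the identity leaves a positive form, so \<open>T \<psi>\<close> is
  real and squeezed from both sides.\<close>

lemma hermitian_bound:
  assumes \<eta>: "test_fun \<eta>" "\<And>z. 0 \<le> \<eta> z" and \<psi>: "test_fun \<psi>"
    and bound: "\<And>z \<xi>. pair11 (\<psi> z) \<xi> \<in> \<real>" "\<And>z \<xi>. norm (pair11 (\<psi> z) \<xi>) \<le> B * \<eta> z * (\<xi> \<bullet> \<xi>)"
  shows "norm (T \<psi>) \<le> B * Re (T (\<lambda>z. \<eta> z *\<^sub>R mat 1))"
proof -
  let ?I = "\<lambda>z. \<eta> z *\<^sub>R mat 1 :: complex^'n^'n"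
  have I: "test_fun ?I" by (rule test_fun_scaleR[OF \<eta>(1) Ck_const])
  have BI: "test_fun (\<lambda>z. B *\<^sub>R ?I z)"
    by (rule test_fun_linear[OF bounded_linear_scaleR_right I])
  have TI: "T ?I \<in> \<real>\<^sub>\<ge>\<^sub>0"
    by (rule positive_current_nonneg[OF I positive_form_trace[OF \<eta>(2)]])
  have pm: "B * \<eta> z * (\<xi> \<bullet> \<xi>) + Re (pair11 (\<psi> z) \<xi>) \<ge> 0" "B * \<eta> z * (\<xi> \<bullet> \<xi>) - Re (pair11 (\<psi> z) \<xi>) \<ge> 0"
      "Im (pair11 (\<psi> z) \<xi>) = 0" for z \<xi>
    using bound[of z \<xi>] abs_Re_le_cmod[of "pair11 (\<psi> z) \<xi>"] by (auto simp: complex_is_Real_iff)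
  have "T (\<lambda>z. B *\<^sub>R ?I z + \<psi> z) \<in> \<real>\<^sub>\<ge>\<^sub>0"
    by (rule positive_current_nonneg[OF test_fun_add[OF BI \<psi>]])
      (use pm in \<open>auto simp: positive_form_def pair11_scaleR pair11_mat_1 pair11_add complex_nonneg_Reals_iff mult.assoc\<close>)
  moreover have "T (\<lambda>z. B *\<^sub>R ?I z - \<psi> z) \<in> \<real>\<^sub>\<ge>\<^sub>0"
    by (rule positive_current_nonneg[OF test_fun_diff[OF BI \<psi>]])
      (use pm in \<open>auto simp: positive_form_def pair11_scaleR pair11_mat_1 pair11_diff complex_nonneg_Reals_iff mult.assoc\<close>)
  ultimately have "B *\<^sub>R T ?I + T \<psi> \<in> \<real>\<^sub>\<ge>\<^sub>0" "B *\<^sub>R T ?I - T \<psi> \<in> \<real>\<^sub>\<ge>\<^sub>0"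
    by (simp_all only: current_add[OF T' BI \<psi>] current_diff[OF T' BI \<psi>] current_scaleR[OF T' I])
  then have "Im (T \<psi>) = 0" "\<bar>Re (T \<psi>)\<bar> \<le> B * Re (T ?I)"
    using TI by (auto simp: complex_nonneg_Reals_iff)
  then show ?thesis
    using cmod_eq_Re by simp
qed

text \<open>Only forms with real pairings can be compared with multiples of the identity, so a
  general form is split into its Hermitian and skew-Hermitian parts. The bound also turns zero trace
  mass into vanishing of \<open>T\<close>.\<close>

lemma current_bound:
  assumes \<eta>: "test_fun \<eta>" "\<And>z. 0 \<le> \<eta> z" and \<phi>: "test_fun \<phi>"
    and bound: "\<And>z. norm (\<phi> z) \<le> M * \<eta> z"
  shows "norm (T \<phi>) \<le> 2 * real CARD('n) ^ 2 * M * Re (T (\<lambda>z. \<eta> z *\<^sub>R mat 1))"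
proof -
  define N where "N = real CARD('n) ^ 2"
  let ?t = "Re (T (\<lambda>z. \<eta> z *\<^sub>R mat 1))"
  have pb: "norm (pair11 (\<phi> z) \<xi>) \<le> N * M * \<eta> z * (\<xi> \<bullet> \<xi>)" for z \<xi>
  proof -
    have "norm (pair11 (\<phi> z) \<xi>) \<le> N * norm (\<phi> z) * (\<xi> \<bullet> \<xi>)"
      unfolding N_def by (rule norm_pair11_le)
    also have "\<dots> \<le> N * (M * \<eta> z) * (\<xi> \<bullet> \<xi>)"
      by (intro mult_right_mono mult_left_mono bound) (auto simp: N_def)
    finally show ?thesis by (simp add: mult.assoc)
  qed
  \<comment> \<open>\<open>S 1\<close> is twice the Hermitian part of \<open>\<phi>\<close> and
    \<open>cmul (- \<i>) (S \<i> z)\<close> twice the skew-Hermitian part; every \<open>S c\<close>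
    has real pairings.\<close>
  define S where "S c z = cmul c (\<phi> z) + adjoint_mat (cmul c (\<phi> z))" for c z
  have S: "test_fun (S c)" for c
    unfolding S_def
    by (intro test_fun_add test_fun_linear[OF bounded_linear_adjoint_mat] test_fun_linear[OF bounded_linear_cmul] \<phi>)
  have pS: "pair11 (S c z) \<xi> = complex_of_real (2 * Re (c * pair11 (\<phi> z) \<xi>))" for c z \<xi>
    by (simp add: S_def pair11_add pair11_adjoint_mat pair11_cmul complex_eq_iff)
  have bS: "norm (T (S c)) \<le> (2 * (N * M)) * ?t" if "norm c = 1" for c
  proof (rule hermitian_bound[OF \<eta> S])
    show "pair11 (S c z) \<xi> \<in> \<real>" for z \<xi> by (simp add: pS del: of_real_mult)
    have "\<bar>Re (c * pair11 (\<phi> z) \<xi>)\<bar> \<le> N * M * \<eta> z * (\<xi> \<bullet> \<xi>)" for z \<xi>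
      using abs_Re_le_cmod[of "c * pair11 (\<phi> z) \<xi>"] pb[of z \<xi>] that by (simp add: norm_mult)
    then show "norm (pair11 (S c z) \<xi>) \<le> 2 * (N * M) * \<eta> z * (\<xi> \<bullet> \<xi>)" for z \<xi>
      unfolding pS norm_of_real abs_mult by (simp add: mult.assoc)
  qed
  have iS: "test_fun (\<lambda>z. cmul (- \<i>) (S \<i> z))"
    by (rule test_fun_linear[OF bounded_linear_cmul S])
  have "\<phi> = (\<lambda>z. (1 / 2) *\<^sub>R (S 1 z + cmul (- \<i>) (S \<i> z)))"
    by (simp add: fun_eq_iff S_def vec_eq_iff cmul_def adjoint_mat_def complex_eq_iff)
  then have "T \<phi> = (1 / 2) *\<^sub>R (T (S 1) + - \<i> * T (S \<i>))"
    using current_scaleR[OF T' test_fun_add[OF S iS], of "1/2" 1] current_add[OF T' S iS, of 1]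
      current_cmul[OF T' S[of \<i>], of "- \<i>"] by simp
  then have "norm (T \<phi>) \<le> (1 / 2) * (norm (T (S 1)) + norm (T (S \<i>)))"
    using norm_triangle_ineq[of "T (S 1)" "- \<i> * T (S \<i>)"] by (simp add: norm_mult)
  with bS[of 1] bS[of \<i>] show ?thesis
    by (simp add: N_def algebra_simps)
qed

lemma current_order_zero:
  assumes "compact C"
  obtains A where "A \<ge> 0"
    "\<And>\<phi> M. test_fun \<phi> \<Longrightarrow> supp \<phi> \<subseteq> C \<Longrightarrow> (\<And>z. norm (\<phi> z) \<le> M) \<Longrightarrow> norm (T \<phi>) \<le> A * M"
proof -
  obtain R where R: "C \<subseteq> cball 0 R"
    using compact_imp_bounded[OF assms] by (auto simp: bounded_iff subset_iff)
  obtain \<eta> :: "complex^'n \<Rightarrow> real" where \<eta>: "test_fun \<eta>" "\<And>z. 0 \<le> \<eta> z" "\<And>z. z \<in> cball 0 R \<Longrightarrow> \<eta> z = 1"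
    using cutoff_exists[of R "R + 1" "0 :: complex^'n"] by (metis less_add_one)
  let ?A = "2 * real CARD('n) ^ 2 * Re (T (\<lambda>z. \<eta> z *\<^sub>R mat 1))"
  show ?thesis
  proof (rule that)
    have "T (\<lambda>z. \<eta> z *\<^sub>R mat 1) \<in> \<real>\<^sub>\<ge>\<^sub>0"
      by (rule positive_current_nonneg[OF test_fun_scaleR[OF \<eta>(1) Ck_const] positive_form_trace[OF \<eta>(2)]])
    then show "?A \<ge> 0" by (auto simp: complex_nonneg_Reals_iff)
    fix \<phi> :: "'n form11" and M assume \<phi>: "test_fun \<phi>" "supp \<phi> \<subseteq> C" "\<And>z. norm (\<phi> z) \<le> M"
    have "norm (\<phi> z) \<le> M * \<eta> z" for z
    proof (cases "z \<in> C")
      case False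
      then have "norm (\<phi> z) = 0" using \<phi>(2) not_in_supp[of z \<phi>] by auto
      moreover have "0 \<le> M" using \<phi>(3)[of z] norm_ge_zero order_trans by blast
      ultimately show ?thesis using \<eta>(2)[of z] by simp
    qed (use R \<eta>(3) \<phi>(3) in auto)
    from current_bound[OF \<eta>(1,2) \<phi>(1) this] show "norm (T \<phi>) \<le> ?A * M"
      by (simp add: mult_ac)
  qed
qed

lemma current_null_sequence:
  assumes "compact C" "\<And>n. test_fun (\<phi> n)" "\<And>n. supp (\<phi> n) \<subseteq> C"
    "uniform_limit UNIV \<phi> (\<lambda>_. 0) F"
  shows "((\<lambda>n. T (\<phi> n)) \<longlongrightarrow> 0) F"
proof -
  obtain A where A: "A \<ge> 0"
    "\<And>\<phi> M. test_fun \<phi> \<Longrightarrow> supp \<phi> \<subseteq> C \<Longrightarrow> (\<And>z. norm (\<phi> z) \<le> M) \<Longrightarrow> norm (T \<phi>) \<le> A * M"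
    using current_order_zero[OF assms(1)] by metis
  show ?thesis
  proof (rule tendstoI)
    fix e :: real assume e: "e > 0"
    then have "e / (A + 1) > 0" using A(1) by simp
    then have "\<forall>\<^sub>F n in F. \<forall>z\<in>UNIV. dist (\<phi> n z) 0 < e / (A + 1)"
      using assms(4) unfolding uniform_limit_iff by blast
    then show "\<forall>\<^sub>F n in F. dist (T (\<phi> n)) 0 < e"
    proof eventually_elim
      case (elim n)
      have "norm (T (\<phi> n)) \<le> A * (e / (A + 1))"
        by (rule A(2)[OF assms(2,3)]) (use elim in \<open>auto intro: less_imp_le\<close>)
      also have "\<dots> < e" using e A(1) by (simp add: field_simps)
      finally show ?case by simp
    qed
  qed
qed

text \<open>The filter is arbitrary because two are used: along the product filter the mollified
  sequence turns out to be Cauchy, along \<open>sequentially\<close> every other approximation gets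
  the same limit.\<close>

lemma current_approximations_agree:
  assumes "compact C" "\<And>n. test_fun (\<phi> n)" "\<And>n. supp (\<phi> n) \<subseteq> C" "uniform_limit UNIV \<phi> \<psi> F"
    and "compact D" "\<And>n. test_fun (\<phi>' n)" "\<And>n. supp (\<phi>' n) \<subseteq> D" "uniform_limit UNIV \<phi>' \<psi> F"
  shows "((\<lambda>n. T (\<phi> n) - T (\<phi>' n)) \<longlongrightarrow> 0) F"
proof -
  have "uniform_limit UNIV (\<lambda>n z. \<phi> n z - \<phi>' n z) (\<lambda>z. \<psi> z - \<psi> z) F"
    by (rule uniform_limit_minus[OF assms(4,8)])
  then have lim: "uniform_limit UNIV (\<lambda>n z. \<phi> n z - \<phi>' n z) (\<lambda>z. 0) F"
    by simp
  have "supp (\<lambda>z. \<phi> n z - \<phi>' n z) \<subseteq> supp (\<phi> n) \<union> supp (\<phi>' n)" for n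
    by (rule supp_subsetI) (auto simp: closed_supp not_in_supp intro!: closed_Un)
  then have "supp (\<lambda>z. \<phi> n z - \<phi>' n z) \<subseteq> C \<union> D" for n
    using assms(3,7) by blast
  from current_null_sequence[OF compact_Un[OF assms(1,5)] test_fun_diff[OF assms(2,6)] this lim]
  have "((\<lambda>n. T (\<lambda>z. \<phi> n z - \<phi>' n z)) \<longlongrightarrow> 0) F" .
  then show ?thesis
    by (simp add: current_diff[OF T' assms(2,6)])
qed

end

section \<open>Extension to continuous forms\<close>

lemma mollified_approximation:
  fixes \<psi> :: "'a::euclidean_space \<Rightarrow> 'b::banach"
  assumes "continuous_on UNIV \<psi>" "compact (supp \<psi>)"
  obtains C where "compact C" "\<And>n. test_fun (mollify (bump_kernel (inverse (real (Suc n)))) \<psi>)"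
    "\<And>n. supp (mollify (bump_kernel (inverse (real (Suc n)))) \<psi>) \<subseteq> C"
proof -
  obtain R where R: "supp \<psi> \<subseteq> cball 0 R"
    using compact_supp_cball[OF assms(2)] .
  show ?thesis
  proof (rule that)
    fix n
    have "supp (mollify (bump_kernel (inverse (real (Suc n)))) \<psi>) \<subseteq> cball 0 (R + inverse (real (Suc n)))"
      by (rule supp_mollify_cball[OF _ R]) simp
    also have "\<dots> \<subseteq> cball 0 (R + 1)"
      by (rule subset_cball) (simp add: field_simps)
    finally show "supp (mollify (bump_kernel (inverse (real (Suc n)))) \<psi>) \<subseteq> cball 0 (R + 1)" .
  qed (auto intro!: test_fun_mollify assms)
qed

context
  fixes T :: "'n::finite current11"
  assumes T: "positive_current T"
begin

private lemmas current_T = positive_current_imp_current[OF T]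

text \<open>This justifies the definite description in \<open>current_ext\<close>: mollification
  supplies one convergent approximation, which pins down the value, and all others share its
  limit.\<close>

lemma current_ext_tendsto:
  assumes \<psi>: "continuous_on UNIV \<psi>" "compact (supp \<psi>)"
    and \<phi>: "compact C" "\<And>n. test_fun (\<phi> n)" "\<And>n. supp (\<phi> n) \<subseteq> C" "uniform_limit UNIV \<phi> \<psi> sequentially"
  shows "(\<lambda>n. T (\<phi> n)) \<longlonglongrightarrow> current_ext T \<psi>"
proof -
  let ?m = "\<lambda>n. mollify (bump_kernel (inverse (real (Suc n)))) \<psi>"
  obtain D where D: "compact D" "\<And>n. test_fun (?m n)" "\<And>n. supp (?m n) \<subseteq> D"
    using mollified_approximation[OF \<psi>] by blast
  note lim = uniform_limit_mollify[OF \<psi>]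
  have "((\<lambda>p. T (?m (fst p)) - T (?m (snd p))) \<longlongrightarrow> 0) (sequentially \<times>\<^sub>F sequentially)"
    by (rule current_approximations_agree[OF T D(1) D(2) D(3) _ D(1) D(2) D(3)])
      (rule filterlim_compose[OF lim filterlim_fst] filterlim_compose[OF lim filterlim_snd])+
  then have ev: "\<forall>\<^sub>F p in sequentially \<times>\<^sub>F sequentially. dist (T (?m (fst p)) - T (?m (snd p))) 0 < e" if "e > 0" for e
    using that by (rule tendstoD)
  have "Cauchy (\<lambda>n. T (?m n))"
  proof (rule CauchyI)
    fix e :: real assume "e > 0"
    from ev[OF this] show "\<exists>M. \<forall>m\<ge>M. \<forall>n\<ge>M. norm (T (?m m) - T (?m n)) < e"
      unfolding eventually_prod_sequentially by auto
  qed
  then obtain c where c: "(\<lambda>n. T (?m n)) \<longlonglongrightarrow> c"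
    using Cauchy_convergent convergent_def by blast
  have "(\<lambda>n. T (\<phi>' n)) \<longlonglongrightarrow> c" if "compact C'" "\<forall>n. test_fun (\<phi>' n) \<and> supp (\<phi>' n) \<subseteq> C'"
      "uniform_limit UNIV \<phi>' \<psi> sequentially" for \<phi>' C'
    using tendsto_add[OF current_approximations_agree[OF T that(1) _ _ that(3) D lim] c] that(2) by simp
  note all = this
  have "current_ext T \<psi> = c"
    unfolding current_ext_def
  proof (rule the_equality)
    fix c' assume *: "\<forall>\<phi> C. compact C \<longrightarrow> (\<forall>n. test_fun (\<phi> n) \<and> supp (\<phi> n) \<subseteq> C) \<longrightarrow>
      uniform_limit UNIV \<phi> \<psi> sequentially \<longrightarrow> (\<lambda>n. T (\<phi> n)) \<longlonglongrightarrow> c'"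
    have "(\<lambda>n. T (?m n)) \<longlonglongrightarrow> c'"
      by (rule *[rule_format, OF D(1) conjI[OF D(2,3)] lim])
    then show "c' = c" using c by (rule LIMSEQ_unique)
  qed (intro allI impI, rule all)
  then show ?thesis
    using all[OF \<phi>(1) _ \<phi>(4)] \<phi>(2,3) by blast
qed

lemma current_ext_eqI:
  assumes \<psi>: "continuous_on UNIV \<psi>" "compact (supp \<psi>)"
    and "(\<lambda>n. T (mollify (bump_kernel (inverse (real (Suc n)))) \<psi>)) \<longlonglongrightarrow> c"
  shows "current_ext T \<psi> = c"
proof -
  obtain C where "compact C" "\<And>n. test_fun (mollify (bump_kernel (inverse (real (Suc n)))) \<psi>)"
    "\<And>n. supp (mollify (bump_kernel (inverse (real (Suc n)))) \<psi>) \<subseteq> C"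
    using mollified_approximation[OF \<psi>] by blast
  from current_ext_tendsto[OF \<psi> this uniform_limit_mollify[OF \<psi>]] assms(3)
  show ?thesis by (rule LIMSEQ_unique)
qed

lemma current_ext_test_fun:
  assumes "test_fun \<phi>"
  shows "current_ext T \<phi> = T \<phi>"
proof -
  have "(\<lambda>n. T \<phi>) \<longlonglongrightarrow> current_ext T \<phi>"
    by (rule current_ext_tendsto[where C = "supp \<phi>"])
      (use assms in \<open>auto intro: Ck_imp_continuous_on[OF test_fun_Ck] compact_supp_test_fun
        simp: uniform_limit_iff\<close>)
  then show ?thesis
    by (simp add: LIMSEQ_const_iff)
qed

lemma current_ext_add:
  assumes \<phi>: "continuous_on UNIV \<phi>" "compact (supp \<phi>)" and \<psi>: "continuous_on UNIV \<psi>" "compact (supp \<psi>)"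
  shows "current_ext T (\<lambda>z. \<phi> z + \<psi> z) = current_ext T \<phi> + current_ext T \<psi>"
proof -
  let ?m = "\<lambda>\<phi> n. mollify (bump_kernel (inverse (real (Suc n)))) \<phi> :: 'n form11"
  obtain C where C: "compact C" "\<And>n. test_fun (?m \<phi> n)" "\<And>n. supp (?m \<phi> n) \<subseteq> C"
    using mollified_approximation[OF \<phi>] by blast
  obtain D where D: "compact D" "\<And>n. test_fun (?m \<psi> n)" "\<And>n. supp (?m \<psi> n) \<subseteq> D"
    using mollified_approximation[OF \<psi>] by blast
  have "(\<lambda>n. T (\<lambda>z. ?m \<phi> n z + ?m \<psi> n z)) \<longlonglongrightarrow> current_ext T (\<lambda>z. \<phi> z + \<psi> z)"
  proof (rule current_ext_tendsto[where C = "C \<union> D"])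
    show "compact (supp (\<lambda>z. \<phi> z + \<psi> z))"
      by (rule compact_supp_subset[OF supp_add compact_Un[OF \<phi>(2) \<psi>(2)]])
    show "supp (\<lambda>z. ?m \<phi> n z + ?m \<psi> n z) \<subseteq> C \<union> D" for n
      using supp_add[of "?m \<phi> n" "?m \<psi> n"] C(3) D(3) by blast
    show "uniform_limit UNIV (\<lambda>n z. ?m \<phi> n z + ?m \<psi> n z) (\<lambda>z. \<phi> z + \<psi> z) sequentially"
      by (rule uniform_limit_add[OF uniform_limit_mollify[OF \<phi>] uniform_limit_mollify[OF \<psi>]])
  qed (rule compact_Un[OF C(1) D(1)] test_fun_add[OF C(2) D(2)] continuous_on_add[OF \<phi>(1) \<psi>(1)])+
  moreover have "(\<lambda>n. T (?m \<phi> n) + T (?m \<psi> n)) \<longlonglongrightarrow> current_ext T \<phi> + current_ext T \<psi>"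
    by (intro tendsto_add current_ext_tendsto[OF \<phi> C uniform_limit_mollify[OF \<phi>]]
        current_ext_tendsto[OF \<psi> D uniform_limit_mollify[OF \<psi>]])
  ultimately show ?thesis
    unfolding current_add[OF current_T C(2) D(2)] by (rule LIMSEQ_unique)
qed

text \<open>The extra unit of radius on which \<open>\<psi>\<close> vanishes keeps mollifications of
  radius below 1 disjoint in support from \<open>T\<close>.\<close>

lemma current_ext_outside_supp:
  assumes \<psi>: "continuous_on UNIV \<psi>" "compact (supp \<psi>)"
    and R: "current_supp T \<subseteq> cball 0 R" "\<And>z. z \<in> cball 0 (R + 1) \<Longrightarrow> \<psi> z = 0"
  shows "current_ext T \<psi> = 0"
proof (rule current_ext_eqI[OF \<psi>])
  \<comment> \<open>At \<open>n = 0\<close> the radius is 1, and the support of the mollification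
    could touch the ball of radius \<open>R\<close>.\<close>
  have "T (mollify (bump_kernel (inverse (real (Suc n)))) \<psi>) = 0" if "n \<ge> 1" for n
  proof (rule current_zero_outside_supp[OF current_T test_fun_mollify[OF _ \<psi>]])
    have n: "inverse (real (Suc n)) < 1"
      using that by (simp add: field_simps)
    let ?m = "mollify (bump_kernel (inverse (real (Suc n)))) \<psi>"
    have "?m z = 0" if "z \<in> ball 0 (R + (1 - inverse (real (Suc n))))" for z
    proof (rule ccontr)
      assume "?m z \<noteq> 0"
      then obtain y where y: "dist z y \<le> inverse (real (Suc n))" "\<psi> y \<noteq> 0"
        using mollify_nonzeroD[of "inverse (real (Suc n))" \<psi> z] by auto
      have "dist 0 y \<le> dist 0 z + dist z y"
        by (rule dist_triangle)
      then have "y \<in> cball 0 (R + 1)"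
        using y(1) that by simp
      with R(2) y(2) show False by simp
    qed
    then have "supp ?m \<subseteq> - ball 0 (R + (1 - inverse (real (Suc n))))"
      by (intro supp_subsetI) auto
    moreover have "cball 0 R \<subseteq> ball (0::complex^'n) (R + (1 - inverse (real (Suc n))))"
      using n by auto
    ultimately show "supp ?m \<inter> current_supp T = {}"
      using R(1) by blast
  qed simp
  then have "\<forall>\<^sub>F n in sequentially. T (mollify (bump_kernel (inverse (real (Suc n)))) \<psi>) = 0"
    unfolding eventually_sequentially by blast
  then show "(\<lambda>n. T (mollify (bump_kernel (inverse (real (Suc n)))) \<psi>)) \<longlonglongrightarrow> 0"
    by (rule tendsto_eventually)
qed

end

section \<open>Linear functionals below sublinear ones\<close>

lemma le_Inf_add:
  fixes A B :: "real set"
  assumes "A \<noteq> {}" "B \<noteq> {}" "\<And>a b. a \<in> A \<Longrightarrow> b \<in> B \<Longrightarrow> m \<le> a + b"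
  shows "m \<le> Inf A + Inf B"
proof -
  have "m - Inf B \<le> a" if "a \<in> A" for a
  proof -
    have "m - a \<le> Inf B"
      by (rule cInf_greatest[OF assms(2)]) (use assms(3)[OF that] in \<open>simp add: algebra_simps\<close>)
    then show ?thesis by simp
  qed
  from cInf_greatest[OF assms(1) this] show ?thesis by simp
qed

lemma le_Inf_scale:
  fixes A :: "real set"
  assumes "A \<noteq> {}" "c > 0" "\<And>a. a \<in> A \<Longrightarrow> m \<le> c * a"
  shows "m \<le> c * Inf A"
proof -
  have "m / c \<le> Inf A"
    by (rule cInf_greatest[OF assms(1)]) (use assms(2,3) in \<open>simp add: field_simps\<close>)
  then show ?thesis
    using assms(2) by (simp add: field_simps)
qed

definition sublinear :: "('a::real_vector \<Rightarrow> real) \<Rightarrow> bool" where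
  "sublinear p \<longleftrightarrow> (\<forall>x y. p (x + y) \<le> p x + p y) \<and> (\<forall>c x. c \<ge> 0 \<longrightarrow> p (c *\<^sub>R x) = c * p x)"

text \<open>The inequality for \<open>c\<close> yields the reverse one when applied to
  \<open>inverse c\<close> and \<open>c *\<^sub>R x\<close>.\<close>

lemma sublinearI:
  assumes add: "\<And>x y. p (x + y) \<le> p x + p y" and scale: "\<And>c x. c > 0 \<Longrightarrow> p (c *\<^sub>R x) \<le> c * p x"
    and zero: "p 0 = 0"
  shows "sublinear p"
proof -
  have "p (c *\<^sub>R x) = c * p x" if "c > 0" for c x
  proof (rule antisym[OF scale[OF that]])
    show "c * p x \<le> p (c *\<^sub>R x)"
      using scale[of "inverse c" "c *\<^sub>R x"] that by (simp add: field_simps)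
  qed
  then show ?thesis
    using add zero unfolding sublinear_def by (metis less_eq_real_def mult_zero_left scale_zero_left)
qed

context
  fixes p :: "'a::real_vector \<Rightarrow> real"
  assumes p: "sublinear p"
begin

lemma sublinear_add: "p (x + y) \<le> p x + p y"
  using p by (simp add: sublinear_def)

lemma sublinear_scale: "c \<ge> 0 \<Longrightarrow> p (c *\<^sub>R x) = c * p x"
  using p by (simp add: sublinear_def)

lemma sublinear_zero: "p 0 = 0"
  using sublinear_scale[of 0 0] by simp

lemma sublinear_uminus: "- p (- x) \<le> p x"
  using sublinear_add[of x "- x"] sublinear_zero by simp

text \<open>The infimum over \<open>t\<close> of \<open>p (x + t y) - t p y\<close> is a sublinear functional below \<open>p\<close>, so a
  minimal \<open>p\<close> satisfies \<open>p x \<le> p (x + y) - p y\<close>.\<close>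

lemma minimal_sublinear_linear:
  assumes min: "\<And>q. sublinear q \<Longrightarrow> (\<And>x. q x \<le> p x) \<Longrightarrow> q = p"
  shows "linear p"
proof -
  have super: "p x + p y \<le> p (x + y)" for x y
  proof -
    define A where "A x = {p (x + t *\<^sub>R y) - t * p y | t. t \<ge> 0}" for x
    have ne: "A x \<noteq> {}" for x by (auto simp: A_def)
    have lower: "- p (- x) \<le> a" if "a \<in> A x" for a x
    proof -
      from that obtain t where t: "t \<ge> 0" "a = p (x + t *\<^sub>R y) - t * p y" by (auto simp: A_def)
      show ?thesis
        using sublinear_add[of "x + t *\<^sub>R y" "- x"] sublinear_scale[OF t(1), of y] t(2) by simp
    qed
    have bdd: "bdd_below (A x)" for x
      using lower by (rule bdd_belowI)
    have below: "Inf (A x) \<le> p (x + t *\<^sub>R y) - t * p y" if "t \<ge> 0" for x t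
      by (rule cInf_lower[OF _ bdd]) (use that in \<open>auto simp: A_def\<close>)
    have "sublinear (\<lambda>x. Inf (A x))"
    proof (rule sublinearI)
      fix x x'
      show "Inf (A (x + x')) \<le> Inf (A x) + Inf (A x')"
      proof (rule le_Inf_add[OF ne ne])
        fix a b assume "a \<in> A x" "b \<in> A x'"
        then obtain t s where ts: "t \<ge> 0" "a = p (x + t *\<^sub>R y) - t * p y"
          "s \<ge> 0" "b = p (x' + s *\<^sub>R y) - s * p y" by (auto simp: A_def)
        have "Inf (A (x + x')) \<le> p (x + x' + (t + s) *\<^sub>R y) - (t + s) * p y"
          using ts by (intro below) auto
        also have "\<dots> \<le> a + b"
          using sublinear_add[of "x + t *\<^sub>R y" "x' + s *\<^sub>R y"] ts by (simp add: algebra_simps)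
        finally show "Inf (A (x + x')) \<le> a + b" .
      qed
    next
      fix c :: real and x assume c: "c > 0"
      show "Inf (A (c *\<^sub>R x)) \<le> c * Inf (A x)"
      proof (rule le_Inf_scale[OF ne c])
        fix a assume "a \<in> A x"
        then obtain t where t: "t \<ge> 0" "a = p (x + t *\<^sub>R y) - t * p y" by (auto simp: A_def)
        have "Inf (A (c *\<^sub>R x)) \<le> p (c *\<^sub>R x + (c * t) *\<^sub>R y) - (c * t) * p y"
          using t c by (intro below) auto
        also have "\<dots> = c * a"
          unfolding t(2) using sublinear_scale[of c "x + t *\<^sub>R y"] c by (simp add: algebra_simps)
        finally show "Inf (A (c *\<^sub>R x)) \<le> c * a" .
      qed
    next
      have "0 \<le> Inf (A 0)"
        by (rule cInf_greatest[OF ne]) (use lower[of _ 0] sublinear_zero in auto)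
      moreover have "Inf (A 0) \<le> 0"
        using below[of 0 0] sublinear_zero by simp
      ultimately show "Inf (A 0) = 0" by simp
    qed
    moreover have "Inf (A x) \<le> p x" for x
      using below[of 0 x] by simp
    ultimately have "(\<lambda>x. Inf (A x)) = p" by (rule min)
    then show ?thesis
      using below[of 1 x] by (simp add: fun_eq_iff)
  qed
  have add: "p (x + y) = p x + p y" for x y
    using super[of x y] sublinear_add[of x y] by simp
  have neg: "p (- x) = - p x" for x
    using add[of x "- x"] sublinear_zero by simp
  have "p (c *\<^sub>R x) = c * p x" for c x
  proof (cases "c \<ge> 0")
    case False
    then show ?thesis
      using sublinear_scale[of "- c" x] neg[of "c *\<^sub>R x"] by simp
  qed (rule sublinear_scale)
  with add show ?thesis by (intro linearI) auto
qed

end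

text \<open>Hahn-Banach without extending from subspaces: Zorn's lemma gives a minimal sublinear
  functional below \<open>p\<close>, and minimal ones are linear.\<close>

lemma ex_linear_le_sublinear:
  fixes p :: "'a::real_vector \<Rightarrow> real"
  assumes p: "sublinear p"
  obtains f where "linear f" "\<And>x. f x \<le> p x"
proof -
  define S where "S = {q. sublinear q \<and> (\<forall>x. q x \<le> p x)}"
  \<comment> \<open>The order is reversed, so that a maximal element for Zorn's lemma is a minimal
    functional.\<close>
  define P where "P q r \<longleftrightarrow> (\<forall>x. r x \<le> q x)" for q r :: "'a \<Rightarrow> real"
  have "\<exists>m\<in>S. \<forall>q\<in>S. P m q \<longrightarrow> q = m"
  proof (rule predicate_Zorn)
    show "partial_order_on S (relation_of P S)"
      by (rule partial_order_on_relation_ofI) (auto simp: P_def fun_eq_iff intro: order_trans antisym)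
    fix C assume "C \<in> Chains (relation_of P S)"
    then have C: "C \<subseteq> S" "\<And>q r. q \<in> C \<Longrightarrow> r \<in> C \<Longrightarrow> P q r \<or> P r q"
      by (auto simp: Chains_def relation_of_def)
    show "\<exists>u\<in>S. \<forall>a\<in>C. P a u"
    proof (cases "C = {}")
      case True
      then show ?thesis using p by (auto simp: S_def)
    next
      case False
      let ?A = "\<lambda>x. (\<lambda>q. q x) ` C"
      have ne: "?A x \<noteq> {}" for x using False by simp
      have lower: "- p (- x) \<le> q x" if "q \<in> C" for q x
      proof -
        have "sublinear q" "q (- x) \<le> p (- x)" using that C(1) by (auto simp: S_def)
        with sublinear_uminus[of q x] show ?thesis by linarith
      qed
      have bdd: "bdd_below (?A x)" for x
        by (rule bdd_belowI[of _ "- p (- x)"]) (use lower in auto)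
      have le: "Inf (?A x) \<le> q x" if "q \<in> C" for q x
        by (rule cInf_lower[OF _ bdd]) (use that in auto)
      have sub: "sublinear q" if "q \<in> C" for q using that C(1) by (auto simp: S_def)
      have "sublinear (\<lambda>x. Inf (?A x))"
      proof (rule sublinearI)
        fix x y
        show "Inf (?A (x + y)) \<le> Inf (?A x) + Inf (?A y)"
        proof (rule le_Inf_add[OF ne ne])
          fix a b assume "a \<in> ?A x" "b \<in> ?A y"
          then obtain q r where qr: "q \<in> C" "a = q x" "r \<in> C" "b = r y" by auto
          \<comment> \<open>Subadditivity of the infimum needs one functional that is below
            \<open>q\<close> at \<open>x\<close> and below \<open>r\<close> at \<open>y\<close>; in
            a chain the smaller of the two does.\<close>
          from C(2)[OF qr(1,3)] obtain s where s: "s \<in> C" "s x \<le> a" "s y \<le> b"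
            using qr unfolding P_def by auto
          have "Inf (?A (x + y)) \<le> s (x + y)" by (rule le[OF s(1)])
          also have "\<dots> \<le> s x + s y" by (rule sublinear_add[OF sub[OF s(1)]])
          finally show "Inf (?A (x + y)) \<le> a + b" using s by simp
        qed
      next
        fix c :: real and x assume c: "c > 0"
        show "Inf (?A (c *\<^sub>R x)) \<le> c * Inf (?A x)"
        proof (rule le_Inf_scale[OF ne c])
          fix a assume "a \<in> ?A x"
          then obtain q where q: "q \<in> C" "a = q x" by auto
          then show "Inf (?A (c *\<^sub>R x)) \<le> c * a"
            using le[OF q(1), of "c *\<^sub>R x"] sublinear_scale[OF sub[OF q(1)], of c x] c by simp
        qed
      next
        have "?A 0 = (\<lambda>_. 0) ` C" by (rule image_cong) (auto simp: sublinear_zero[OF sub])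
        then have "?A 0 = {0}" using False by auto
        then show "Inf (?A 0) = 0" by simp
      qed
      moreover have "Inf (?A x) \<le> p x" for x
      proof -
        obtain q where q: "q \<in> C" using False by blast
        then have "q x \<le> p x" using C(1) by (auto simp: S_def)
        with le[OF q, of x] show ?thesis by linarith
      qed
      ultimately show ?thesis
        using le by (intro bexI[of _ "\<lambda>x. Inf (?A x)"]) (auto simp: S_def P_def)
    qed
  qed
  then obtain m where m: "m \<in> S" "\<And>q. q \<in> S \<Longrightarrow> P m q \<Longrightarrow> q = m" by blast
  have "linear m"
  proof (rule minimal_sublinear_linear)
    show "sublinear m" using m(1) by (simp add: S_def)
    fix q assume q: "sublinear q" "\<And>x. q x \<le> m x"
    then have "q \<in> S" using m(1) order_trans by (fastforce simp: S_def)
    then show "q = m" by (rule m(2)) (simp add: P_def q)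
  qed
  then show ?thesis
    using m(1) by (intro that[of m]) (auto simp: S_def)
qed

section \<open>Supports lie in the hull\<close>

lemma DERIV_pos_part_power:
  "((\<lambda>t. (max 0 (t - c)) ^ Suc (Suc k)) has_real_derivative real (Suc (Suc k)) * (max 0 (t - c)) ^ Suc k) (at t)"
proof -
  consider "t > c" | "t < c" | "t = c" by linarith
  then show ?thesis
  proof cases
    case 1
    have "((\<lambda>t. (t - c) ^ Suc (Suc k)) has_real_derivative real (Suc (Suc k)) * (max 0 (t - c)) ^ Suc k) (at t)"
      using DERIV_power[OF DERIV_diff[OF DERIV_ident DERIV_const[of c]], of "Suc (Suc k)" t] 1
      by (simp add: max_def)
    then show ?thesis
      by (rule has_field_derivative_transform_within_open[of _ _ _ "{c<..}"]) (use 1 in auto)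
  next
    case 2
    have "((\<lambda>t. 0) has_real_derivative real (Suc (Suc k)) * (max 0 (t - c)) ^ Suc k) (at t)"
      using 2 by (auto simp: max_def)
    then show ?thesis
      by (rule has_field_derivative_transform_within_open[of _ _ _ "{..<c}"]) (use 2 in auto)
  next
    case 3
    have "norm ((max 0 h) ^ Suc (Suc k) / h) \<le> \<bar>h\<bar> ^ Suc k" for h :: real
    proof (cases "h > 0")
      case False
      then have "(max 0 h) ^ Suc (Suc k) = 0" by simp
      then show ?thesis by (simp del: power_Suc)
    qed (simp add: max_def)
    moreover have "((\<lambda>h::real. \<bar>h\<bar> ^ Suc k) \<longlongrightarrow> 0) (at 0)"
      by (auto intro!: tendsto_eq_intros)
    ultimately have "((\<lambda>h::real. (max 0 h) ^ Suc (Suc k) / h) \<longlongrightarrow> 0) (at 0)"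
      by (intro Lim_null_comparison[of "\<lambda>h::real. (max 0 h) ^ Suc (Suc k) / h"] always_eventually allI)
    then show ?thesis
      using 3 by (simp add: DERIV_def)
  qed
qed

lemma DERIV_cube_pos_part:
  "((\<lambda>t. (max 0 (t - c)) ^ 3) has_real_derivative 3 * (max 0 (t - c))\<^sup>2) (at t)"
  "((\<lambda>t. 3 * (max 0 (t - c))\<^sup>2) has_real_derivative 6 * max 0 (t - c)) (at t)"
  using DERIV_pos_part_power[of c 1 t] DERIV_cmult[OF DERIV_pos_part_power[of c 0 t], of 3]
  by (simp_all add: numeral_3_eq_3 numeral_2_eq_2)

text \<open>Three is the least integer exponent that gives class C^2. The function is convex and
  nondecreasing, so composing with it preserves nonnegative Levi forms, and it kills all values up
  to \<open>c\<close>.\<close>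

lemma Ck_cube_pos_part: "Ck 2 (\<lambda>t. (max 0 (t - c)) ^ 3 :: real)"
proof -
  have 0: "Ck 0 (\<lambda>t. 6 * max 0 (t - c))"
    by (auto intro!: continuous_intros)
  have "Ck (Suc 0) (\<lambda>t. 3 * (max 0 (t - c))\<^sup>2)"
    by (rule Ck_SucI[OF DERIV_cube_pos_part(2)[unfolded has_field_derivative_def]])
      (rule Ck_mult[OF 0 Ck_const])
  then have "Ck (Suc (Suc 0)) (\<lambda>t. (max 0 (t - c)) ^ 3)"
    by (rule Ck_SucI[OF DERIV_cube_pos_part(1)[unfolded has_field_derivative_def] Ck_mult[OF _ Ck_const]])
  then show ?thesis by (simp only: numeral_2_eq_2)
qed

section \<open>Mollification commutes with the Levi operator\<close>

context
  fixes \<delta> :: real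
  assumes \<delta>: "\<delta> > 0"
begin

lemma mollify_linear:
  fixes f :: "'a::euclidean_space \<Rightarrow> 'b::banach" and L :: "'b \<Rightarrow> 'c::banach"
  assumes "bounded_linear L" "continuous_on UNIV f"
  shows "L (mollify (bump_kernel \<delta>) f x) = mollify (bump_kernel \<delta>) (\<lambda>y. L (f y)) x"
  using integral_linear[OF mollify_integrable[OF \<delta> assms(2)] assms(1), of x]
  by (simp add: mollify_def o_def linear_scale[OF bounded_linear.linear[OF assms(1)]])

lemma mollify_add:
  fixes f g :: "'a::euclidean_space \<Rightarrow> 'b::banach"
  assumes "continuous_on UNIV f" "continuous_on UNIV g"
  shows "mollify (bump_kernel \<delta>) (\<lambda>y. f y + g y) x = mollify (bump_kernel \<delta>) f x + mollify (bump_kernel \<delta>) g x"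
  using integral_add[OF mollify_integrable[OF \<delta> assms(1)] mollify_integrable[OF \<delta> assms(2)], of x x]
  by (simp add: mollify_def scaleR_add_right)

lemma mollify_diff:
  fixes f g :: "'a::euclidean_space \<Rightarrow> 'b::banach"
  assumes "continuous_on UNIV f" "continuous_on UNIV g"
  shows "mollify (bump_kernel \<delta>) (\<lambda>y. f y - g y) x = mollify (bump_kernel \<delta>) f x - mollify (bump_kernel \<delta>) g x"
  using integral_diff[OF mollify_integrable[OF \<delta> assms(1)] mollify_integrable[OF \<delta> assms(2)], of x x]
  by (simp add: mollify_def scaleR_diff_right)

lemma D2_mollify:
  fixes w :: "'a::euclidean_space \<Rightarrow> real"
  assumes "Ck 2 w"
  shows "D2 (mollify (bump_kernel \<delta>) w) z a b = mollify (bump_kernel \<delta>) (\<lambda>x. D2 w x a b) z"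
proof -
  note k = Ck_imp_continuous_on[OF Ck_bump_kernel[OF \<delta>, of 0]] compact_supp_bump_kernel[OF \<delta>]
  have 1: "Ck 1 w" by (rule Ck_mono[OF assms]) simp
  have 2: "Ck 1 (\<lambda>x. frechet_derivative w (at x) a)"
    using assms by (simp add: numeral_2_eq_2)
  show ?thesis
    using D2_eqI[OF mollify_has_derivative_right[OF k 1] mollify_has_derivative_right[OF k 2]]
    by (simp add: D2_def)
qed

text \<open>A differential operator with constant coefficients commutes with convolution. This is
  how a condition on \<open>T (ddbar h)\<close> for smooth \<open>h\<close> reaches functions that
  are only C^2.\<close>

lemma ddbar_mollify:
  fixes w :: "complex^'n::finite \<Rightarrow> real"
  assumes w: "Ck 2 w"
  shows "ddbar (mollify (bump_kernel \<delta>) w) = mollify (bump_kernel \<delta>) (ddbar w)"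
proof
  fix z
  let ?m = "mollify (bump_kernel \<delta>)"
  have mw: "Ck 2 (?m w)"
    by (rule mollify_Ck_right[OF Ck_imp_continuous_on[OF Ck_bump_kernel[OF \<delta>, of 0]] compact_supp_bump_kernel[OF \<delta>] w])
  note cont = continuous_on_D2[OF w]
  have div: "?m (\<lambda>x. f x / 4) z = ?m f z / 4" if "continuous_on UNIV f" for f :: "complex^'n \<Rightarrow> real"
    by (rule mollify_linear[OF bounded_linear_divide that, symmetric])
  have "bounded_linear (\<lambda>M::complex^'n^'n. Re (M $ j $ l))" "bounded_linear (\<lambda>M::complex^'n^'n. Im (M $ j $ l))" for j l
    by (intro bounded_linear_compose[OF bounded_linear_Re] bounded_linear_compose[OF bounded_linear_Im]
        bounded_linear_compose[OF bounded_linear_vec_nth bounded_linear_vec_nth])+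
  note L = this[THEN mollify_linear, OF continuous_on_ddbar[OF w]]
  have "Re (ddbar (?m w) z $ j $ l) = Re (?m (ddbar w) z $ j $ l)" for j l
    unfolding L ddbar_nth[OF mw] ddbar_nth[OF w]
    by (simp add: D2_mollify[OF w] mollify_add div cont continuous_on_add)
  moreover have "Im (ddbar (?m w) z $ j $ l) = Im (?m (ddbar w) z $ j $ l)" for j l
    unfolding L ddbar_nth[OF mw] ddbar_nth[OF w]
    by (simp add: D2_mollify[OF w] mollify_diff div cont continuous_on_diff)
  ultimately show "ddbar (?m w) z = ?m (ddbar w) z"
    by (simp add: vec_eq_iff complex_eq_iff)
qed

end

text \<open>The sign condition on \<open>ddbar_current T\<close> concerns smooth functions supported
  off \<open>K\<close>. The compact \<open>K\<close> and the closed \<open>F\<close> have positive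
  distance, so mollifications of \<open>w\<close> of small radius are such functions.\<close>

lemma ddbar_current_ext_nonpos:
  fixes T :: "'n::finite current11"
  assumes T: "positive_current T" "nonneg_distribution_on (- K) (\<lambda>h. - ddbar_current T h)"
    and K: "compact K" and F: "closed F" "K \<inter> F = {}"
    and w: "Ck 2 w" "compact (supp w)" "\<And>x. 0 \<le> w x" "\<And>x. x \<notin> F \<Longrightarrow> w x = 0"
  shows "- current_ext T (ddbar w) \<in> \<real>\<^sub>\<ge>\<^sub>0"
proof -
  define \<delta> where "\<delta> n = inverse (real (Suc n))" for n
  have \<delta>: "\<delta> n > 0" for n by (simp add: \<delta>_def)
  let ?m = "\<lambda>n. mollify (bump_kernel (\<delta> n)) w"
  have cw: "continuous_on UNIV w" by (rule Ck_imp_continuous_on[OF w(1)])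
  have cd: "continuous_on UNIV (ddbar w)" "compact (supp (ddbar w))"
    by (rule continuous_on_ddbar[OF w(1)], rule compact_supp_subset[OF supp_ddbar[OF w(1)] w(2)])
  obtain C where C: "compact C" "\<And>n. test_fun (mollify (bump_kernel (\<delta> n)) (ddbar w))"
    "\<And>n. supp (mollify (bump_kernel (\<delta> n)) (ddbar w)) \<subseteq> C"
    unfolding \<delta>_def using mollified_approximation[OF cd] by blast
  have "(\<lambda>n. T (mollify (bump_kernel (\<delta> n)) (ddbar w))) \<longlonglongrightarrow> current_ext T (ddbar w)"
    by (rule current_ext_tendsto[OF T(1) cd C]) (unfold \<delta>_def, rule uniform_limit_mollify[OF cd])
  then have lim: "(\<lambda>n. - T (ddbar (?m n))) \<longlonglongrightarrow> - current_ext T (ddbar w)"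
    unfolding ddbar_mollify[OF \<delta> w(1)] by (rule tendsto_minus)
  obtain d where d: "d > 0" "\<And>x y. x \<in> K \<Longrightarrow> y \<in> F \<Longrightarrow> d \<le> dist x y"
    using separate_compact_closed[OF K F] by blast
  have "- T (ddbar (?m n)) \<in> \<real>\<^sub>\<ge>\<^sub>0" if n: "\<delta> n < d" for n
  proof -
    \<comment> \<open>The closed complement of an open neighbourhood of \<open>K\<close>: at a point
      within \<open>d - \<delta> n\<close> of \<open>K\<close>, the average runs only over points
      closer than \<open>d\<close> to \<open>K\<close>, where \<open>w\<close> is 0.\<close>
    let ?C = "- (\<Union>k\<in>K. ball k (d - \<delta> n))"
    have "supp (?m n) \<subseteq> ?C"
    proof (rule supp_subsetI)
      fix x assume "x \<notin> ?C"
      then obtain k where k: "k \<in> K" "dist k x < d - \<delta> n" by auto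
      show "?m n x = 0"
      proof (rule ccontr)
        assume "?m n x \<noteq> 0"
        then obtain y where y: "dist x y \<le> \<delta> n" "w y \<noteq> 0"
          using mollify_nonzeroD[OF \<delta>] by blast
        then have "d \<le> dist k y" using w(4) d(2)[OF k(1)] by blast
        with dist_triangle[of k y x] k(2) y(1) show False by linarith
      qed
    qed auto
    moreover have "K \<subseteq> - ?C" using n by auto
    ultimately have "supp (?m n) \<subseteq> - K" by blast
    moreover have "0 \<le> ?m n z" for z
      using mollify_mono[OF \<delta>[of n] continuous_on_const cw w(3), of z] mollify_const[OF \<delta>[of n], of "0::real" z] by simp
    ultimately show ?thesis
      using T(2) test_fun_mollify[OF \<delta> cw w(2)] unfolding nonneg_distribution_on_def ddbar_current_def by blast
  qed
  moreover have "\<forall>\<^sub>F n in sequentially. \<delta> n < d"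
    unfolding \<delta>_def using order_tendstoD(2)[OF LIMSEQ_inverse_real_of_nat d(1)] .
  ultimately have "\<forall>\<^sub>F n in sequentially. - T (ddbar (?m n)) \<in> \<real>\<^sub>\<ge>\<^sub>0"
    by (auto elim: eventually_mono)
  from Lim_in_closed_set[OF closed_nonneg_Reals this _ lim] show ?thesis by simp
qed

lemma nonneg_Reals_sum_nonpos:
  assumes "a \<in> \<real>\<^sub>\<ge>\<^sub>0" "b \<in> \<real>\<^sub>\<ge>\<^sub>0" "- (a + b) \<in> \<real>\<^sub>\<ge>\<^sub>0"
  shows "a = (0::complex)"
  using assms by (auto simp: complex_nonneg_Reals_iff complex_eq_iff)

text \<open>The mass of the positive measure equals the extended \<open>T\<close> on
  \<open>ddbar\<close> of \<open>v\<close> cut off far from the support of \<open>T\<close>, which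
  is nonpositive because \<open>v\<close> vanishes near \<open>K\<close>. Splitting the cutoff
  \<open>h\<close> into the nonnegative functions \<open>\<theta>\<close> and
  \<open>h - \<theta>\<close> forces each part to be 0.\<close>

lemma wedge_ddbar_vanishes:
  fixes T :: "'n::finite current11"
  assumes T: "directed_current \<Gamma> T" "nonneg_distribution_on (- K) (\<lambda>h. - ddbar_current T h)"
    and K: "compact K" and R: "current_supp T \<subseteq> cball 0 R"
    and v: "v \<in> psh_dir \<Gamma>" "\<And>x. 0 \<le> v x"
    and F: "closed F" "K \<inter> F = {}" "\<And>x. x \<notin> F \<Longrightarrow> v x = 0"
    and \<theta>: "test_fun \<theta>" "\<And>x. 0 \<le> \<theta> x" "\<And>x. \<theta> x \<le> 1" "supp \<theta> \<subseteq> cball 0 (R + 1)"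
  shows "wedge_ddbar T v \<theta> = 0"
proof -
  have pT: "positive_current T" using T(1) by (simp add: directed_current_def)
  have v2: "Ck 2 v" using v(1) by (simp add: psh_dir_iff)
  \<comment> \<open>\<open>h\<close> is 1 on an open ball containing the closed ball of radius
    \<open>R + 1\<close>. There \<open>ddbar\<close> of the product is \<open>ddbar v\<close>, so
    the two forms differ only where the extended current does not see them.\<close>
  have "R + 2 < R + 3" by simp
  then obtain h :: "complex^'n \<Rightarrow> real" where h: "test_fun h" "\<And>x. 0 \<le> h x" "\<And>x. h x \<le> 1"
    "\<And>x. x \<in> cball 0 (R + 2) \<Longrightarrow> h x = 1" "supp h \<subseteq> cball 0 (R + 3)"
    using cutoff_exists[of "R + 2" "R + 3" "0::complex^'n"] by blast
  let ?hv = "\<lambda>z. h z * v z"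
  have hv: "Ck 2 ?hv" by (rule Ck_mult[OF test_fun_Ck[OF h(1)] v2])
  have shv: "compact (supp ?hv)"
    using supp_scaleR[of h v] by (intro compact_supp_subset[OF _ compact_supp_test_fun[OF h(1)]]) simp
  have "- current_ext T (ddbar ?hv) \<in> \<real>\<^sub>\<ge>\<^sub>0"
    by (rule ddbar_current_ext_nonpos[OF pT T(2) K F(1,2) hv shv]) (use h(2) v(2) F(3) in auto)
  moreover have "wedge_ddbar T v h = current_ext T (ddbar ?hv)"
  proof -
    let ?\<psi> = "\<lambda>z. h z *\<^sub>R ddbar v z + (- 1) *\<^sub>R ddbar ?hv z"
    have c1: "continuous_on UNIV (ddbar ?hv)" "compact (supp (ddbar ?hv))"
      by (rule continuous_on_ddbar[OF hv], rule compact_supp_subset[OF supp_ddbar[OF hv] shv])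
    have "continuous_on UNIV ?\<psi>"
      by (intro continuous_on_add continuous_on_scaleR continuous_on_const continuous_on_ddbar[OF v2] c1(1)
          Ck_imp_continuous_on[OF test_fun_Ck[OF h(1), of 0]])
    moreover have "compact (supp ?\<psi>)"
    proof (rule compact_supp_subset[OF order_trans[OF supp_add Un_mono[OF supp_scaleR]] compact_Un])
      show "supp (\<lambda>z. (- 1) *\<^sub>R ddbar ?hv z) \<subseteq> supp (ddbar ?hv)"
        by (rule supp_subsetI) (auto simp: closed_supp not_in_supp)
    qed (use c1(2) compact_supp_test_fun[OF h(1)] in auto)
    moreover have "?\<psi> z = 0" if "z \<in> cball 0 (R + 1)" for z
    proof -
      have z: "z \<in> ball 0 (R + 2)" using that by auto
      have "ddbar ?hv z = ddbar v z"
        by (rule ddbar_cong[OF hv v2 open_ball z]) (use h(4) in auto)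
      then show ?thesis using h(4)[of z] z by simp
    qed
    ultimately have "current_ext T (\<lambda>z. ddbar ?hv z + ?\<psi> z) = current_ext T (ddbar ?hv)"
      using current_ext_add[OF pT c1, of ?\<psi>] current_ext_outside_supp[OF pT _ _ R, of ?\<psi>] by simp
    then show ?thesis by (simp add: wedge_ddbar_def)
  qed
  moreover have "wedge_ddbar T v h = wedge_ddbar T v \<theta> + wedge_ddbar T v (\<lambda>z. h z - \<theta> z)"
  proof -
    have *: "continuous_on UNIV (\<lambda>z. g z *\<^sub>R ddbar v z)" "compact (supp (\<lambda>z. g z *\<^sub>R ddbar v z))" if "test_fun g" for g :: "complex^'n \<Rightarrow> real"
      by (intro continuous_on_scaleR continuous_on_ddbar[OF v2] Ck_imp_continuous_on[OF test_fun_Ck[OF that, of 0]],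
          rule compact_supp_subset[OF supp_scaleR compact_supp_test_fun[OF that]])
    show ?thesis
      using current_ext_add[OF pT *[OF \<theta>(1)] *[OF test_fun_diff[OF h(1) \<theta>(1)]]]
      by (simp add: wedge_ddbar_def scaleR_diff_left)
  qed
  moreover have nonneg: "wedge_ddbar T v g \<in> \<real>\<^sub>\<ge>\<^sub>0" if "test_fun g" "\<And>z. 0 \<le> g z" for g
    using T(1) v(1) that unfolding directed_current_def nonneg_distribution_on_def by blast
  moreover have "0 \<le> h z - \<theta> z" for z
    using h(4)[of z] \<theta>(3)[of z] \<theta>(4) h(2)[of z] not_in_supp[of z \<theta>] by (cases "z \<in> supp \<theta>") auto
  ultimately show ?thesis
    using nonneg_Reals_sum_nonpos[OF nonneg[OF \<theta>(1,2)] nonneg[OF test_fun_diff[OF h(1) \<theta>(1)]]] by simp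
qed

lemma current_supp_subset_hull:
  fixes T :: "'n::finite current11"
  assumes T: "directed_current \<Gamma> T" "nonneg_distribution_on (- K) (\<lambda>h. - ddbar_current T h)"
    and K: "compact K" and supp: "compact (current_supp T)"
  shows "current_supp T \<subseteq> hull_dir \<Gamma> K"
proof (rule ccontr)
  assume "\<not> ?thesis"
  then obtain z0 where z0: "z0 \<in> current_supp T" and "z0 \<notin> hull_dir \<Gamma> K" by blast
  then obtain u where u: "u \<in> psh_dir \<Gamma>" and "\<not> ereal (u z0) \<le> (SUP w\<in>K. ereal (u w))"
    unfolding hull_dir_def by blast
  then have "(SUP w\<in>K. ereal (u w)) < ereal (u z0)" by simp
  \<comment> \<open>The comparison happens in \<open>ereal\<close>: for empty \<open>K\<close> the
    supremum is \<open>-\<infinity>\<close> and a real \<open>c1\<close> still exists.\<close>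
  then obtain c1 where c1: "(SUP w\<in>K. ereal (u w)) < ereal c1" "c1 < u z0"
    using ereal_dense2 by (metis less_ereal.simps(1))
  have uK: "u w < c1" if "w \<in> K" for w
    using SUP_upper[OF that, of "\<lambda>w. ereal (u w)"] c1(1) by (metis less_ereal.simps(1) order_le_less_trans)
  have pT: "positive_current T" using T(1) by (simp add: directed_current_def)
  have u2: "Ck 2 u" using u by (simp add: psh_dir_iff)
  obtain M where M: "\<And>w. w \<in> K \<Longrightarrow> norm w \<le> M"
    using compact_imp_bounded[OF K] by (auto simp: bounded_iff)
  obtain R where R: "current_supp T \<subseteq> cball 0 R"
    using compact_imp_bounded[OF supp] by (auto simp: bounded_iff subset_iff)
  define c where "c = (c1 + u z0) / 2"
  \<comment> \<open>On \<open>K\<close> the added term is then at most \<open>c - c1\<close>, the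
    room left between the bound \<open>c1\<close> for \<open>u\<close> and the level
    \<open>c\<close>; the added 1 keeps the denominator positive.\<close>
  define \<epsilon> where "\<epsilon> = (c - c1) / (M\<^sup>2 + 1)"
  have M1: "M\<^sup>2 + 1 > 0" by (simp add: add_nonneg_pos)
  have c: "c1 < c" "c < u z0" using c1(2) by (auto simp: c_def)
  have \<epsilon>: "\<epsilon> > 0" using M1 c by (simp add: \<epsilon>_def)
  define U where "U x = u x + \<epsilon> * (x \<bullet> x)" for x
  have U2: "Ck 2 U"
    unfolding U_def by (intro Ck_add u2 Ck_mult Ck_const Ck_inner_self)
  have leviU: "levi U z \<xi> = levi u z \<xi> + \<epsilon> * (\<xi> \<bullet> \<xi>)" for z \<xi>
    unfolding U_def
    by (simp add: levi_add[OF u2] Ck_mult Ck_inner_self levi_scale[OF Ck_inner_self] levi_inner_self)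
  have UK: "U w < c" if "w \<in> K" for w
  proof -
    have "w \<bullet> w \<le> M\<^sup>2"
      using M[OF that] by (simp add: dot_square_norm power_mono)
    then have "\<epsilon> * (w \<bullet> w) \<le> \<epsilon> * (M\<^sup>2 + 1)"
      using \<epsilon> by (intro mult_left_mono) auto
    also have "\<dots> = c - c1" using M1 by (simp add: \<epsilon>_def)
    finally show ?thesis using uK[OF that] by (simp add: U_def)
  qed
  have Uz0: "c < U z0"
    using c(2) \<epsilon> add_less_le_mono[of c "u z0" 0 "\<epsilon> * (z0 \<bullet> z0)"] by (simp add: U_def)
  define v where "v x = (max 0 (U x - c)) ^ 3" for x
  have v2: "Ck 2 v"
    unfolding v_def by (rule Ck_compose_real[OF Ck_cube_pos_part U2])
  have leviv: "levi v z \<xi> \<ge> 3 * (max 0 (U z - c))\<^sup>2 * (\<epsilon> * (\<xi> \<bullet> \<xi>))" if "\<xi> \<in> \<Gamma> z" for z \<xi>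
  proof -
    have "3 * (max 0 (U z - c))\<^sup>2 * levi U z \<xi> \<le> levi v z \<xi>"
      unfolding v_def by (rule levi_compose_ge[OF U2 DERIV_cube_pos_part]) simp
    moreover have "\<epsilon> * (\<xi> \<bullet> \<xi>) \<le> levi U z \<xi>"
      using u that unfolding leviU psh_dir_iff by simp
    ultimately show ?thesis
      by (meson mult_left_mono order_trans zero_le_mult_iff zero_le_numeral zero_le_power2)
  qed
  have vpsh: "v \<in> psh_dir \<Gamma>"
    unfolding psh_dir_iff
  proof (intro conjI v2 allI ballI)
    fix z \<xi> assume "\<xi> \<in> \<Gamma> z"
    have "0 \<le> 3 * (max 0 (U z - c))\<^sup>2 * (\<epsilon> * (\<xi> \<bullet> \<xi>))" using \<epsilon> by simp
    with leviv[OF \<open>\<xi> \<in> \<Gamma> z\<close>] show "0 \<le> levi v z \<xi>" by linarith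
  qed
  have vanish: "wedge_ddbar T v \<theta> = 0" if "test_fun \<theta>" "\<And>x. 0 \<le> \<theta> x" "\<And>x. \<theta> x \<le> 1" "supp \<theta> \<subseteq> cball 0 (R + 1)" for \<theta>
  proof (rule wedge_ddbar_vanishes[OF T K R vpsh _ _ _ _ that])
    show "closed {x. c \<le> U x}"
      by (intro closed_Collect_le continuous_on_const Ck_imp_continuous_on[OF U2])
    show "K \<inter> {x. c \<le> U x} = {}" using UK by (auto simp: not_le[symmetric])
  qed (auto simp: v_def)
  \<comment> \<open>Half the excess of \<open>U\<close> over \<open>c\<close> at \<open>z0\<close>:
    near \<open>z0\<close> the Levi form of \<open>v\<close> along \<open>\<Gamma>\<close> is then
    at least \<open>3 * \<kappa>\<^sup>2 * \<epsilon>\<close> times the squared length of the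
    vector.\<close>
  define \<kappa> where "\<kappa> = (U z0 - c) / 2"
  have \<kappa>: "\<kappa> > 0" using Uz0 by (simp add: \<kappa>_def)
  have "open {x. c + \<kappa> < U x}"
    by (intro open_Collect_less continuous_on_const Ck_imp_continuous_on[OF U2])
  moreover have "z0 \<in> {x. c + \<kappa> < U x}"
    using Uz0 by (simp add: \<kappa>_def field_simps)
  ultimately obtain \<rho> where \<rho>: "\<rho> > 0" "ball z0 \<rho> \<subseteq> {x. c + \<kappa> < U x}"
    using open_contains_ball by metis
  \<comment> \<open>\<open>r \<le> 1\<close> keeps the support of \<open>\<theta>\<close> inside
    \<open>cball 0 (R + 1)\<close>; \<open>r < \<rho>\<close> keeps the support of \<open>G\<close>
    where the lower bound for the Levi form of \<open>v\<close> holds.\<close>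
  define r where "r = min 1 (\<rho> / 2)"
  have r: "r > 0" "r \<le> 1" "r < \<rho>" using \<rho> by (auto simp: r_def)
  have "r / 2 < r" using r by simp
  then obtain \<eta> :: "complex^'n \<Rightarrow> real" where \<eta>: "test_fun \<eta>" "\<And>x. 0 \<le> \<eta> x" "\<And>x. \<eta> x \<le> 1"
    "\<And>x. x \<in> cball z0 (r / 2) \<Longrightarrow> \<eta> x = 1" "supp \<eta> \<subseteq> cball z0 r"
    using cutoff_exists[of "r / 2" r z0] by blast
  \<comment> \<open>Nested cutoffs: \<open>\<theta>\<close> lives well inside the ball where
    \<open>\<eta>\<close> is 1, so near its support \<open>G\<close> is the squared norm and
    contributes exactly the identity matrix.\<close>
  have "r / 8 < r / 4" using r by simp
  then obtain \<theta> :: "complex^'n \<Rightarrow> real" where \<theta>: "test_fun \<theta>" "\<And>x. 0 \<le> \<theta> x" "\<And>x. \<theta> x \<le> 1"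
    "\<And>x. x \<in> cball z0 (r / 8) \<Longrightarrow> \<theta> x = 1" "supp \<theta> \<subseteq> cball z0 (r / 4)"
    using cutoff_exists[of "r / 8" "r / 4" z0] by blast
  define G where "G x = \<eta> x * (x \<bullet> x)" for x
  have G2: "Ck 2 G"
    unfolding G_def by (intro Ck_mult test_fun_Ck[OF \<eta>(1)] Ck_inner_self)
  have sG: "supp G \<subseteq> cball z0 r"
    using supp_scaleR[of \<eta> "\<lambda>x. x \<bullet> x"] \<eta>(5) by (simp add: G_def[abs_def])
  obtain B where B: "B \<ge> 0" "\<And>z \<xi>. \<bar>levi G z \<xi>\<bar> \<le> B * (\<xi> \<bullet> \<xi>)"
    using levi_bounded[OF G2 compact_supp_subset[OF sG compact_cball]] by blast
  \<comment> \<open>Small enough that on the support of \<open>G\<close> the Levi form of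
    \<open>d * G\<close> stays below the lower bound for that of \<open>v\<close>; off this support
    nothing is subtracted. The added 1 covers \<open>B = 0\<close>.\<close>
  define d where "d = 3 * \<kappa>\<^sup>2 * \<epsilon> / (B + 1)"
  have d: "d > 0" "d * B \<le> 3 * \<kappa>\<^sup>2 * \<epsilon>"
    using \<kappa> \<epsilon> B(1) by (auto simp: d_def field_simps)
  have dG2: "Ck 2 (\<lambda>x. (- d) * G x)" by (intro Ck_mult Ck_const G2)
  define V where "V x = v x + (- d) * G x" for x
  have Vpsh: "V \<in> psh_dir \<Gamma>"
    unfolding psh_dir_iff
  proof (intro conjI allI ballI)
    show "Ck 2 V" unfolding V_def by (rule Ck_add[OF v2 dG2])
    fix z \<xi> assume \<xi>: "\<xi> \<in> \<Gamma> z"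
    have eq: "levi V z \<xi> = levi v z \<xi> - d * levi G z \<xi>"
      unfolding V_def levi_add[OF v2 dG2] levi_scale[OF G2] by simp
    show "0 \<le> levi V z \<xi>"
    proof (cases "z \<in> supp G")
      case False
      then have "levi G z \<xi> = 0"
        using pair11_ddbar[OF G2, of z \<xi>] ddbar_outside_supp[OF G2 False] by (simp add: pair11_def)
      then show ?thesis using vpsh \<xi> unfolding eq psh_dir_iff by simp
    next
      case True
      then have "z \<in> ball z0 \<rho>" using sG r(3) by auto
      then have "\<kappa> \<le> max 0 (U z - c)" using \<rho>(2) by auto
      then have "\<kappa>\<^sup>2 \<le> (max 0 (U z - c))\<^sup>2" using \<kappa> by (intro power_mono) auto
      then have "3 * \<kappa>\<^sup>2 * (\<epsilon> * (\<xi> \<bullet> \<xi>)) \<le> 3 * (max 0 (U z - c))\<^sup>2 * (\<epsilon> * (\<xi> \<bullet> \<xi>))"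
        using \<epsilon> by (intro mult_right_mono) auto
      moreover have "d * levi G z \<xi> \<le> d * (B * (\<xi> \<bullet> \<xi>))"
        using d(1) B(2)[of z \<xi>] by (intro mult_left_mono) auto
      moreover have "d * B * (\<xi> \<bullet> \<xi>) \<le> 3 * \<kappa>\<^sup>2 * \<epsilon> * (\<xi> \<bullet> \<xi>)"
        by (rule mult_right_mono[OF d(2)]) simp
      ultimately show ?thesis
        using leviv[OF \<xi>] unfolding eq by (simp add: mult.assoc)
    qed
  qed
  let ?I = "\<lambda>z. \<theta> z *\<^sub>R mat 1 :: complex^'n^'n"
  have I: "test_fun ?I" by (rule test_fun_scaleR[OF \<theta>(1) Ck_const])
  have dI: "test_fun (\<lambda>z. (- d) *\<^sub>R ?I z)"
    by (rule test_fun_linear[OF bounded_linear_scaleR_right I])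
  have \<theta>V: "\<theta> z *\<^sub>R ddbar V z = \<theta> z *\<^sub>R ddbar v z + (- d) *\<^sub>R ?I z" for z
  proof (cases "z \<in> supp \<theta>")
    case True
    then have z: "z \<in> ball z0 (r / 2)" using \<theta>(5) r by auto
    have "ddbar G z = ddbar (\<lambda>z. z \<bullet> z) z"
      by (rule ddbar_cong[OF G2 Ck_inner_self open_ball z]) (use \<eta>(4) in \<open>auto simp: G_def\<close>)
    then show ?thesis
      unfolding V_def ddbar_add[OF v2 dG2] ddbar_scale[OF G2] by (simp add: ddbar_inner_self algebra_simps)
  qed (simp add: not_in_supp)
  have z0R: "norm z0 \<le> R" using z0 R by auto
  have "supp \<theta> \<subseteq> cball 0 (R + 1)"
  proof
    fix x assume "x \<in> supp \<theta>"
    then have "dist z0 x \<le> 1" using \<theta>(5) r by auto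
    then show "x \<in> cball 0 (R + 1)"
      using z0R dist_triangle[of 0 x z0] by simp
  qed
  note v\<theta> = vanish[OF \<theta>(1-3) this, unfolded wedge_ddbar_def]
  have "current_ext T (\<lambda>z. \<theta> z *\<^sub>R ddbar v z + (- d) *\<^sub>R ?I z) =
      current_ext T (\<lambda>z. \<theta> z *\<^sub>R ddbar v z) + current_ext T (\<lambda>z. (- d) *\<^sub>R ?I z)"
    by (rule current_ext_add[OF pT])
      (intro continuous_on_scaleR continuous_on_ddbar[OF v2] Ck_imp_continuous_on[OF test_fun_Ck[OF \<theta>(1), of 0]]
        compact_supp_subset[OF supp_scaleR compact_supp_test_fun[OF \<theta>(1)]]
        Ck_imp_continuous_on[OF test_fun_Ck[OF dI, of 0]] compact_supp_test_fun[OF dI])+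
  \<comment> \<open>The part coming from \<open>v\<close> is 0, so positivity of the wedge with
    \<open>V\<close> makes \<open>- d\<close> times the trace mass of \<open>\<theta>\<close>
    nonnegative, while the trace mass itself is nonnegative.\<close>
  then have "wedge_ddbar T V \<theta> = - d *\<^sub>R T ?I"
    unfolding wedge_ddbar_def \<theta>V v\<theta> current_ext_test_fun[OF pT dI]
      current_scaleR[OF positive_current_imp_current[OF pT] I] by simp
  moreover have "wedge_ddbar T V \<theta> \<in> \<real>\<^sub>\<ge>\<^sub>0"
    using T(1) Vpsh \<theta>(1,2) unfolding directed_current_def nonneg_distribution_on_def by blast
  moreover have "T ?I \<in> \<real>\<^sub>\<ge>\<^sub>0"
    by (rule positive_current_nonneg[OF pT I positive_form_trace[OF \<theta>(2)]])
  ultimately have TI: "Re (T ?I) = 0"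
    using d(1) by (auto simp: complex_nonneg_Reals_iff mult_le_0_iff)
  have "T \<phi> = 0" if \<phi>: "test_fun \<phi>" "supp \<phi> \<subseteq> ball z0 (r / 8)" for \<phi>
  proof -
    obtain A where A: "A \<ge> 0" "\<And>x. norm (\<phi> x) \<le> A"
      using continuous_compact_supp_bounded[OF Ck_imp_continuous_on[OF test_fun_Ck[OF \<phi>(1), of 0]] compact_supp_test_fun[OF \<phi>(1)]]
      by blast
    \<comment> \<open>Once \<open>\<phi>\<close> is dominated by a multiple of
      \<open>\<theta>\<close>, the zero trace mass of \<open>\<theta>\<close> forces
      \<open>T \<phi> = 0\<close>.\<close>
    have "norm (\<phi> z) \<le> A * \<theta> z" for z
    proof (cases "z \<in> supp \<phi>")
      case True
      then have "\<theta> z = 1" using \<phi>(2) by (intro \<theta>(4)) auto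
      then show ?thesis using A(2) by simp
    qed (use A(1) \<theta>(2) in \<open>simp add: not_in_supp\<close>)
    from current_bound[OF pT \<theta>(1,2) \<phi>(1) this] TI show ?thesis by simp
  qed
  then have "ball z0 (r / 8) \<in> {U. open U \<and> (\<forall>\<phi>. test_fun \<phi> \<longrightarrow> supp \<phi> \<subseteq> U \<longrightarrow> T \<phi> = 0)}"
    by simp
  moreover have "z0 \<in> ball z0 (r / 8)" using r by simp
  ultimately show False
    using z0 unfolding current_supp_def by blast
qed

section \<open>Currents through points of the hull\<close>

text \<open>Compact support of \<open>u\<close> bounds its Levi form everywhere, so a single
  multiple of \<open>g\<close> suffices on the unbounded region outside the ball of radius
  \<open>R\<close>.\<close>

lemma hull_test_function:
  fixes K :: "(complex^'n::finite) set"
  assumes z0: "z0 \<in> hull_dir \<Gamma> K" "norm z0 \<le> R0" and K: "\<And>w. w \<in> K \<Longrightarrow> norm w \<le> R0" and R: "0 \<le> R0" "R0 < R"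
    and u: "test_fun u" "\<And>z \<xi>. norm z \<le> R \<Longrightarrow> \<xi> \<in> \<Gamma> z \<Longrightarrow> 0 \<le> levi u z \<xi>" and c: "\<And>w. w \<in> K \<Longrightarrow> u w \<le> c"
  shows "u z0 \<le> c"
proof -
  have u2: "Ck 2 u" by (rule test_fun_Ck[OF u(1)])
  obtain B where B: "B \<ge> 0" "\<And>z \<xi>. \<bar>levi u z \<xi>\<bar> \<le> B * (\<xi> \<bullet> \<xi>)"
    using levi_bounded[OF u2 compact_supp_test_fun[OF u(1)]] by blast
  have R2: "R0\<^sup>2 < R\<^sup>2" using R by (intro power_strict_mono) auto
  \<comment> \<open>The minimum over \<open>norm z \<ge> R\<close> of the factor in the lower bound
    for the Levi form of \<open>g\<close>, attained on the sphere; \<open>B / D\<close> copies of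
    \<open>g\<close> therefore outweigh \<open>B\<close>.\<close>
  define D where "D = 3 * (R\<^sup>2 - R0\<^sup>2)\<^sup>2"
  have D: "D > 0" using R2 by (simp add: D_def)
  define g where "g x = (max 0 (x \<bullet> x - R0\<^sup>2)) ^ 3" for x :: "complex^'n"
  have g2: "Ck 2 g" unfolding g_def by (rule Ck_compose_real[OF Ck_cube_pos_part Ck_inner_self])
  have Ag2: "Ck 2 (\<lambda>x. (B / D) * g x)" by (rule Ck_mult[OF Ck_const g2])
  have levig: "3 * (max 0 (z \<bullet> z - R0\<^sup>2))\<^sup>2 * (\<xi> \<bullet> \<xi>) \<le> levi g z \<xi>" for z \<xi>
    using levi_compose_ge[OF Ck_inner_self DERIV_cube_pos_part, of z "R0\<^sup>2" \<xi>]
    unfolding g_def[abs_def] by (simp add: levi_inner_self)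
  define v where "v x = u x + (B / D) * g x" for x
  have leviv: "levi v z \<xi> = levi u z \<xi> + (B / D) * levi g z \<xi>" for z \<xi>
    unfolding v_def levi_add[OF u2 Ag2] levi_scale[OF g2] ..
  have "v \<in> psh_dir \<Gamma>"
    unfolding psh_dir_iff
  proof (intro conjI allI ballI)
    show "Ck 2 v" unfolding v_def by (rule Ck_add[OF u2 Ag2])
    fix z \<xi> assume \<xi>: "\<xi> \<in> \<Gamma> z"
    show "0 \<le> levi v z \<xi>"
    proof (cases "norm z \<le> R")
      case True
      have "0 \<le> levi g z \<xi>" by (rule order_trans[OF _ levig]) simp
      then show ?thesis
        using u(2)[OF True \<xi>] B(1) D unfolding leviv by simp
    next
      case False
      then have "R\<^sup>2 \<le> z \<bullet> z"
        using R by (simp add: dot_square_norm power_mono)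
      then have "(R\<^sup>2 - R0\<^sup>2)\<^sup>2 \<le> (max 0 (z \<bullet> z - R0\<^sup>2))\<^sup>2"
        using R2 by (intro power_mono) auto
      then have "D * (\<xi> \<bullet> \<xi>) \<le> 3 * (max 0 (z \<bullet> z - R0\<^sup>2))\<^sup>2 * (\<xi> \<bullet> \<xi>)"
        unfolding D_def by (intro mult_right_mono) auto
      then have "D * (\<xi> \<bullet> \<xi>) \<le> levi g z \<xi>" using levig order_trans by blast
      then have "(B / D) * (D * (\<xi> \<bullet> \<xi>)) \<le> (B / D) * levi g z \<xi>"
        using B(1) D by (intro mult_left_mono) auto
      then have "B * (\<xi> \<bullet> \<xi>) \<le> (B / D) * levi g z \<xi>" using D by simp
      then show ?thesis using B(2)[of z \<xi>] unfolding leviv by linarith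
    qed
  qed
  then have "ereal (v z0) \<le> (SUP w\<in>K. ereal (v w))"
    using z0(1) by (simp add: hull_dir_def)
  also have "\<dots> \<le> ereal c"
  proof (rule SUP_least)
    fix w assume w: "w \<in> K"
    have "w \<bullet> w \<le> R0\<^sup>2" using K[OF w] by (simp add: dot_square_norm power_mono)
    then show "ereal (v w) \<le> ereal c" using c[OF w] by (simp add: v_def g_def)
  qed
  finally have "v z0 \<le> c" by simp
  moreover have "z0 \<bullet> z0 \<le> R0\<^sup>2" using z0(2) by (simp add: dot_square_norm power_mono)
  ultimately show ?thesis by (simp add: v_def g_def)
qed

text \<open>The squared norm itself belongs to \<open>psh_dir \<Gamma>\<close>, since its Levi form
  is nonnegative in every direction.\<close>

lemma hull_dir_bounded:
  assumes "\<And>w. w \<in> K \<Longrightarrow> norm w \<le> R0" "0 \<le> R0" "z0 \<in> hull_dir \<Gamma> K"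
  shows "norm z0 \<le> R0"
proof -
  have "(\<lambda>z. z \<bullet> z) \<in> psh_dir \<Gamma>"
    by (simp add: psh_dir_iff Ck_inner_self levi_inner_self)
  moreover have "\<forall>u\<in>psh_dir \<Gamma>. ereal (u z0) \<le> (SUP w\<in>K. ereal (u w))"
    using assms(3) by (simp add: hull_dir_def)
  ultimately have "ereal (z0 \<bullet> z0) \<le> (SUP w\<in>K. ereal (w \<bullet> w))"
    by (rule bspec[rotated])
  also have "\<dots> \<le> ereal (R0\<^sup>2)"
  proof (rule SUP_least)
    fix w assume "w \<in> K"
    from power_mono[OF assms(1)[OF this] norm_ge_zero, of 2]
    show "ereal (w \<bullet> w) \<le> ereal (R0\<^sup>2)" by (simp add: dot_square_norm)
  qed
  finally have "(norm z0)\<^sup>2 \<le> R0\<^sup>2" by (simp add: dot_square_norm)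
  then show ?thesis using assms(2) by (rule power2_le_imp_le)
qed

lemma test_fun_zero: "test_fun (\<lambda>_. 0)"
  by (simp add: test_fun_def supp_def)

lemma test_fun_scale: "test_fun u \<Longrightarrow> test_fun (\<lambda>x. c * u x :: real)"
  by (rule test_fun_linear[OF bounded_linear_mult_right])

text \<open>One-sided inequalities are enough, since linearity turns them round. The radius
  \<open>R\<close> will bound the support of the current; the last property yields both the sign off
  \<open>K\<close> and the presence of \<open>z0\<close> in the support.\<close>

lemma ex_hull_functional:
  fixes K :: "(complex^'n::finite) set"
  assumes z0: "z0 \<in> hull_dir \<Gamma> K" and K: "compact K"
  obtains \<Lambda> :: "((complex^'n) \<Rightarrow>\<^sub>C (complex^'n^'n)) \<Rightarrow> real" and E R
  where "linear \<Lambda>" "\<And>\<Phi>. \<Lambda> \<Phi> \<le> E * norm \<Phi>" "0 \<le> E"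
    "\<And>\<Phi>. (\<And>z \<xi>. norm z \<le> R \<Longrightarrow> \<xi> \<in> \<Gamma> z \<Longrightarrow> Re (pair11 (apply_bcontfun \<Phi> z) \<xi>) \<le> 0) \<Longrightarrow> \<Lambda> \<Phi> \<le> 0"
    "\<And>\<Phi> u c. test_fun u \<Longrightarrow> apply_bcontfun \<Phi> = ddbar u \<Longrightarrow> (\<And>w. w \<in> K \<Longrightarrow> u w \<le> c) \<Longrightarrow> \<Lambda> \<Phi> \<le> c - u z0"
proof -
  obtain R1 where R1: "\<And>w. w \<in> K \<Longrightarrow> norm w \<le> R1"
    using compact_imp_bounded[OF K] by (auto simp: bounded_iff)
  define R0 where "R0 = max 0 R1"
  have R0: "\<And>w. w \<in> K \<Longrightarrow> norm w \<le> R0" "0 \<le> R0" using R1 by (auto simp: R0_def le_max_iff_disj)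
  have z0R: "norm z0 \<le> R0" by (rule hull_dir_bounded[OF R0 z0])
  define R where "R = R0 + 1"
  have R: "R0 < R" by (simp add: R_def)
  note key = hull_test_function[OF z0 z0R R0(1) R0(2) R]
  have "R + 1 < R + 2" by simp
  then obtain \<eta> :: "complex^'n \<Rightarrow> real" where \<eta>: "test_fun \<eta>" "\<And>x. 0 \<le> \<eta> x" "\<And>x. \<eta> x \<le> 1"
    "\<And>x. x \<in> cball 0 (R + 1) \<Longrightarrow> \<eta> x = 1" "supp \<eta> \<subseteq> cball 0 (R + 2)"
    using cutoff_exists[of "R + 1" "R + 2" "0 :: complex^'n"] by blast
  \<comment> \<open>Equal to the squared norm on a neighbourhood of the ball of radius
    \<open>R\<close>, so its Levi form there is \<open>\<xi> \<bullet> \<xi>\<close> and the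
    multiple \<open>N * norm \<Phi>\<close> dominates any \<open>\<Phi>\<close>.\<close>
  define w where "w x = \<eta> x * (x \<bullet> x)" for x
  have w: "test_fun w"
    using test_fun_scaleR[OF \<eta>(1) Ck_inner_self] by (simp add: w_def[abs_def])
  have w2: "Ck 2 w" by (rule test_fun_Ck[OF w])
  have leviw: "levi w z \<xi> = \<xi> \<bullet> \<xi>" if "norm z \<le> R" for z \<xi>
  proof -
    have "levi w z \<xi> = levi (\<lambda>x. x \<bullet> x) z \<xi>"
      by (rule levi_cong[OF w2, of "ball 0 (R + 1)"]) (use that \<eta>(4) in \<open>auto simp: w_def\<close>)
    then show ?thesis by (simp add: levi_inner_self)
  qed
  obtain W where W: "W \<ge> 0" "\<And>x. norm (w x) \<le> W"
    using continuous_compact_supp_bounded[OF Ck_imp_continuous_on[OF w2] compact_supp_test_fun[OF w]] by blast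
  define N where "N = real CARD('n) ^ 2"
  have N: "N \<ge> 0" by (simp add: N_def)
  \<comment> \<open>The dominating multiple of \<open>w\<close>, with its bound
    \<open>N * norm \<Phi> * W\<close>, has the value \<open>E * norm \<Phi>\<close>.\<close>
  define E where "E = N * (W - w z0)"
  have E: "E \<ge> 0" using N W(2)[of z0] by (simp add: E_def abs_le_iff)
  have pb: "\<bar>Re (pair11 (apply_bcontfun \<Phi> z) \<xi>)\<bar> \<le> N * norm \<Phi> * (\<xi> \<bullet> \<xi>)" for \<Phi> :: "(complex^'n) \<Rightarrow>\<^sub>C (complex^'n^'n)" and z \<xi>
  proof -
    have "\<bar>Re (pair11 (apply_bcontfun \<Phi> z) \<xi>)\<bar> \<le> N * norm (apply_bcontfun \<Phi> z) * (\<xi> \<bullet> \<xi>)"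
      unfolding N_def by (rule order_trans[OF abs_Re_le_cmod norm_pair11_le])
    also have "\<dots> \<le> N * norm \<Phi> * (\<xi> \<bullet> \<xi>)"
      by (intro mult_right_mono mult_left_mono norm_bounded N) simp
    finally show ?thesis .
  qed
  \<comment> \<open>Here \<open>c\<close> is any upper bound of \<open>u\<close> on \<open>K\<close>
    in place of the maximum, so an empty \<open>K\<close> needs no separate case.\<close>
  define adm where "adm \<Phi> u c \<longleftrightarrow> test_fun u \<and> (\<forall>x\<in>K. u x \<le> c) \<and>
    (\<forall>z \<xi>. norm z \<le> R \<longrightarrow> \<xi> \<in> \<Gamma> z \<longrightarrow> Re (pair11 (apply_bcontfun \<Phi> z) \<xi>) \<le> levi u z \<xi>)"
    for \<Phi> :: "(complex^'n) \<Rightarrow>\<^sub>C (complex^'n^'n)" and u c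
  define A where "A \<Phi> = {c - u z0 | u c. adm \<Phi> u c}" for \<Phi>
  have wadm: "adm \<Phi> (\<lambda>x. (N * norm \<Phi>) * w x) (N * norm \<Phi> * W)" for \<Phi>
    unfolding adm_def
  proof (intro conjI ballI allI impI)
    show "test_fun (\<lambda>x. (N * norm \<Phi>) * w x)" by (rule test_fun_scale[OF w])
    show "N * norm \<Phi> * w x \<le> N * norm \<Phi> * W" for x
      using W(2)[of x] N by (intro mult_left_mono) auto
    show "Re (pair11 (apply_bcontfun \<Phi> z) \<xi>) \<le> levi (\<lambda>x. N * norm \<Phi> * w x) z \<xi>" if "norm z \<le> R" for z \<xi>
      unfolding levi_scale[OF w2] leviw[OF that] using pb[of \<Phi> z \<xi>] by linarith
  qed
  have adm_add: "adm (\<Phi> + \<Psi>) (\<lambda>x. u x + v x) (c + d)" if "adm \<Phi> u c" "adm \<Psi> v d" for \<Phi> \<Psi> u v c d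
  proof -
    have "levi (\<lambda>x. u x + v x) z \<xi> = levi u z \<xi> + levi v z \<xi>" for z \<xi>
      using that by (intro levi_add test_fun_Ck) (auto simp: adm_def)
    then show ?thesis
      using that unfolding adm_def by (simp add: test_fun_add pair11_add add_mono)
  qed
  have adm_scale: "adm (r *\<^sub>R \<Phi>) (\<lambda>x. r * u x) (r * c)" if "adm \<Phi> u c" "r > 0" for \<Phi> u c r
  proof -
    have "levi (\<lambda>x. r * u x) z \<xi> = r * levi u z \<xi>" for z \<xi>
      using that by (intro levi_scale test_fun_Ck) (auto simp: adm_def)
    then show ?thesis
      using that unfolding adm_def by (simp add: test_fun_scale pair11_scaleR)
  qed
  have ne: "A \<Phi> \<noteq> {}" for \<Phi> using wadm by (auto simp: A_def)
  \<comment> \<open>Adding the dominating function for \<open>- \<Phi>\<close> to one for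
    \<open>\<Phi>\<close> gives a function with nonnegative Levi form along \<open>\<Gamma>\<close>
    over the ball, whose value at \<open>z0\<close> the hull controls.\<close>
  have lower: "- (E * norm \<Phi>) \<le> c - u z0" if "adm \<Phi> u c" for \<Phi> u c
  proof -
    have 1: "adm (\<Phi> + - \<Phi>) (\<lambda>x. u x + (N * norm (- \<Phi>)) * w x) (c + N * norm (- \<Phi>) * W)"
      by (rule adm_add[OF that wadm])
    have "u z0 + (N * norm (- \<Phi>)) * w z0 \<le> c + N * norm (- \<Phi>) * W"
      by (rule key) (use 1 in \<open>auto simp: adm_def pair11_def\<close>)
    then show ?thesis by (simp add: E_def algebra_simps)
  qed
  have bdd: "bdd_below (A \<Phi>)" for \<Phi>
    by (rule bdd_belowI[of _ "- (E * norm \<Phi>)"]) (use lower in \<open>auto simp: A_def\<close>)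
  have below: "Inf (A \<Phi>) \<le> c - u z0" if "adm \<Phi> u c" for \<Phi> u c
    by (rule cInf_lower[OF _ bdd]) (use that in \<open>auto simp: A_def\<close>)
  have levi_0: "levi (\<lambda>_. 0) z \<xi> = 0" for z \<xi> :: "complex^'n"
    using levi_scale[OF Ck_const, of 0 0 z \<xi>] by simp
  have zero: "adm \<Phi> (\<lambda>_. 0) 0" if "\<And>z \<xi>. norm z \<le> R \<Longrightarrow> \<xi> \<in> \<Gamma> z \<Longrightarrow> Re (pair11 (apply_bcontfun \<Phi> z) \<xi>) \<le> 0" for \<Phi>
    using that by (simp add: adm_def test_fun_zero levi_0)
  have "sublinear (\<lambda>\<Phi>. Inf (A \<Phi>))"
  proof (rule sublinearI)
    fix \<Phi> \<Psi>
    show "Inf (A (\<Phi> + \<Psi>)) \<le> Inf (A \<Phi>) + Inf (A \<Psi>)"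
    proof (rule le_Inf_add[OF ne ne])
      fix a b assume "a \<in> A \<Phi>" "b \<in> A \<Psi>"
      then obtain u c v d where "adm \<Phi> u c" "a = c - u z0" "adm \<Psi> v d" "b = d - v z0" by (auto simp: A_def)
      then show "Inf (A (\<Phi> + \<Psi>)) \<le> a + b"
        using below[OF adm_add[of \<Phi> u c \<Psi> v d]] by simp
    qed
  next
    fix r :: real and \<Phi> assume r: "r > 0"
    show "Inf (A (r *\<^sub>R \<Phi>)) \<le> r * Inf (A \<Phi>)"
    proof (rule le_Inf_scale[OF ne r])
      fix a assume "a \<in> A \<Phi>"
      then obtain u c where "adm \<Phi> u c" "a = c - u z0" by (auto simp: A_def)
      then show "Inf (A (r *\<^sub>R \<Phi>)) \<le> r * a"
        using below[OF adm_scale[of \<Phi> u c r]] r by (simp add: right_diff_distrib)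
    qed
  next
    have "Inf (A 0) \<le> 0"
      using below[OF zero, of 0] by (simp add: pair11_def)
    moreover have "0 \<le> Inf (A 0)"
      by (rule cInf_greatest[OF ne]) (use lower[of 0] in \<open>auto simp: A_def\<close>)
    ultimately show "Inf (A 0) = 0" by simp
  qed
  then obtain \<Lambda> where \<Lambda>: "linear \<Lambda>" "\<And>\<Phi>. \<Lambda> \<Phi> \<le> Inf (A \<Phi>)"
    using ex_linear_le_sublinear by blast
  show ?thesis
  proof (rule that[OF \<Lambda>(1) _ E])
    fix \<Phi> :: "(complex^'n) \<Rightarrow>\<^sub>C (complex^'n^'n)"
    show "\<Lambda> \<Phi> \<le> E * norm \<Phi>"
      using \<Lambda>(2)[of \<Phi>] below[OF wadm, of \<Phi>] by (simp add: E_def algebra_simps)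
    show "\<Lambda> \<Phi> \<le> 0" if "\<And>z \<xi>. norm z \<le> R \<Longrightarrow> \<xi> \<in> \<Gamma> z \<Longrightarrow> Re (pair11 (apply_bcontfun \<Phi> z) \<xi>) \<le> 0"
      using \<Lambda>(2)[of \<Phi>] below[OF zero[of \<Phi>]] that by force
    fix u c assume u: "test_fun u" "apply_bcontfun \<Phi> = ddbar u" "\<And>w. w \<in> K \<Longrightarrow> u w \<le> c"
    have "adm \<Phi> u c"
      using u by (simp add: adm_def pair11_ddbar[OF test_fun_Ck[OF u(1)]])
    then show "\<Lambda> \<Phi> \<le> c - u z0"
      using \<Lambda>(2)[of \<Phi>] below by force
  qed
qed

section \<open>From a real functional to a complex current\<close>

lemma bcontfun_compact_supp:
  fixes \<phi> :: "'a::real_normed_vector \<Rightarrow> 'b::real_normed_vector"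
  assumes "continuous_on UNIV \<phi>" "compact (supp \<phi>)"
  shows "\<phi> \<in> bcontfun"
proof -
  obtain M where "\<And>x. norm (\<phi> x) \<le> M"
    using continuous_compact_supp_bounded[OF assms] by blast
  then show ?thesis by (rule bcontfun_normI[OF assms(1)])
qed

lemma bcontfun_test_fun: "test_fun \<phi> \<Longrightarrow> \<phi> \<in> bcontfun"
  by (rule bcontfun_compact_supp[OF Ck_imp_continuous_on[OF test_fun_Ck] compact_supp_test_fun])

lemma norm_cmul_ii: "norm (cmul \<i> M) = norm M"
  by (simp add: norm_vec_def cmul_def norm_mult)

lemma cmul_add: "cmul c (M + N) = cmul c M + cmul c N"
  by (simp add: cmul_def vec_eq_iff algebra_simps)

text \<open>For real-linear \<open>\<Lambda>\<close>, the unique complex-linear functional with real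
  part \<open>\<Lambda>\<close>.\<close>

definition complexify :: "(((complex^'n::finite) \<Rightarrow>\<^sub>C (complex^'n^'n)) \<Rightarrow> real) \<Rightarrow> 'n current11" where
  "complexify \<Lambda> \<phi> = Complex (\<Lambda> (Bcontfun \<phi>)) (- \<Lambda> (Bcontfun (\<lambda>z. cmul \<i> (\<phi> z))))"

context
  fixes \<Lambda> :: "((complex^'n::finite) \<Rightarrow>\<^sub>C (complex^'n^'n)) \<Rightarrow> real"
  assumes lin: "linear \<Lambda>"
begin

private lemma apply_Bcontfun: "\<phi> \<in> bcontfun \<Longrightarrow> apply_bcontfun (Bcontfun \<phi>) = \<phi>"
  by (rule Bcontfun_inverse)

private lemma bcontfun_linear:
  assumes "bounded_linear L" "\<phi> \<in> bcontfun"
  shows "(\<lambda>z. L (\<phi> z)) \<in> bcontfun"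
proof -
  have \<phi>: "continuous_on UNIV \<phi>" "bounded (range \<phi>)" using assms(2) by (auto simp: bcontfun_def)
  have "(\<lambda>z. L (\<phi> z)) ` UNIV = L ` range \<phi>" by auto
  then show ?thesis
    using bounded_linear.continuous_on[OF assms(1) \<phi>(1)] bounded_linear_image[OF \<phi>(2) assms(1)]
    by (simp add: bcontfun_def)
qed

private lemma functional_linear_combination:
  assumes "\<phi> \<in> bcontfun" "\<psi> \<in> bcontfun"
  shows "\<Lambda> (Bcontfun (\<lambda>z. a *\<^sub>R \<phi> z + b *\<^sub>R \<psi> z)) = a * \<Lambda> (Bcontfun \<phi>) + b * \<Lambda> (Bcontfun \<psi>)"
proof -
  have "(\<lambda>z. a *\<^sub>R \<phi> z + b *\<^sub>R \<psi> z) \<in> bcontfun"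
    by (intro plus_cont scaleR_cont assms)
  then have "Bcontfun (\<lambda>z. a *\<^sub>R \<phi> z + b *\<^sub>R \<psi> z) = a *\<^sub>R Bcontfun \<phi> + b *\<^sub>R Bcontfun \<psi>"
    by (intro bcontfun_eqI) (simp add: apply_Bcontfun assms)
  then show ?thesis
    by (simp add: linear_add[OF lin] linear_scale[OF lin])
qed

lemma complexify_add:
  assumes "\<phi> \<in> bcontfun" "\<psi> \<in> bcontfun"
  shows "complexify \<Lambda> (\<lambda>z. \<phi> z + \<psi> z) = complexify \<Lambda> \<phi> + complexify \<Lambda> \<psi>"
  using functional_linear_combination[OF assms, of 1 1]
    functional_linear_combination[OF assms[THEN bcontfun_linear[OF bounded_linear_cmul]], of 1 \<i> 1 \<i>]
  by (simp add: complexify_def cmul_add complex_eq_iff)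

lemma complexify_cmul:
  assumes "\<phi> \<in> bcontfun"
  shows "complexify \<Lambda> (\<lambda>z. cmul c (\<phi> z)) = c * complexify \<Lambda> \<phi>"
proof -
  have i: "(\<lambda>z. cmul \<i> (\<phi> z)) \<in> bcontfun" by (rule bcontfun_linear[OF bounded_linear_cmul assms])
  have 1: "cmul c M = Re c *\<^sub>R M + Im c *\<^sub>R cmul \<i> M" and
    2: "cmul \<i> (cmul c M) = (- Im c) *\<^sub>R M + Re c *\<^sub>R cmul \<i> M" for M :: "complex^'n^'n"
    by (simp_all add: cmul_def vec_eq_iff complex_eq_iff)
  show ?thesis
    unfolding complexify_def 2 unfolding 1 functional_linear_combination[OF assms i]
    by (simp add: complex_eq_iff)
qed

lemma norm_complexify_le:
  assumes bound: "\<And>\<Phi>. \<Lambda> \<Phi> \<le> E * norm \<Phi>" "0 \<le> E"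
    and \<phi>: "\<phi> \<in> bcontfun" "\<And>z. norm (\<phi> z) \<le> M"
  shows "norm (complexify \<Lambda> \<phi>) \<le> 2 * (E * M)"
proof -
  have *: "\<bar>\<Lambda> (Bcontfun \<phi>)\<bar> \<le> E * M" if "\<phi> \<in> bcontfun" "\<And>z. norm (\<phi> z) \<le> M" for \<phi>
  proof -
    have "norm (Bcontfun \<phi>) \<le> M" by (rule norm_bound) (simp add: apply_Bcontfun that)
    then have "E * norm (Bcontfun \<phi>) \<le> E * M" by (rule mult_left_mono[OF _ bound(2)])
    then show ?thesis
      using bound(1)[of "Bcontfun \<phi>"] bound(1)[of "- Bcontfun \<phi>"] by (simp add: linear_neg[OF lin] abs_le_iff)
  qed
  have "norm (complexify \<Lambda> \<phi>) \<le> \<bar>\<Lambda> (Bcontfun \<phi>)\<bar> + \<bar>\<Lambda> (Bcontfun (\<lambda>z. cmul \<i> (\<phi> z)))\<bar>"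
    using cmod_le[of "complexify \<Lambda> \<phi>"] by (simp add: complexify_def)
  also have "\<dots> \<le> E * M + E * M"
    using \<phi> by (intro add_mono * bcontfun_linear[OF bounded_linear_cmul]) (auto simp: norm_cmul_ii)
  finally show ?thesis by simp
qed

lemma complexify_diff:
  assumes "\<phi> \<in> bcontfun" "\<psi> \<in> bcontfun"
  shows "complexify \<Lambda> (\<lambda>z. \<phi> z - \<psi> z) = complexify \<Lambda> \<phi> - complexify \<Lambda> \<psi>"
  using complexify_add[OF minus_cont[OF assms] assms(2)] by (simp add: algebra_simps)

lemma complexify_tendsto:
  assumes bound: "\<And>\<Phi>. \<Lambda> \<Phi> \<le> E * norm \<Phi>" "0 \<le> E"
    and \<phi>: "\<psi> \<in> bcontfun" "\<And>n. \<phi> n \<in> bcontfun" "uniform_limit UNIV \<phi> \<psi> sequentially"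
  shows "(\<lambda>n. complexify \<Lambda> (\<phi> n)) \<longlonglongrightarrow> complexify \<Lambda> \<psi>"
proof (rule tendstoI)
  fix e :: real assume e: "e > 0"
  define d where "d = e / (2 * E + 1)"
  have d: "d > 0" "2 * (E * d) < e" using e bound(2) by (auto simp: d_def field_simps)
  have "\<forall>\<^sub>F n in sequentially. \<forall>z\<in>UNIV. dist (\<phi> n z) (\<psi> z) < d"
    using \<phi>(3) d(1) unfolding uniform_limit_iff by blast
  then show "\<forall>\<^sub>F n in sequentially. dist (complexify \<Lambda> (\<phi> n)) (complexify \<Lambda> \<psi>) < e"
  proof eventually_elim
    case (elim n)
    have "norm (complexify \<Lambda> (\<lambda>z. \<phi> n z - \<psi> z)) \<le> 2 * (E * d)"
      by (rule norm_complexify_le[OF bound minus_cont[OF \<phi>(2,1)]])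
        (use elim in \<open>auto simp: dist_norm intro: less_imp_le\<close>)
    then show ?case
      using d(2) by (simp add: complexify_diff[OF \<phi>(2,1)] dist_norm)
  qed
qed

text \<open>Where \<open>\<phi>\<close> has real pairings, \<open>\<i>\<close> times
  \<open>\<phi>\<close> and its negative have pairings with real part 0, so the one-sided hypothesis
  makes the imaginary part vanish. Applied to \<open>- \<phi>\<close> it gives the sign of the real
  part.\<close>

lemma complexify_nonneg:
  assumes pos: "\<And>\<Phi>. (\<And>z \<xi>. P z \<xi> \<Longrightarrow> Re (pair11 (apply_bcontfun \<Phi> z) \<xi>) \<le> 0) \<Longrightarrow> \<Lambda> \<Phi> \<le> 0"
    and \<phi>: "\<phi> \<in> bcontfun" "\<And>z \<xi>. P z \<xi> \<Longrightarrow> pair11 (\<phi> z) \<xi> \<in> \<real>\<^sub>\<ge>\<^sub>0"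
  shows "complexify \<Lambda> \<phi> \<in> \<real>\<^sub>\<ge>\<^sub>0"
proof -
  let ?i = "\<lambda>z. cmul \<i> (\<phi> z)"
  have i: "?i \<in> bcontfun" by (rule bcontfun_linear[OF bounded_linear_cmul \<phi>(1)])
  have r: "0 \<le> Re (pair11 (\<phi> z) \<xi>)" "Im (pair11 (\<phi> z) \<xi>) = 0" if "P z \<xi>" for z \<xi>
    using \<phi>(2)[OF that] by (auto simp: complex_nonneg_Reals_iff)
  have "\<Lambda> (- Bcontfun \<phi>) \<le> 0" "\<Lambda> (Bcontfun ?i) \<le> 0" "\<Lambda> (- Bcontfun ?i) \<le> 0"
    by (rule pos; simp add: apply_Bcontfun \<phi>(1) i pair11_minus pair11_cmul r)+
  then show ?thesis
    by (simp add: linear_neg[OF lin] complexify_def complex_nonneg_Reals_iff)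
qed

end

lemma hull_subset_current_supp:
  fixes K :: "(complex^'n::finite) set"
  assumes z0: "z0 \<in> hull_dir \<Gamma> K" "z0 \<notin> K" and K: "compact K"
  shows "\<exists>T. directed_current \<Gamma> T \<and> compact (current_supp T) \<and>
    nonneg_distribution_on (- K) (\<lambda>h. - ddbar_current T h) \<and> z0 \<in> current_supp T"
proof (rule ex_hull_functional[OF z0(1) K])
  fix \<Lambda> :: "((complex^'n) \<Rightarrow>\<^sub>C (complex^'n^'n)) \<Rightarrow> real" and E R
  assume \<Lambda>: "linear \<Lambda>" "\<And>\<Phi>. \<Lambda> \<Phi> \<le> E * norm \<Phi>" "0 \<le> E"
    and pos: "\<And>\<Phi>. (\<And>z \<xi>. norm z \<le> R \<Longrightarrow> \<xi> \<in> \<Gamma> z \<Longrightarrow> Re (pair11 (apply_bcontfun \<Phi> z) \<xi>) \<le> 0) \<Longrightarrow> \<Lambda> \<Phi> \<le> 0"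
    and le: "\<And>\<Phi> u c. test_fun u \<Longrightarrow> apply_bcontfun \<Phi> = ddbar u \<Longrightarrow> (\<And>w. w \<in> K \<Longrightarrow> u w \<le> c) \<Longrightarrow> \<Lambda> \<Phi> \<le> c - u z0"
  define T where "T = complexify \<Lambda>"
  note cx = complexify_add[OF \<Lambda>(1)] complexify_cmul[OF \<Lambda>(1)]
  note tendsto = complexify_tendsto[OF \<Lambda>, folded T_def]
  have nonneg: "T \<phi> \<in> \<real>\<^sub>\<ge>\<^sub>0" if "\<phi> \<in> bcontfun" "\<And>z \<xi>. norm z \<le> R \<Longrightarrow> \<xi> \<in> \<Gamma> z \<Longrightarrow> pair11 (\<phi> z) \<xi> \<in> \<real>\<^sub>\<ge>\<^sub>0" for \<phi>
    unfolding T_def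
    by (rule complexify_nonneg[OF \<Lambda>(1), of "\<lambda>z \<xi>. norm z \<le> R \<and> \<xi> \<in> \<Gamma> z"]) (use pos that in auto)
  have zero: "T (\<lambda>_. 0) = 0"
    using complexify_cmul[OF \<Lambda>(1) bcontfun_test_fun[OF test_fun_zero], of 0] by (simp add: T_def cmul_def zero_vec_def)
  have T: "current11 T"
    unfolding current11_def
  proof (intro conjI allI impI)
    show "T (\<lambda>z. \<phi> z + \<psi> z) = T \<phi> + T \<psi>" if "test_fun \<phi>" "test_fun \<psi>" for \<phi> \<psi>
      unfolding T_def by (rule cx(1)[OF that[THEN bcontfun_test_fun]])
    show "T (\<lambda>z. \<chi> j l. c * \<phi> z $ j $ l) = c * T \<phi>" if "test_fun \<phi>" for c \<phi>
      unfolding T_def by (rule cx(2)[OF bcontfun_test_fun[OF that], unfolded cmul_def])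
    fix \<phi> :: "nat \<Rightarrow> 'n form11" and C
    assume \<phi>: "\<forall>n. test_fun (\<phi> n) \<and> supp (\<phi> n) \<subseteq> C"
      and lim: "\<forall>vs. uniform_limit UNIV (\<lambda>n. iter_deriv vs (\<phi> n)) (\<lambda>_. 0) sequentially"
    have "uniform_limit UNIV \<phi> (\<lambda>_. 0) sequentially"
      using lim[rule_format, of "[]"] by simp
    from tendsto[OF bcontfun_test_fun[OF test_fun_zero] bcontfun_test_fun this] \<phi>
    show "(\<lambda>n. T (\<phi> n)) \<longlonglongrightarrow> 0" by (simp add: zero)
  qed
  have pT: "positive_current T"
    unfolding positive_current_def
    using T nonneg bcontfun_test_fun by (auto simp: positive_form_def)
  have dT: "directed_current \<Gamma> T"
    unfolding directed_current_def nonneg_distribution_on_def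
  proof (intro conjI pT ballI allI impI)
    fix u h :: "complex^'n \<Rightarrow> real" assume u: "u \<in> psh_dir \<Gamma>" and h: "test_fun h" "\<forall>z. 0 \<le> h z"
    let ?\<psi> = "\<lambda>z. h z *\<^sub>R ddbar u z"
    have u2: "Ck 2 u" using u by (simp add: psh_dir_iff)
    have \<psi>: "continuous_on UNIV ?\<psi>" "compact (supp ?\<psi>)"
      by (intro continuous_on_scaleR continuous_on_ddbar[OF u2] Ck_imp_continuous_on[OF test_fun_Ck[OF h(1), of 0]],
          rule compact_supp_subset[OF supp_scaleR compact_supp_test_fun[OF h(1)]])
    note b = bcontfun_compact_supp[OF \<psi>]
    \<comment> \<open>\<open>T\<close> is already given by \<open>\<Lambda>\<close> on bounded
      continuous forms and is continuous there for uniform convergence, so its extension is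
      evaluation.\<close>
    have "wedge_ddbar T u h = T ?\<psi>"
      unfolding wedge_ddbar_def
    proof (rule current_ext_eqI[OF pT \<psi>], rule tendsto[OF b _ uniform_limit_mollify[OF \<psi>]])
      show "mollify (bump_kernel (inverse (real (Suc n)))) ?\<psi> \<in> bcontfun" for n
        by (rule bcontfun_test_fun[OF test_fun_mollify[OF _ \<psi>]]) simp
    qed
    moreover have "T ?\<psi> \<in> \<real>\<^sub>\<ge>\<^sub>0"
    proof (rule nonneg[OF b])
      fix z \<xi> assume "\<xi> \<in> \<Gamma> z"
      then have "0 \<le> h z * levi u z \<xi>" using u h(2) by (simp add: psh_dir_iff)
      then show "pair11 (?\<psi> z) \<xi> \<in> \<real>\<^sub>\<ge>\<^sub>0"
        by (simp add: pair11_scaleR pair11_ddbar[OF u2] complex_nonneg_Reals_iff)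
    qed
    ultimately show "wedge_ddbar T u h \<in> \<real>\<^sub>\<ge>\<^sub>0" by simp
  qed
  have supp: "current_supp T \<subseteq> cball 0 R"
  proof -
    \<comment> \<open>A form that vanishes on the ball of radius \<open>R\<close> meets the
      positivity requirement trivially, and so does its negative.\<close>
    have "T \<phi> = 0" if \<phi>: "test_fun \<phi>" "supp \<phi> \<subseteq> - cball 0 R" for \<phi>
    proof -
      have 0: "\<phi> z = 0" if "norm z \<le> R" for z
        using \<phi>(2) that by (intro not_in_supp) auto
      have "T \<phi> \<in> \<real>\<^sub>\<ge>\<^sub>0" "T (\<lambda>z. - \<phi> z) \<in> \<real>\<^sub>\<ge>\<^sub>0"
        by (rule nonneg; simp add: bcontfun_test_fun \<phi>(1) test_fun_uminus 0 pair11_def)+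
      then show ?thesis
        by (auto simp: current_uminus[OF T \<phi>(1)] complex_nonneg_Reals_iff complex_eq_iff)
    qed
    then have "- cball 0 R \<subseteq> \<Union>{U. open U \<and> (\<forall>\<phi>. test_fun \<phi> \<longrightarrow> supp \<phi> \<subseteq> U \<longrightarrow> T \<phi> = 0)}"
      by (intro Union_upper) auto
    then show ?thesis unfolding current_supp_def by blast
  qed
  have "closed (current_supp T)"
    unfolding current_supp_def closed_def by auto
  then have compact: "compact (current_supp T)"
    using supp by (metis compact_Int_closed compact_cball inf.absorb2)
  \<comment> \<open>\<open>h\<close> vanishes on \<open>K\<close>, so the bound \<open>c = 0\<close>
    is available and gives \<open>- h z0\<close>; the imaginary part is 0 because
    \<open>ddbar h\<close> has real pairings.\<close>
  have dd: "- ddbar_current T h \<in> \<real>\<^sub>\<ge>\<^sub>0 \<and> Re (ddbar_current T h) \<le> - h z0"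
    if h: "test_fun h" "supp h \<subseteq> - K" "\<And>z. 0 \<le> h z" for h :: "complex^'n \<Rightarrow> real"
  proof -
    have h2: "Ck 2 h" by (rule test_fun_Ck[OF h(1)])
    have b: "ddbar h \<in> bcontfun" by (rule bcontfun_test_fun[OF test_fun_ddbar[OF h(1)]])
    have bi: "(\<lambda>z. cmul \<i> (ddbar h z)) \<in> bcontfun"
      by (rule bcontfun_test_fun[OF test_fun_linear[OF bounded_linear_cmul test_fun_ddbar[OF h(1)]]])
    have "\<Lambda> (Bcontfun (ddbar h)) \<le> 0 - h z0"
    proof (rule le[OF h(1) Bcontfun_inverse[OF b]])
      fix w assume "w \<in> K"
      then have "w \<notin> supp h" using h(2) by blast
      then show "h w \<le> 0" by (simp add: not_in_supp)
    qed
    moreover have "\<Lambda> (Bcontfun (\<lambda>z. cmul \<i> (ddbar h z))) \<le> 0" "\<Lambda> (- Bcontfun (\<lambda>z. cmul \<i> (ddbar h z))) \<le> 0"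
      by (rule pos; simp add: Bcontfun_inverse[OF bi] pair11_minus pair11_cmul pair11_ddbar[OF h2])+
    ultimately show ?thesis
      using h(3)[of z0]
      by (auto simp: ddbar_current_def T_def complexify_def linear_neg[OF \<Lambda>(1)] complex_nonneg_Reals_iff)
  qed
  have "z0 \<in> current_supp T"
  proof (rule ccontr)
    assume "z0 \<notin> current_supp T"
    then obtain U where U: "open U" "z0 \<in> U" "\<forall>\<phi>. test_fun \<phi> \<longrightarrow> supp \<phi> \<subseteq> U \<longrightarrow> T \<phi> = 0"
      unfolding current_supp_def by auto
    \<comment> \<open>\<open>z0 \<notin> K\<close> enters here: a cutoff with
      \<open>h z0 = 1\<close> fits inside \<open>U\<close> and off \<open>K\<close>, and for it the
      inequality in \<open>dd\<close> would read \<open>0 \<le> - 1\<close>.\<close>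
    have "open (U \<inter> - K)" "z0 \<in> U \<inter> - K"
      using U z0(2) compact_imp_closed[OF K] by auto
    then obtain r where r: "r > 0" "cball z0 r \<subseteq> U \<inter> - K"
      using open_contains_cball by blast
    have "r / 2 < r" using r by simp
    then obtain h :: "complex^'n \<Rightarrow> real" where h: "test_fun h" "\<And>x. 0 \<le> h x" "\<And>x. h x \<le> 1"
      "\<And>x. x \<in> cball z0 (r / 2) \<Longrightarrow> h x = 1" "supp h \<subseteq> cball z0 r"
      using cutoff_exists[of "r / 2" r z0] by blast
    have "supp (ddbar h) \<subseteq> U"
      using supp_ddbar[OF test_fun_Ck[OF h(1)]] h(5) r(2) by blast
    then have "ddbar_current T h = 0"
      using U(3) test_fun_ddbar[OF h(1)] by (simp add: ddbar_current_def)
    moreover have "h z0 = 1" using h(4)[of z0] r(1) by simp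
    moreover have "supp h \<subseteq> - K" using h(5) r(2) by blast
    ultimately show False using dd[OF h(1) _ h(2)] by simp
  qed
  moreover have "nonneg_distribution_on (- K) (\<lambda>h. - ddbar_current T h)"
    unfolding nonneg_distribution_on_def using dd by blast
  ultimately show ?thesis
    using dT compact by blast
qed

lemma subset_hull_dir: "K \<subseteq> hull_dir \<Gamma> K"
  unfolding hull_dir_def by (auto intro: SUP_upper)

theorem corollary3p5:
  fixes \<Gamma> :: "complex^'n::finite \<Rightarrow> (complex^'n) set" and K :: "(complex^'n) set"
  assumes "\<And>z. cone (\<Gamma> z)" and "\<And>z. closed (\<Gamma> z)" and "\<And>z. \<exists>\<xi>\<in>\<Gamma> z. \<xi> \<noteq> 0"
    and "closed {(z, \<xi>). \<xi> \<in> \<Gamma> z}"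
    and "compact K"
  shows "hull_dir \<Gamma> K =
    (\<Union>{current_supp T | T. directed_current \<Gamma> T \<and> compact (current_supp T) \<and>
          nonneg_distribution_on (- K) (\<lambda>h. - ddbar_current T h)}) \<union> K"
proof (rule equalityI)
  let ?R = "(\<Union>{current_supp T | T. directed_current \<Gamma> T \<and> compact (current_supp T) \<and>
      nonneg_distribution_on (- K) (\<lambda>h. - ddbar_current T h)}) \<union> K"
  show "hull_dir \<Gamma> K \<subseteq> ?R"
    using hull_subset_current_supp[OF _ _ \<open>compact K\<close>, of _ \<Gamma>] by blast
  show "?R \<subseteq> hull_dir \<Gamma> K"
    using current_supp_subset_hull[OF _ _ \<open>compact K\<close>, of \<Gamma>] subset_hull_dir by blast
qed

end
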